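(* Let $\mathbb K$ be a field, $R=\mathbb K[x_1,\dots,x_n]$, and let $I\subseteq R$ be the edge ideal of a cycle. Then $I$ admits a minimal pruned resolution.
   Context: The edge ideal of a simple graph on vertices $x_1,\dots,x_n$ is the ideal generated by the monomials $x_ix_j$ with $\{x_i,x_j\}$ an edge. $G(I)$ denotes the set of minimal monomial generators of a monomial ideal $I$. Pruned resolutions. For a monomial ideal $I$ with minimal generators in a fixed order $m_1,\dots,m_q$ and $\sigma\subseteq\{1,\dots,q\}$ put $m_\sigma=\mathrm{lcm}(m_i: i\in\sigma)$, $m_\emptyset=1$. The Taylor resolution of $R/I$ is supported on the full simplex $X_{\mathrm{Taylor}}$ on $q$ vertices; the face $\sigma$ has homological degree $|\sigma|$ and multidegree the exponent of $m_\sigma$. Pruning algorithm: for $j=1,\dots,q$ successively (step $j$), for every $\sigma\not\ni j$ with $m_\sigma=m_{\sigma\cup\{j\}}$ and such that neither $\sigma$ nor $\sigma\cup\{j\}$ belongs to a previously selected edge, select (prune) the edge $\{\sigma,\sigma\cup\{j\}\}$. The selected edges form a homogeneous acyclic matching on $X_{\mathrm{Taylor}}$, and discrete Morse theory (Batzies–Welker) yields a $\mathbb Z^n$-graded CW-complex, with cells corresponding to the faces in no selected edge (critical faces), supporting a free resolution of $R/I$: the pruned resolution for the given order. Its module in homological degree $i$ is the direct sum of $R(-\deg m_\sigma)$ over critical $\sigma$ with $|\sigma|=i$; so it is minimal iff, for all $i,\alpha$, the number of critical $\sigma$ with $|\sigma|=i$ and multidegree $\alpha$ is $\beta_{i,\alpha}(R/I)$.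 Betti splitting version. $I=J+K$, with $G(I)$ the disjoint union of $G(J)$ and $G(K)$, is a Betti splitting if $\beta_{i,\alpha}(I)=\beta_{i,\alpha}(J)+\beta_{i,\alpha}(K)+\beta_{i-1,\alpha}(J\cap K)$ for all $i$ and $\alpha\in\mathbb Z^n$. Then one may prune separately the faces with vertices in $G(J)$, the faces with vertices in $G(K)$, and the remaining faces (which account for $J\cap K$), and iterate this using Betti splittings of $J$, $K$, $J\cap K$; this is always a partial pruning of $X_{\mathrm{Taylor}}$, and the numbers of generators (pruned Betti numbers) satisfy $\overline\beta_{i,\alpha}(I)=\overline\beta_{i,\alpha}(J)+\overline\beta_{i,\alpha}(K)+\overline\beta_{i-1,\alpha}(J\cap K)$. $I$ admits a minimal pruned resolution if, for some order of the generators, the cellular resolution given by the pruning algorithm or by its iterated Betti splitting version is minimal. Explicitly (recursively, in finitely many steps): either for some order of $G(I)$ the pruned resolution of $R/I$ is minimal, or there is a Betti splitting $I=J+K$ such that $J$, $K$ and $J\cap K$ all admit minimal pruned resolutions. *)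

theory Defs
  imports
    Complex_Main
    "HOL-Library.Poly_Mapping"
    "HOL-Library.Function_Algebras"
    "HOL-Library.Cardinality"
begin

section \<open>Polynomials and monomial ideals\<close>

text \<open>
  The variables are indexed by a finite type \<open>'n\<close>. An exponent vector is a function
  \<open>'n \<Rightarrow> nat\<close> with the pointwise operations, so for a field \<open>'k\<close> the convolution ring below is
  the polynomial ring over \<open>'k\<close> in \<open>CARD('n)\<close> variables. Divisibility of monomials is the
  pointwise order on exponent vectors.
\<close>

type_synonym ('n, 'k) mpoly = "('n \<Rightarrow> nat) \<Rightarrow>\<^sub>0 'k"

definition monom :: "('n \<Rightarrow> nat) \<Rightarrow> ('n, 'k::field) mpoly" where
  "monom m = Poly_Mapping.single m 1"

definition var :: "'n \<Rightarrow> ('n, 'k::field) mpoly" where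
  "var v = monom (\<lambda>w. if w = v then 1 else 0)"

definition ideal_gen :: "('n, 'k::field) mpoly set \<Rightarrow> ('n, 'k) mpoly set" where
  "ideal_gen S = module.span (*) S"

definition monomial_ideal :: "('n, 'k::field) mpoly set \<Rightarrow> bool" where
  "monomial_ideal I \<longleftrightarrow> (\<exists>S. I = ideal_gen (monom ` S))"

text \<open>The set \<open>G(I)\<close>, as a set of exponent vectors.\<close>

definition min_gens :: "('n, 'k::field) mpoly set \<Rightarrow> ('n \<Rightarrow> nat) set" where
  "min_gens I = {m. monom m \<in> I \<and> (\<forall>m'. monom m' \<in> I \<and> m' \<le> m \<longrightarrow> m' = m)}"


section \<open>Multigraded Betti numbers\<close>

text \<open>Multidegrees live in \<open>\<int>\<^sup>n\<close>; the zero polynomial is homogeneous of every multidegree.\<close>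

definition mdeg :: "('n \<Rightarrow> nat) \<Rightarrow> 'n \<Rightarrow> int" where
  "mdeg m = (\<lambda>v. int (m v))"

definition homogeneous :: "('n \<Rightarrow> int) \<Rightarrow> ('n, 'k::field) mpoly \<Rightarrow> bool" where
  "homogeneous \<alpha> f \<longleftrightarrow> (\<forall>t\<in>Poly_Mapping.keys f. mdeg t = \<alpha>)"

definition free_mod :: "nat \<Rightarrow> (nat \<Rightarrow> 'a::zero) set" where
  "free_mod r = {v. \<forall>b\<ge>r. v b = 0}"

definition lin_map ::
  "nat \<Rightarrow> nat \<Rightarrow> (nat \<Rightarrow> nat \<Rightarrow> 'a::semiring_0) \<Rightarrow> (nat \<Rightarrow> 'a) \<Rightarrow> (nat \<Rightarrow> 'a)" where
  "lin_map p q M v = (\<lambda>a. if a < p then \<Sum>b<q. M a b * v b else 0)"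

text \<open>
  Minimal multigraded free resolutions of a module \<open>A/B\<close>, where \<open>B \<subseteq> A\<close> are monomial ideals of
  the polynomial ring \<open>R\<close>; a monomial ideal \<open>I\<close> is the case \<open>A = I\<close>, \<open>B = {0}\<close>, and \<open>R/I\<close> is the
  case \<open>A = UNIV\<close>, \<open>B = I\<close>. The module in homological degree \<open>i\<close> is
  \<open>F\<^sub>i = \<Oplus>\<^bsub>b < r i\<^esub> R(- d i b)\<close>. The augmentation \<open>F\<^sub>0 \<rightarrow> A/B\<close> sends the \<open>b\<close>-th basis vector to the
  class of \<open>\<epsilon> b\<close>, and \<open>\<phi> i\<close> is the matrix of the differential \<open>F\<^bsub>i+1\<^esub> \<rightarrow> F\<^sub>i\<close> (row index first).
  The conjuncts say: the augmentation has degree 0 and is onto; the differentials have degree 0;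
  they have entries in the ideal generated by the variables (minimality); the augmented complex
  is exact at \<open>F\<^sub>0\<close> and at \<open>F\<^bsub>i+1\<^esub>\<close>.
\<close>

definition minimal_free_resolution ::
  "('n, 'k::field) mpoly set \<Rightarrow> ('n, 'k) mpoly set \<Rightarrow> (nat \<Rightarrow> nat) \<Rightarrow> (nat \<Rightarrow> nat \<Rightarrow> 'n \<Rightarrow> int) \<Rightarrow>
    (nat \<Rightarrow> ('n, 'k) mpoly) \<Rightarrow> (nat \<Rightarrow> nat \<Rightarrow> nat \<Rightarrow> ('n, 'k) mpoly) \<Rightarrow> bool" where
  "minimal_free_resolution A B r d \<epsilon> \<phi> \<longleftrightarrow>
     (\<forall>b<r 0. \<epsilon> b \<in> A \<and> homogeneous (d 0 b) (\<epsilon> b)) \<and>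
     A = {(\<Sum>b<r 0. v b * \<epsilon> b) + g | v g. v \<in> free_mod (r 0) \<and> g \<in> B} \<and>
     (\<forall>i. \<forall>a<r i. \<forall>b<r (Suc i). homogeneous (d (Suc i) b - d i a) (\<phi> i a b)) \<and>
     (\<forall>i. \<forall>a<r i. \<forall>b<r (Suc i). \<phi> i a b \<in> ideal_gen (range var)) \<and>
     {v \<in> free_mod (r 0). (\<Sum>b<r 0. v b * \<epsilon> b) \<in> B}
       = lin_map (r 0) (r 1) (\<phi> 0) ` free_mod (r 1) \<and>
     (\<forall>i. {v \<in> free_mod (r (Suc i)). lin_map (r i) (r (Suc i)) (\<phi> i) v = 0}
       = lin_map (r (Suc i)) (r (Suc (Suc i))) (\<phi> (Suc i)) ` free_mod (r (Suc (Suc i))))"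

text \<open>\<open>\<beta>\<^bsub>i,\<alpha>\<^esub>(A/B)\<close>; minimal free resolutions exist and are unique up to isomorphism.\<close>

definition betti ::
  "('n, 'k::field) mpoly set \<Rightarrow> ('n, 'k) mpoly set \<Rightarrow> nat \<Rightarrow> ('n \<Rightarrow> int) \<Rightarrow> nat" where
  "betti A B i \<alpha> = (THE n. \<exists>r d \<epsilon> \<phi>.
     minimal_free_resolution A B r d \<epsilon> \<phi> \<and> n = card {b. b < r i \<and> d i b = \<alpha>})"

abbreviation betti_ideal :: "('n, 'k::field) mpoly set \<Rightarrow> nat \<Rightarrow> ('n \<Rightarrow> int) \<Rightarrow> nat" where
  "betti_ideal I \<equiv> betti I {0}"

abbreviation betti_quotient :: "('n, 'k::field) mpoly set \<Rightarrow> nat \<Rightarrow> ('n \<Rightarrow> int) \<Rightarrow> nat" where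
  "betti_quotient I \<equiv> betti UNIV I"


section \<open>Pruned resolutions\<close>

text \<open>
  The generators \<open>ms\<close> are indexed from 0, and a face of the Taylor simplex is a subset of
  \<open>{..<length ms}\<close>. Inserting 0 makes the lcm over the empty face equal to 1.
\<close>

definition face_lcm :: "('n \<Rightarrow> nat) list \<Rightarrow> nat set \<Rightarrow> 'n \<Rightarrow> nat" where
  "face_lcm ms \<sigma> = (\<lambda>v. Max (insert 0 ((\<lambda>i. (ms ! i) v) ` \<sigma>)))"

text \<open>
  Step \<open>j\<close> of the algorithm, \<open>E\<close> being the set of edges selected so far. The edges selected in
  one step are pairwise disjoint, hence selecting them simultaneously is unambiguous.
\<close>

definition prune_step ::
  "('n \<Rightarrow> nat) list \<Rightarrow> nat set set set \<Rightarrow> nat \<Rightarrow> nat set set set" where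
  "prune_step ms E j = E \<union>
     {{\<sigma>, insert j \<sigma>} | \<sigma>. \<sigma> \<subseteq> {..<length ms} \<and> j \<notin> \<sigma> \<and>
        face_lcm ms \<sigma> = face_lcm ms (insert j \<sigma>) \<and> \<sigma> \<notin> \<Union>E \<and> insert j \<sigma> \<notin> \<Union>E}"

definition pruned_edges :: "('n \<Rightarrow> nat) list \<Rightarrow> nat set set set" where
  "pruned_edges ms = foldl (prune_step ms) {} [0..<length ms]"

definition critical_faces :: "('n \<Rightarrow> nat) list \<Rightarrow> nat set set" where
  "critical_faces ms = {\<sigma>. \<sigma> \<subseteq> {..<length ms} \<and> \<sigma> \<notin> \<Union>(pruned_edges ms)}"

definition minimal_pruned_order ::
  "('n, 'k::field) mpoly set \<Rightarrow> ('n \<Rightarrow> nat) list \<Rightarrow> bool" where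
  "minimal_pruned_order I ms \<longleftrightarrow> distinct ms \<and> set ms = min_gens I \<and>
     (\<forall>i \<alpha>. card {\<sigma> \<in> critical_faces ms. card \<sigma> = i \<and> mdeg (face_lcm ms \<sigma>) = \<alpha>}
            = betti_quotient I i \<alpha>)"

definition betti_splitting ::
  "('n, 'k::field) mpoly set \<Rightarrow> ('n, 'k) mpoly set \<Rightarrow> ('n, 'k) mpoly set \<Rightarrow> bool" where
  "betti_splitting I J K \<longleftrightarrow>
     monomial_ideal I \<and> monomial_ideal J \<and> monomial_ideal K \<and>
     I = {f + g | f g. f \<in> J \<and> g \<in> K} \<and>
     min_gens I = min_gens J \<union> min_gens K \<and> min_gens J \<inter> min_gens K = {} \<and>
     (\<forall>i \<alpha>. betti_ideal I i \<alpha> = betti_ideal J i \<alpha> + betti_ideal K i \<alpha>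
            + (if i = 0 then 0 else betti_ideal (J \<inter> K) (i - 1) \<alpha>))"

inductive admits_minimal_pruned_resolution :: "('n, 'k::field) mpoly set \<Rightarrow> bool" where
  pruned: "monomial_ideal I \<Longrightarrow> minimal_pruned_order I ms \<Longrightarrow> admits_minimal_pruned_resolution I"
| splitting: "betti_splitting I J K \<Longrightarrow> admits_minimal_pruned_resolution J \<Longrightarrow>
    admits_minimal_pruned_resolution K \<Longrightarrow> admits_minimal_pruned_resolution (J \<inter> K) \<Longrightarrow>
    admits_minimal_pruned_resolution I"


section \<open>Edge ideals and cycles\<close>

text \<open>A simple graph on the vertex set \<open>UNIV :: 'n set\<close> is given by its set of edges.\<close>

definition simple_graph :: "'n set set \<Rightarrow> bool" where
  "simple_graph E \<longleftrightarrow> (\<forall>e\<in>E. card e = 2)"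

definition edge_ideal :: "'n set set \<Rightarrow> ('n, 'k::field) mpoly set" where
  "edge_ideal E = ideal_gen {var u * var v | u v. u \<noteq> v \<and> {u, v} \<in> E}"

text \<open>A cycle through all the vertices, taken in an arbitrary cyclic order \<open>p 0, p 1, \<dots>\<close>.\<close>

definition cycle_graph :: "'n::finite set set \<Rightarrow> bool" where
  "cycle_graph E \<longleftrightarrow> simple_graph E \<and> CARD('n) \<ge> 3 \<and>
     (\<exists>p. bij_betw p {..<CARD('n)} (UNIV :: 'n set) \<and>
          E = {{p i, p (Suc i mod CARD('n))} | i. i < CARD('n)})"

end

theory Submission
  imports Defs
begin

text \<open>
  If \<open>I = J + K\<close> and no multidegree occurs in the same homological degree of the minimal resolutions
  of \<open>J \<inter> K\<close> and of \<open>J\<close> or \<open>K\<close>, then the comparison maps lifting the inclusions of \<open>J \<inter> K\<close> have no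
  unit entries. Their mapping cone is then a minimal resolution of \<open>I\<close>, so \<open>I = J + K\<close> is a Betti
  splitting. The edge ideal of a cycle is reduced to principal ideals by such splittings: for a
  vertex \<open>v\<close> with neighbours \<open>u\<close> and \<open>w\<close>, let \<open>J = v (u, w)\<close>, so that \<open>K\<close> is the edge ideal of a path
  from \<open>u\<close> to \<open>w\<close>. The ideal \<open>J \<inter> K = v ((u, w) \<inter> K)\<close> is in turn the sum of its parts divisible by
  \<open>u\<close> and by \<open>w\<close>, whose intersection is \<open>u v w\<close> times the edge ideal of the cycle obtained by
  joining the ends of the path that remains after deleting \<open>u\<close>, \<open>v\<close> and \<open>w\<close>.
\<close>

section \<open>Linear maps between coordinate spaces with graded bases\<close>

text \<open>Two obstacles shape the argument. \<open>betti\<close> is a definite description, so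
  existence and uniqueness of minimal resolutions must be available for every ideal that occurs.
  Both come from resolutions by scalar matrices: a polynomial homogeneous in a multidegree is a
  scalar times one monomial, and a graded complex is exact iff it is exact in each degree.

  The other obstacle is the choice of J. If J were a single edge of the cycle, the path K would
  still pass through all vertices, and supports could not separate the multidegrees of J \<inter> K
  from those of K. With J = v (u, w) the vertex v is absent from K but divides all of J \<inter> K.
  The multidegrees of J lie inside {u, v, w}, while each edge of K reaches a further vertex as soon
  as the cycle has at least four vertices. So supports alone decide disjointness, except for the
  triangle: there uvw occurs both in J and in J \<inter> K, and only the homological degrees tell
  the two apart.\<close>

definition lin :: "(('a \<Rightarrow> 'k::field) \<Rightarrow> ('b \<Rightarrow> 'k)) \<Rightarrow> bool" where
  "lin T \<longleftrightarrow> (\<forall>v w. T (v + w) = T v + T w) \<and> (\<forall>c v. T (\<lambda>a. c * v a) = (\<lambda>b. c * T v b))"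

definition basis :: "'b \<Rightarrow> 'b \<Rightarrow> 'k::field" where
  "basis b = (\<lambda>a. if a = b then 1 else 0)"

text \<open>The component in degree \<gamma> of a free module with generators in degrees
  \<open>d b\<close>: a generator below \<gamma> has exactly one monomial multiple there, so only
  its scalar is recorded.\<close>

definition deg_part :: "'b set \<Rightarrow> ('b \<Rightarrow> 'p::order) \<Rightarrow> 'p \<Rightarrow> ('b \<Rightarrow> 'k::field) set" where
  "deg_part B d \<gamma> = {v. \<forall>b. v b \<noteq> 0 \<longrightarrow> b \<in> B \<and> d b \<le> \<gamma>}"

lemma linI:
  assumes "\<And>v w. T (v + w) = T v + T w" "\<And>c v. T (\<lambda>a. c * v a) = (\<lambda>b. c * T v b)"
  shows "lin T"
  using assms unfolding lin_def by blast

lemma lin_add: "lin T \<Longrightarrow> T (v + w) = T v + T w"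
  by (simp add: lin_def)

lemma lin_scale: "lin T \<Longrightarrow> T (\<lambda>a. c * v a) = (\<lambda>b. c * T v b)"
  by (simp add: lin_def)

lemma lin_zero: "lin T \<Longrightarrow> T 0 = 0"
  using lin_scale[of T 0 0] by (simp add: zero_fun_def)

lemma lin_uminus:
  assumes "lin T"
  shows "T (- v) = - T v"
proof -
  have "(\<lambda>a. - 1 * v a) = - v" "(\<lambda>b. - 1 * T v b) = - T v" by (simp_all add: fun_eq_iff)
  then show ?thesis using lin_scale[OF assms, of "- 1" v] by (simp only:)
qed

lemma lin_diff: "lin T \<Longrightarrow> T (v - w) = T v - T w"
  unfolding diff_conv_add_uminus by (simp only: lin_add lin_uminus)

lemma lin_sum:
  assumes "lin T" "finite S"
  shows "T (\<lambda>a. \<Sum>b\<in>S. x b * w b a) = (\<lambda>a. \<Sum>b\<in>S. x b * T (w b) a)"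
  using assms(2)
proof (induction S rule: finite_induct)
  case empty
  then show ?case using lin_zero[OF assms(1)] by (simp add: zero_fun_def)
next
  case (insert s S)
  have "(\<lambda>a. \<Sum>b\<in>insert s S. x b * w b a) = (\<lambda>a. x s * w s a) + (\<lambda>a. \<Sum>b\<in>S. x b * w b a)"
    using insert by (auto simp: fun_eq_iff)
  then show ?case using insert
    by (simp only: lin_add[OF assms(1)] lin_scale[OF assms(1)]) (simp add: fun_eq_iff)
qed

lemma lin_expand:
  assumes "lin T" "finite B" "v \<in> deg_part B d \<gamma>"
  shows "T v = (\<lambda>a. \<Sum>b\<in>B. v b * T (basis b) a)"
proof -
  have "v = (\<lambda>a. \<Sum>b\<in>B. v b * basis b a)"
  proof
    fix a
    have "(\<Sum>b\<in>B. v b * basis b a) = (\<Sum>b\<in>B. if a = b then v b else 0)"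
      by (rule sum.cong) (auto simp: basis_def)
    then show "v a = (\<Sum>b\<in>B. v b * basis b a)"
      using assms(2,3) by (auto simp: deg_part_def)
  qed
  then show ?thesis using lin_sum[OF assms(1,2), of v basis] by simp
qed

lemma lin_cong_basis:
  assumes "lin T" "lin T'" "finite B" "v \<in> deg_part B d \<gamma>"
    and "\<And>b. b \<in> B \<Longrightarrow> d b \<le> \<gamma> \<Longrightarrow> T (basis b) = T' (basis b)"
  shows "T v = T' v"
proof -
  have "v b * T (basis b) a = v b * T' (basis b) a" if "b \<in> B" for a b
    using assms(4,5) that by (cases "v b = 0") (auto simp: deg_part_def)
  then show ?thesis
    unfolding lin_expand[OF assms(1,3,4)] lin_expand[OF assms(2,3,4)] by (intro ext sum.cong) auto
qed

lemma deg_part_zero [simp]: "0 \<in> deg_part B d \<gamma>"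
  by (simp add: deg_part_def)

lemma deg_part_add: "v \<in> deg_part B d \<gamma> \<Longrightarrow> w \<in> deg_part B d \<gamma> \<Longrightarrow> v + w \<in> deg_part B d \<gamma>"
  unfolding deg_part_def mem_Collect_eq plus_fun_apply by (metis add_0)

lemma deg_part_uminus: "v \<in> deg_part B d \<gamma> \<Longrightarrow> - v \<in> deg_part B d \<gamma>"
  by (simp add: deg_part_def)

lemma deg_part_diff: "v \<in> deg_part B d \<gamma> \<Longrightarrow> w \<in> deg_part B d \<gamma> \<Longrightarrow> v - w \<in> deg_part B d \<gamma>"
  unfolding deg_part_def mem_Collect_eq minus_apply by (metis diff_zero)

lemma deg_part_scale: "v \<in> deg_part B d \<gamma> \<Longrightarrow> (\<lambda>a. c * v a) \<in> deg_part B d \<gamma>"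
  by (simp add: deg_part_def)

lemma basis_deg_part: "b \<in> B \<Longrightarrow> d b \<le> \<gamma> \<Longrightarrow> basis b \<in> deg_part B d \<gamma>"
  by (auto simp: deg_part_def basis_def)

lemma deg_part_sum:
  assumes "\<And>b. b \<in> S \<Longrightarrow> x b \<noteq> 0 \<Longrightarrow> w b \<in> deg_part B d \<gamma>"
  shows "(\<lambda>a. \<Sum>b\<in>S. x b * w b a) \<in> deg_part B d \<gamma>"
  unfolding deg_part_def
proof (intro CollectI allI impI)
  fix a assume "(\<Sum>b\<in>S. x b * w b a) \<noteq> 0"
  then obtain b where "b \<in> S" "x b * w b a \<noteq> 0" by (meson sum.not_neutral_contains_not_neutral)
  then show "a \<in> B \<and> d a \<le> \<gamma>" using assms[of b] by (auto simp: deg_part_def)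
qed

lemma lin_deg_part:
  assumes "lin T" "finite B" "v \<in> deg_part B d \<gamma>"
    and "\<And>b. b \<in> B \<Longrightarrow> T (basis b) \<in> deg_part B' d' (d b)"
  shows "T v \<in> deg_part B' d' \<gamma>"
  unfolding lin_expand[OF assms(1-3)]
proof (rule deg_part_sum)
  fix b assume "b \<in> B" "v b \<noteq> 0"
  then show "T (basis b) \<in> deg_part B' d' \<gamma>"
    using assms(3,4) by (auto simp: deg_part_def intro: order_trans)
qed

lemma lin_extend:
  assumes "finite B"
  obtains h where "lin h" "\<And>b. b \<in> B \<Longrightarrow> h (basis b) = w b"
proof
  let ?h = "\<lambda>v a. \<Sum>b\<in>B. v b * w b a"
  show "lin ?h"
    by (rule linI) (auto simp: fun_eq_iff algebra_simps sum.distrib sum_distrib_left)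
  fix b assume "b \<in> B"
  have "(\<Sum>b'\<in>B. basis b b' * w b' a) = (\<Sum>b'\<in>B. if b = b' then w b a else 0)" for a
    by (rule sum.cong) (auto simp: basis_def)
  then show "?h (basis b) = w b" using assms \<open>b \<in> B\<close> by simp
qed

lemma lin_compose: "lin S \<Longrightarrow> lin T \<Longrightarrow> lin (\<lambda>v. S (T v))"
  by (simp add: lin_def)

lemma lin_minus: "lin S \<Longrightarrow> lin T \<Longrightarrow> lin (\<lambda>v. S v - T v)"
  by (simp add: lin_def fun_eq_iff algebra_simps)

text \<open>Projectivity of free modules in graded form: preimages are chosen for basis vectors in
  their own degrees, and a single map \<open>h\<close> then works in all degrees because
  \<open>deg_part\<close> grows with \<gamma>.\<close>

lemma lin_lift:
  fixes d :: "'b \<Rightarrow> 'p::order"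
    and D :: "('c \<Rightarrow> 'k::field) \<Rightarrow> ('a \<Rightarrow> 'k)" and T :: "('b \<Rightarrow> 'k) \<Rightarrow> ('a \<Rightarrow> 'k)"
  assumes "finite B" "lin D" "lin T"
    and "\<And>b. b \<in> B \<Longrightarrow> T (basis b) \<in> D ` deg_part B' d' (d b)"
  shows "\<exists>h. lin h \<and> (\<forall>\<gamma>. \<forall>v\<in>deg_part B d \<gamma>. h v \<in> deg_part B' d' \<gamma> \<and> D (h v) = T v)"
proof -
  have "\<forall>b. \<exists>w. b \<in> B \<longrightarrow> w \<in> deg_part B' d' (d b) \<and> D w = T (basis b)"
    using assms(4) by (metis imageE)
  then obtain w where w: "\<And>b. b \<in> B \<Longrightarrow> w b \<in> deg_part B' d' (d b) \<and> D (w b) = T (basis b)"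
    by metis
  obtain h where h: "lin h" "\<And>b. b \<in> B \<Longrightarrow> h (basis b) = w b"
    using lin_extend[OF assms(1), of w] by metis
  show ?thesis
  proof (intro exI conjI allI ballI)
    show "lin h" by fact
    fix \<gamma> and v :: "'b \<Rightarrow> 'k" assume v: "v \<in> deg_part B d \<gamma>"
    show "h v \<in> deg_part B' d' \<gamma>"
      using lin_deg_part[OF h(1) assms(1) v] h(2) w by simp
    show "D (h v) = T v"
      using lin_cong_basis[OF lin_compose[OF assms(2) h(1)] assms(3,1) v] h(2) w by simp
  qed
qed

section \<open>Dimension counting in function spaces\<close>

lemma vector_space_fun: "vector_space (\<lambda>(c::'k::field) (v::'b \<Rightarrow> 'k) b. c * v b)"
  by unfold_locales (auto simp: fun_eq_iff algebra_simps)

interpretation fun_space: vector_space "\<lambda>(c::'k::field) (v::'b \<Rightarrow> 'k) b. c * v b"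
  by (rule vector_space_fun)

text \<open>An identity matrix of size \<open>card S\<close> that factors through \<open>S'\<close>
  has rank at most \<open>card S'\<close>: the unit vectors indexed by \<open>S\<close> lie in the
  span of the vectors \<open>y c\<close>.\<close>

lemma card_le_of_left_inverse:
  fixes X Y :: "'b \<Rightarrow> 'c \<Rightarrow> 'k::field"
  assumes "finite S" "finite S'"
    and inv: "\<And>a b. a \<in> S \<Longrightarrow> b \<in> S \<Longrightarrow> (\<Sum>c\<in>S'. X b c * Y a c) = (if a = b then 1 else 0)"
  shows "card S \<le> card S'"
proof -
  \<comment> \<open>Cut off outside \<open>S\<close>, so that the expansion of
    \<open>basis b\<close> holds at every argument and not only on \<open>S\<close>.\<close>
  define y where "y c = (\<lambda>a. if a \<in> S then Y a c else 0)" for c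
  have sum_apply: "(\<Sum>c\<in>A. g c) a = (\<Sum>c\<in>A. g c a)" for A and g :: "'x \<Rightarrow> 'b \<Rightarrow> 'k" and a
    by (induction A rule: infinite_finite_induct) auto
  have inj: "inj_on (basis :: 'b \<Rightarrow> 'b \<Rightarrow> 'k) S"
    by (auto simp: inj_on_def basis_def fun_eq_iff)
  have "basis b = (\<Sum>c\<in>S'. (\<lambda>a. X b c * y c a))" if "b \<in> S" for b
  proof
    fix a
    show "basis b a = (\<Sum>c\<in>S'. (\<lambda>a. X b c * y c a)) a"
    proof (cases "a \<in> S")
      case True
      then show ?thesis using inv[OF True that] by (simp add: sum_apply y_def basis_def)
    next
      case False
      then show ?thesis using that by (auto simp: sum_apply y_def basis_def)
    qed
  qed
  moreover have "(\<Sum>c\<in>S'. (\<lambda>a. X b c * y c a)) \<in> fun_space.span (y ` S')" for b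
    by (rule fun_space.span_sum, rule fun_space.span_scale, rule fun_space.span_base) auto
  ultimately have span: "basis ` S \<subseteq> fun_space.span (y ` S')"
    by auto
  have "fun_space.independent (basis ` S :: ('b \<Rightarrow> 'k) set)"
  proof (rule fun_space.independent_if_scalars_zero)
    show "finite (basis ` S)" using assms(1) by simp
    fix f :: "('b \<Rightarrow> 'k) \<Rightarrow> 'k" and x :: "'b \<Rightarrow> 'k"
    assume "(\<Sum>x\<in>basis ` S. (\<lambda>b. f x * x b)) = 0" and "x \<in> basis ` S"
    then obtain b where b: "b \<in> S" "x = basis b" by blast
    have "0 = (\<Sum>x\<in>basis ` S. (\<lambda>b. f x * x b)) b"
      using \<open>(\<Sum>x\<in>basis ` S. (\<lambda>b. f x * x b)) = 0\<close> by simp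
    also have "\<dots> = (\<Sum>c\<in>S. f (basis c) * basis c b)"
      by (simp add: sum_apply sum.reindex[OF inj])
    also have "\<dots> = (\<Sum>c\<in>S. if b = c then f (basis c) else 0)"
      by (rule sum.cong) (auto simp: basis_def)
    also have "\<dots> = f (basis b)" using b assms(1) by simp
    finally show "f x = 0" using b by simp
  qed
  then have "card (basis ` S :: ('b \<Rightarrow> 'k) set) \<le> card (y ` S')"
    using fun_space.independent_span_bound[OF _ _ span] assms(2) by auto
  then show ?thesis using card_image[OF inj] card_image_le[OF assms(2), of y] by linarith
qed

section \<open>Graded resolutions over the coefficient field\<close>

text \<open>
  A \<open>\<int>\<^sup>n\<close>-graded free module \<open>\<Oplus> R(-d b)\<close> has in degree \<open>\<gamma>\<close> the basis \<open>{b. d b \<le> \<gamma>}\<close>, and a map of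
  degree 0 between such modules is given by a single scalar matrix whose \<open>(a, b)\<close>-entry vanishes
  unless \<open>d a \<le> d b\<close>. The following structure is thus a minimal free resolution of \<open>A/B\<close>, where \<open>P\<close>
  and \<open>Q\<close> are the sets of degrees of the monomials in \<open>A\<close> and in \<open>B\<close>.
\<close>

definition cycles ::
  "(nat \<Rightarrow> 'b set) \<Rightarrow> (nat \<Rightarrow> 'b \<Rightarrow> 'p::order) \<Rightarrow> (('b \<Rightarrow> 'k::field) \<Rightarrow> (unit \<Rightarrow> 'k)) \<Rightarrow>
    (nat \<Rightarrow> ('b \<Rightarrow> 'k) \<Rightarrow> ('b \<Rightarrow> 'k)) \<Rightarrow> 'p set \<Rightarrow> nat \<Rightarrow> 'p \<Rightarrow> ('b \<Rightarrow> 'k) set" where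
  "cycles B d e D Q i \<gamma> = {v \<in> deg_part (B i) (d i) \<gamma>.
     case i of 0 \<Rightarrow> \<gamma> \<in> Q \<or> e v = 0 | Suc j \<Rightarrow> D j v = 0}"

text \<open>A component of A/B has dimension at most one, so \<open>unit \<Rightarrow> 'k\<close>
  can serve as the target of the augmentation in all degrees. In degrees of \<open>Q\<close> the
  component is zero; there everything at index 0 is a cycle, and surjectivity is asked only outside
  \<open>Q\<close>.\<close>

locale graded_resolution =
  fixes B :: "nat \<Rightarrow> 'b set" and d :: "nat \<Rightarrow> 'b \<Rightarrow> 'p::order"
    and e :: "('b \<Rightarrow> 'k::field) \<Rightarrow> (unit \<Rightarrow> 'k)" and D :: "nat \<Rightarrow> ('b \<Rightarrow> 'k) \<Rightarrow> ('b \<Rightarrow> 'k)"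
    and P Q :: "'p set"
  assumes fin: "finite (B i)"
    and lin_e: "lin e"
    and lin_D: "lin (D i)"
    and e_degree: "v \<in> deg_part (B 0) (d 0) \<gamma> \<Longrightarrow> e v \<noteq> 0 \<Longrightarrow> \<gamma> \<in> P"
    and e_onto: "\<gamma> \<in> P \<Longrightarrow> \<gamma> \<notin> Q \<Longrightarrow> \<exists>v\<in>deg_part (B 0) (d 0) \<gamma>. e v = 1"
    and minimal: "b \<in> B (Suc i) \<Longrightarrow> a \<in> B i \<Longrightarrow> d i a = d (Suc i) b \<Longrightarrow> D i (basis b) a = 0"
    and exact: "D i ` deg_part (B (Suc i)) (d (Suc i)) \<gamma> = cycles B d e D Q i \<gamma>"
begin

abbreviation Z :: "nat \<Rightarrow> 'p \<Rightarrow> ('b \<Rightarrow> 'k) set" where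
  "Z \<equiv> cycles B d e D Q"

abbreviation F :: "nat \<Rightarrow> 'p \<Rightarrow> ('b \<Rightarrow> 'k) set" where
  "F i \<equiv> deg_part (B i) (d i)"

lemma D_cycle: "v \<in> F (Suc i) \<gamma> \<Longrightarrow> D i v \<in> Z i \<gamma>"
  using exact by blast

lemma Z_F: "v \<in> Z i \<gamma> \<Longrightarrow> v \<in> F i \<gamma>"
  by (simp add: cycles_def)

lemma Z_0: "v \<in> Z 0 \<gamma> \<longleftrightarrow> v \<in> F 0 \<gamma> \<and> (\<gamma> \<in> Q \<or> e v = 0)"
  by (simp add: cycles_def)

lemma Z_Suc: "v \<in> Z (Suc i) \<gamma> \<longleftrightarrow> v \<in> F (Suc i) \<gamma> \<and> D i v = 0"
  by (simp add: cycles_def)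

lemma D_F: "v \<in> F (Suc i) \<gamma> \<Longrightarrow> D i v \<in> F i \<gamma>"
  using D_cycle Z_F by blast

lemma D_D: "v \<in> F (Suc (Suc i)) \<gamma> \<Longrightarrow> D i (D (Suc i) v) = 0"
  using D_cycle Z_Suc by blast

text \<open>A generator of degree below \<gamma> maps to entries of degree below \<gamma>, and one
  of degree \<gamma> has no entry of degree \<gamma> by \<open>minimal\<close>.\<close>

lemma minimal_vector:
  assumes "v \<in> F (Suc i) \<gamma>" "a \<in> B i" "d i a = \<gamma>"
  shows "D i v a = 0"
proof -
  have "v b * D i (basis b) a = 0" if b: "b \<in> B (Suc i)" for b
  proof (cases "v b = 0")
    case False
    then have le: "d (Suc i) b \<le> \<gamma>" using assms(1) by (auto simp: deg_part_def)
    have "D i (basis b) \<in> F i (d (Suc i) b)" using D_F basis_deg_part[OF b] by blast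
    then have "D i (basis b) a = 0"
      using le minimal[OF b assms(2)] assms(3) unfolding deg_part_def by fastforce
    then show ?thesis by simp
  qed simp
  then show ?thesis unfolding lin_expand[OF lin_D fin assms(1)] by (intro sum.neutral) blast
qed

end

text \<open>A chain map over the map of modules induced by inclusions of the ideals.\<close>

definition comparison_map where
  "comparison_map B d e D B' d' e' D' Q' f \<longleftrightarrow>
     (\<forall>i. lin (f i)) \<and>
     (\<forall>i \<gamma>. \<forall>v\<in>deg_part (B i) (d i) \<gamma>. f i v \<in> deg_part (B' i) (d' i) \<gamma>) \<and>
     (\<forall>\<gamma>. \<forall>v\<in>deg_part (B 0) (d 0) \<gamma>. \<gamma> \<in> Q' \<or> e' (f 0 v) = e v) \<and>
     (\<forall>i \<gamma>. \<forall>v\<in>deg_part (B (Suc i)) (d (Suc i)) \<gamma>. D' i (f (Suc i) v) = f i (D i v))"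

lemma comparison_mapD:
  assumes "comparison_map B d e D B' d' e' D' Q' f"
  shows "lin (f i)"
    and "v \<in> deg_part (B i) (d i) \<gamma> \<Longrightarrow> f i v \<in> deg_part (B' i) (d' i) \<gamma>"
    and "u \<in> deg_part (B 0) (d 0) \<gamma> \<Longrightarrow> \<gamma> \<notin> Q' \<Longrightarrow> e' (f 0 u) = e u"
    and "w \<in> deg_part (B (Suc i)) (d (Suc i)) \<gamma> \<Longrightarrow> D' i (f (Suc i) w) = f i (D i w)"
  using assms unfolding comparison_map_def by blast+

text \<open>The comparison theorem: the lifts are chosen one homological degree at a time, using
  freeness of the source and exactness of the target.\<close>

lemma comparison_map_exists:
  fixes B :: "nat \<Rightarrow> 'b set" and B' :: "nat \<Rightarrow> 'c set" and d :: "nat \<Rightarrow> 'b \<Rightarrow> 'p::order"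
    and e :: "('b \<Rightarrow> 'k::field) \<Rightarrow> (unit \<Rightarrow> 'k)"
  assumes "graded_resolution B d e D P Q" "graded_resolution B' d' e' D' P' Q'"
    and PQ: "P \<subseteq> P'" "Q \<subseteq> Q'" and up: "\<And>\<gamma> \<delta>. \<gamma> \<in> Q' \<Longrightarrow> \<gamma> \<le> \<delta> \<Longrightarrow> \<delta> \<in> Q'"
  obtains f where "comparison_map B d e D B' d' e' D' Q' f"
proof -
  interpret R: graded_resolution B d e D P Q by fact
  interpret R': graded_resolution B' d' e' D' P' Q' by fact
  \<comment> \<open>Mapping cycles to cycles belongs to the invariant: by exactness of the target it
    puts the image of \<open>D i (basis b)\<close> into the range of \<open>D' i\<close>, so that
    the next lift exists.\<close>
  define good where "good i f \<longleftrightarrow> lin f \<and> (\<forall>\<gamma>. \<forall>v\<in>R.F i \<gamma>. f v \<in> R'.F i \<gamma>) \<and>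
    (\<forall>\<gamma>. \<forall>v\<in>R.Z i \<gamma>. f v \<in> R'.Z i \<gamma>) \<and>
    (i = 0 \<longrightarrow> (\<forall>\<gamma>. \<forall>v\<in>R.F 0 \<gamma>. \<gamma> \<in> Q' \<or> e' (f v) = e v))" for i f
  define comm where
    "comm i f g \<longleftrightarrow> (\<forall>\<gamma>. \<forall>v\<in>R.F (Suc i) \<gamma>. D' i (g v) = f (D i v))" for i f g
  have "\<exists>f. \<forall>i. good i (f i) \<and> comm i (f i) (f (Suc i))"
  proof (rule dependent_nat_choice)
    \<comment> \<open>In degrees of \<open>Q'\<close> the target module is zero and 0 is a lift;
      elsewhere a multiple of a vector with augmentation 1 is taken.\<close>
    have "\<exists>w. b \<in> B 0 \<longrightarrow> w \<in> R'.F 0 (d 0 b) \<and> (d 0 b \<in> Q' \<or> e' w = e (basis b))" for b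
    proof (cases "b \<notin> B 0 \<or> d 0 b \<in> Q' \<or> e (basis b) = 0")
      case True
      then show ?thesis using deg_part_zero lin_zero[OF R'.lin_e] by metis
    next
      case False
      then have "d 0 b \<in> P' - Q'" using R.e_degree[OF basis_deg_part] PQ by blast
      then obtain v where v: "v \<in> R'.F 0 (d 0 b)" "e' v = 1" using R'.e_onto by blast
      have "e' (\<lambda>a. e (basis b) () * v a) = e (basis b)"
        using lin_scale[OF R'.lin_e, of _ v] v(2) by (simp add: fun_eq_iff)
      then show ?thesis using deg_part_scale[OF v(1)] by blast
    qed
    then obtain w where w: "\<And>b. b \<in> B 0 \<Longrightarrow>
      w b \<in> R'.F 0 (d 0 b) \<and> (d 0 b \<in> Q' \<or> e' (w b) = e (basis b))" by metis
    obtain f where f: "lin f" "\<And>b. b \<in> B 0 \<Longrightarrow> f (basis b) = w b"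
      using lin_extend[OF R.fin] by metis
    have "f v \<in> R'.F 0 \<gamma>" if "v \<in> R.F 0 \<gamma>" for v \<gamma>
      using lin_deg_part[OF f(1) R.fin that] f(2) w by simp
    moreover have e: "e' (f v) = e v" if "v \<in> R.F 0 \<gamma>" "\<gamma> \<notin> Q'" for v \<gamma>
    proof (rule lin_cong_basis[OF lin_compose[OF R'.lin_e f(1)] R.lin_e R.fin that(1)])
      fix b assume "b \<in> B 0" "d 0 b \<le> \<gamma>"
      then show "e' (f (basis b)) = e (basis b)"
        using f(2)[of b] w[of b] up[of "d 0 b" \<gamma>] that(2) by auto
    qed
    ultimately have "good 0 f"
      unfolding good_def using f(1) PQ(2) by (auto simp: R.Z_0 R'.Z_0)
    then show "\<exists>f. good 0 f" by blast
  next
    fix f i assume "good i f"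
    then have f: "lin f" "\<And>v \<gamma>. v \<in> R.Z i \<gamma> \<Longrightarrow> f v \<in> R'.Z i \<gamma>"
      unfolding good_def by auto
    have lift: "f (D i (basis b)) \<in> D' i ` R'.F (Suc i) (d (Suc i) b)" if "b \<in> B (Suc i)" for b
      unfolding R'.exact by (intro f(2) R.D_cycle basis_deg_part that order_refl)
    obtain g where g: "lin g" "\<And>\<gamma> v. v \<in> R.F (Suc i) \<gamma> \<Longrightarrow> g v \<in> R'.F (Suc i) \<gamma>"
        "\<And>\<gamma> v. v \<in> R.F (Suc i) \<gamma> \<Longrightarrow> D' i (g v) = f (D i v)"
      using lin_lift[OF R.fin R'.lin_D lin_compose[OF f(1) R.lin_D] lift] by blast
    have "D' i (g v) = 0" if "v \<in> R.Z (Suc i) \<gamma>" for v \<gamma>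
      using that g(3)[of v \<gamma>] lin_zero[OF f(1)] unfolding R.Z_Suc by simp
    then have "good (Suc i) g \<and> comm i f g"
      unfolding good_def comm_def using g R.Z_F by (auto simp: R'.Z_Suc)
    then show "\<exists>g. good (Suc i) g \<and> comm i f g" by blast
  qed
  then obtain f where "\<And>i. good i (f i) \<and> comm i (f i) (f (Suc i))" by blast
  then have "comparison_map B d e D B' d' e' D' Q' f"
    unfolding comparison_map_def good_def comm_def by auto
  then show thesis by (rule that)
qed

section \<open>Uniqueness of the generator degrees of a minimal resolution\<close>

context graded_resolution
begin

text \<open>A self-comparison differs from the identity by a null-homotopic map
  \<open>t = D h + h D\<close>. Both summands vanish between generators of equal degree, because D
  does so by minimality and neither h nor D raises degrees.\<close>

lemma self_comparison_block:
  assumes u: "comparison_map B d e D B d e D Q u"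
    and Q_up: "\<And>\<gamma> \<delta>. \<gamma> \<in> Q \<Longrightarrow> \<gamma> \<le> \<delta> \<Longrightarrow> \<delta> \<in> Q"
    and "a \<in> B i" "b \<in> B i" "d i a = d i b"
  shows "u i (basis b) a = basis b a"
proof -
  define t where "t i v = u i v - v" for i v
  have lin_t: "lin (t i)" for i
    using u lin_minus[of "u i" "\<lambda>v. v"] unfolding comparison_map_def t_def by (auto simp: lin_def)
  have t_F: "t i v \<in> F i \<gamma>" if "v \<in> F i \<gamma>" for i v \<gamma>
    unfolding t_def by (rule deg_part_diff[OF comparison_mapD(2)[OF u that] that])
  have t_D: "D i (t (Suc i) v) = t i (D i v)" if "v \<in> F (Suc i) \<gamma>" for i v \<gamma>
    using comparison_mapD(4)[OF u that] unfolding t_def by (simp add: lin_diff[OF lin_D])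
  have t_0: "t 0 v \<in> Z 0 \<gamma>" if "v \<in> F 0 \<gamma>" for v \<gamma>
    using t_F[OF that] u that
    unfolding comparison_map_def Z_0 by (auto simp: t_def lin_diff[OF lin_e])
  \<comment> \<open>The homotopy relation is recorded on cycles only, where the term
    \<open>h D\<close> vanishes; this is all that the construction of the next \<open>h\<close>
    uses.\<close>
  have "\<exists>h. lin h \<and> (\<forall>\<gamma>. \<forall>v\<in>F i \<gamma>. h v \<in> F (Suc i) \<gamma>) \<and> (\<forall>\<gamma>. \<forall>v\<in>Z i \<gamma>. D i (h v) = t i v) \<and>
      (\<forall>b\<in>B i. \<forall>a\<in>B i. d i a = d i b \<longrightarrow> t i (basis b) a = 0)"
  proof (induction i)
    case 0
    have lift: "t 0 (basis b) \<in> D 0 ` F (Suc 0) (d 0 b)" if "b \<in> B 0" for b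
      unfolding exact by (intro t_0 basis_deg_part that order_refl)
    obtain h where h: "lin h" "\<And>\<gamma> v. v \<in> F 0 \<gamma> \<Longrightarrow> h v \<in> F (Suc 0) \<gamma>"
        "\<And>\<gamma> v. v \<in> F 0 \<gamma> \<Longrightarrow> D 0 (h v) = t 0 v"
      using lin_lift[OF fin lin_D lin_t lift] by blast
    have "t 0 (basis b) a = 0" if "b \<in> B 0" "a \<in> B 0" "d 0 a = d 0 b" for a b
      using minimal_vector[OF h(2)[OF basis_deg_part[OF that(1) order_refl]] that(2,3)]
        h(3)[OF basis_deg_part[OF that(1) order_refl]] by simp
    then show ?case using h Z_F by blast
  next
    case (Suc i)
    then obtain h where h: "lin h" "\<And>\<gamma> v. v \<in> F i \<gamma> \<Longrightarrow> h v \<in> F (Suc i) \<gamma>"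
        "\<And>\<gamma> v. v \<in> Z i \<gamma> \<Longrightarrow> D i (h v) = t i v" by blast
    let ?T = "\<lambda>v. t (Suc i) v - h (D i v)"
    have lin_T: "lin ?T" by (rule lin_minus[OF lin_t lin_compose[OF h(1) lin_D]])
    have "?T v \<in> Z (Suc i) \<gamma>" if v: "v \<in> F (Suc i) \<gamma>" for v \<gamma>
      using h(3)[OF D_cycle[OF v]] h(2)[OF D_F[OF v]] t_F[OF v] t_D[OF v]
      by (simp add: Z_Suc lin_diff[OF lin_D] deg_part_diff)
    then have lift: "?T (basis b) \<in> D (Suc i) ` F (Suc (Suc i)) (d (Suc i) b)" if "b \<in> B (Suc i)" for b
      unfolding exact using basis_deg_part[OF that order_refl] by blast
    obtain h' where h': "lin h'"
        "\<And>\<gamma> v. v \<in> F (Suc i) \<gamma> \<Longrightarrow> h' v \<in> F (Suc (Suc i)) \<gamma>"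
        "\<And>\<gamma> v. v \<in> F (Suc i) \<gamma> \<Longrightarrow> D (Suc i) (h' v) = ?T v"
      using lin_lift[OF fin lin_D lin_T lift] by blast
    have "D (Suc i) (h' v) = t (Suc i) v" if "v \<in> Z (Suc i) \<gamma>" for v \<gamma>
      using h'(3)[OF Z_F[OF that]] that lin_zero[OF h(1)] by (simp add: Z_Suc)
    moreover have "t (Suc i) (basis b) a = 0"
      if "b \<in> B (Suc i)" "a \<in> B (Suc i)" "d (Suc i) a = d (Suc i) b" for a b
    proof -
      have b: "basis b \<in> F (Suc i) (d (Suc i) b)" by (rule basis_deg_part[OF that(1) order_refl])
      have "D (Suc i) (h' (basis b)) a = 0"
        by (rule minimal_vector[OF h'(2)[OF b] that(2,3)])
      \<comment> \<open>A nonzero term passes from \<open>b\<close> through some \<open>c\<close> to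
        \<open>a\<close> with non-increasing degrees. Since the outer degrees agree,
        \<open>c\<close> has the degree of \<open>b\<close> too, which \<open>minimal\<close>
        forbids.\<close>
      moreover have "h (D i (basis b)) a = 0"
      proof -
        have "D i (basis b) c * h (basis c) a = 0" if c: "c \<in> B i" for c
        proof (rule ccontr)
          assume nz: "D i (basis b) c * h (basis c) a \<noteq> 0"
          then have "d i c \<le> d (Suc i) b" "d i c \<noteq> d (Suc i) b"
            using D_F[OF b] minimal[OF \<open>b \<in> B (Suc i)\<close> c] by (auto simp: deg_part_def)
          moreover have "d (Suc i) a \<le> d i c"
            using nz h(2)[OF basis_deg_part[OF c order_refl]] by (auto simp: deg_part_def)
          ultimately show False using \<open>d (Suc i) a = d (Suc i) b\<close> by simp
        qed
        then show ?thesis unfolding lin_expand[OF h(1) fin D_F[OF b]] by (intro sum.neutral) blast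
      qed
      ultimately show ?thesis using h'(3)[OF b] by simp
    qed
    ultimately show ?case using h' by blast
  qed
  then have "t i (basis b) a = 0" using assms(3-5) by blast
  then show ?thesis by (simp add: t_def)
qed

end

text \<open>The composite of comparison maps in both directions restricts to the identity on the
  generators of degree \<alpha>, and this block factors through the generators of degree \<alpha> of
  the other resolution.\<close>

lemma rank_le:
  fixes B :: "nat \<Rightarrow> 'b set" and B' :: "nat \<Rightarrow> 'c set" and d :: "nat \<Rightarrow> 'b \<Rightarrow> 'p::order"
    and e :: "('b \<Rightarrow> 'k::field) \<Rightarrow> (unit \<Rightarrow> 'k)" and e' :: "('c \<Rightarrow> 'k) \<Rightarrow> (unit \<Rightarrow> 'k)"
  assumes R: "graded_resolution B d e D P Q" and R': "graded_resolution B' d' e' D' P Q"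
    and up: "\<And>\<gamma> \<delta>. \<gamma> \<in> Q \<Longrightarrow> \<gamma> \<le> \<delta> \<Longrightarrow> \<delta> \<in> Q"
  shows "card {b \<in> B i. d i b = \<alpha>} \<le> card {b \<in> B' i. d' i b = \<alpha>}"
proof -
  interpret R: graded_resolution B d e D P Q by fact
  interpret R': graded_resolution B' d' e' D' P Q by fact
  obtain f where f: "comparison_map B d e D B' d' e' D' Q f"
    using comparison_map_exists[OF R R' order_refl order_refl] up by blast
  obtain g where g: "comparison_map B' d' e' D' B d e D Q g"
    using comparison_map_exists[OF R' R order_refl order_refl] up by blast
  have gf: "comparison_map B d e D B d e D Q (\<lambda>i v. g i (f i v))"
    unfolding comparison_map_def
  proof (intro conjI allI ballI)
    show "lin (\<lambda>v. g i (f i v))" for i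
      by (rule lin_compose[OF comparison_mapD(1)[OF g] comparison_mapD(1)[OF f]])
    show "g i (f i v) \<in> R.F i \<gamma>" if "v \<in> R.F i \<gamma>" for i \<gamma> v
      by (rule comparison_mapD(2)[OF g comparison_mapD(2)[OF f that]])
    show "\<gamma> \<in> Q \<or> e (g 0 (f 0 v)) = e v" if "v \<in> R.F 0 \<gamma>" for \<gamma> v
      using comparison_mapD(3)[OF g comparison_mapD(2)[OF f that]] comparison_mapD(3)[OF f that] by auto
    show "D i (g (Suc i) (f (Suc i) v)) = g i (f i (D i v))" if "v \<in> R.F (Suc i) \<gamma>" for i \<gamma> v
      using comparison_mapD(4)[OF g comparison_mapD(2)[OF f that]] comparison_mapD(4)[OF f that] by simp
  qed
  show ?thesis
  proof (rule card_le_of_left_inverse)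
    fix a b assume a: "a \<in> {b \<in> B i. d i b = \<alpha>}" and b: "b \<in> {b \<in> B i. d i b = \<alpha>}"
    have fb: "f i (basis b) \<in> R'.F i \<alpha>"
      using comparison_mapD(2)[OF f basis_deg_part] b by blast
    have "(if a = b then 1 else 0) = g i (f i (basis b)) a"
      using R.self_comparison_block[OF gf, of a i b] up a b by (auto simp: basis_def)
    also have "\<dots> = (\<Sum>c\<in>B' i. f i (basis b) c * g i (basis c) a)"
    proof -
      show ?thesis by (simp add: lin_expand[OF comparison_mapD(1)[OF g] R'.fin fb])
    qed
    \<comment> \<open>Intermediate generators of another degree drop out: maps of degree 0 squeeze
      \<open>d' i c\<close> between \<alpha> and \<alpha>.\<close>
    also have "\<dots> = (\<Sum>c\<in>{c \<in> B' i. d' i c = \<alpha>}. f i (basis b) c * g i (basis c) a)"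
    proof (rule sum.mono_neutral_right)
      show "\<forall>c\<in>B' i - {c \<in> B' i. d' i c = \<alpha>}. f i (basis b) c * g i (basis c) a = 0"
      proof (rule ballI, rule ccontr)
        fix c assume c: "c \<in> B' i - {c \<in> B' i. d' i c = \<alpha>}"
          and nz: "f i (basis b) c * g i (basis c) a \<noteq> 0"
        have "d' i c \<le> \<alpha>" using nz fb by (auto simp: deg_part_def)
        moreover have "g i (basis c) \<in> R.F i (d' i c)"
          using comparison_mapD(2)[OF g basis_deg_part] c by blast
        then have "\<alpha> \<le> d' i c" using nz a by (auto simp: deg_part_def)
        ultimately show False using c by simp
      qed
    qed (use R'.fin in auto)
    finally show "(\<Sum>c\<in>{c \<in> B' i. d' i c = \<alpha>}. f i (basis b) c * g i (basis c) a) =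
      (if a = b then 1 else 0)" by simp
  qed (use R.fin R'.fin in auto)
qed

lemma rank_unique:
  fixes B :: "nat \<Rightarrow> 'b set" and B' :: "nat \<Rightarrow> 'c set" and d :: "nat \<Rightarrow> 'b \<Rightarrow> 'p::order"
    and e :: "('b \<Rightarrow> 'k::field) \<Rightarrow> (unit \<Rightarrow> 'k)" and e' :: "('c \<Rightarrow> 'k) \<Rightarrow> (unit \<Rightarrow> 'k)"
  assumes R: "graded_resolution B d e D P Q" and R': "graded_resolution B' d' e' D' P Q"
    and up: "\<And>\<gamma> \<delta>. \<gamma> \<in> Q \<Longrightarrow> \<gamma> \<le> \<delta> \<Longrightarrow> \<delta> \<in> Q"
  shows "card {b \<in> B i. d i b = \<alpha>} = card {b \<in> B' i. d' i b = \<alpha>}"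
proof (rule le_antisym)
  show "card {b \<in> B i. d i b = \<alpha>} \<le> card {b \<in> B' i. d' i b = \<alpha>}"
    by (rule rank_le[OF R R']) (blast intro: up)
  show "card {b \<in> B' i. d' i b = \<alpha>} \<le> card {b \<in> B i. d i b = \<alpha>}"
    by (rule rank_le[OF R' R]) (blast intro: up)
qed

section \<open>Polynomials by integral degrees\<close>

text \<open>Differences of multidegrees may leave the nonnegative orthant; extending coefficients by
  zero lets all degree computations run in the group of integer vectors.\<close>

definition coeff_at :: "('n, 'k::field) mpoly \<Rightarrow> ('n \<Rightarrow> int) \<Rightarrow> 'k" where
  "coeff_at p \<gamma> = (if 0 \<le> \<gamma> then Poly_Mapping.lookup p (\<lambda>v. nat (\<gamma> v)) else 0)"

definition monom_at :: "('n \<Rightarrow> int) \<Rightarrow> 'k \<Rightarrow> ('n, 'k::field) mpoly" where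
  "monom_at \<gamma> c = (if 0 \<le> \<gamma> then Poly_Mapping.single (\<lambda>v. nat (\<gamma> v)) c else 0)"

lemma nonneg_mdeg: "0 \<le> \<gamma> \<longleftrightarrow> mdeg (\<lambda>v. nat (\<gamma> v)) = \<gamma>"
  by (auto simp: le_fun_def mdeg_def fun_eq_iff)

lemma mdeg_nonneg: "0 \<le> mdeg t"
  by (simp add: mdeg_def le_fun_def)

lemma coeff_at_mdeg: "coeff_at p (mdeg t) = Poly_Mapping.lookup p t"
  by (simp add: coeff_at_def mdeg_nonneg) (simp add: mdeg_def)

lemma coeff_at_nonneg: "coeff_at p \<gamma> \<noteq> 0 \<Longrightarrow> 0 \<le> \<gamma>"
  by (metis coeff_at_def)

lemma coeff_at_nonzero: "coeff_at p \<gamma> \<noteq> 0 \<longleftrightarrow> (\<exists>t\<in>Poly_Mapping.keys p. \<gamma> = mdeg t)"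
proof
  assume nz: "coeff_at p \<gamma> \<noteq> 0"
  then have "mdeg (\<lambda>v. nat (\<gamma> v)) = \<gamma>" using coeff_at_nonneg nonneg_mdeg by blast
  then show "\<exists>t\<in>Poly_Mapping.keys p. \<gamma> = mdeg t"
    using nz by (metis coeff_at_mdeg in_keys_iff)
qed (auto simp: coeff_at_mdeg in_keys_iff)

lemma mpoly_eqI: "(\<And>\<gamma>. coeff_at p \<gamma> = coeff_at q \<gamma>) \<Longrightarrow> p = q"
  by (rule poly_mapping_eqI) (metis coeff_at_mdeg)

lemma coeff_at_zero [simp]: "coeff_at 0 \<gamma> = 0"
  by (simp add: coeff_at_def)

lemma coeff_at_add: "coeff_at (p + q) \<gamma> = coeff_at p \<gamma> + coeff_at q \<gamma>"
  by (simp add: coeff_at_def lookup_add)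

lemma coeff_at_diff: "coeff_at (p - q) \<gamma> = coeff_at p \<gamma> - coeff_at q \<gamma>"
  by (simp add: coeff_at_def lookup_minus)

lemma coeff_at_sum: "coeff_at (\<Sum>i\<in>S. f i) \<gamma> = (\<Sum>i\<in>S. coeff_at (f i) \<gamma>)"
  by (simp add: coeff_at_def lookup_sum)

lemma coeff_at_monom_at:
  "coeff_at (monom_at \<delta> c) \<gamma> = (if \<gamma> = \<delta> \<and> 0 \<le> \<delta> then c else 0)"
proof (cases "0 \<le> \<gamma> \<and> 0 \<le> \<delta>")
  case True
  then have "(\<lambda>v. nat (\<delta> v)) = (\<lambda>v. nat (\<gamma> v)) \<longleftrightarrow> \<gamma> = \<delta>" by (metis nonneg_mdeg)
  then show ?thesis using True by (auto simp: coeff_at_def monom_at_def lookup_single when_def)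
qed (auto simp: coeff_at_def monom_at_def)

lemma finite_coeff_at: "finite {\<gamma>. coeff_at p \<gamma> \<noteq> 0}"
proof -
  have "{\<gamma>. coeff_at p \<gamma> \<noteq> 0} = mdeg ` Poly_Mapping.keys p" by (auto simp: coeff_at_nonzero)
  then show ?thesis by simp
qed

lemma homogeneous_coeff_at: "homogeneous \<delta> p \<longleftrightarrow> (\<forall>\<gamma>. coeff_at p \<gamma> \<noteq> 0 \<longrightarrow> \<gamma> = \<delta>)"
  by (auto simp: homogeneous_def coeff_at_nonzero)

lemma homogeneous_monom_at: "homogeneous \<delta> (monom_at \<delta> c)"
  by (simp add: homogeneous_coeff_at coeff_at_monom_at)

lemma homogeneous_eq_monom_at:
  assumes "homogeneous \<delta> p"
  shows "p = monom_at \<delta> (coeff_at p \<delta>)"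
  using assms
  by (intro mpoly_eqI) (auto simp: homogeneous_coeff_at coeff_at_monom_at dest: coeff_at_nonneg)

lemma lookup_single_mult:
  fixes p :: "('n, 'k::field) mpoly"
  shows "Poly_Mapping.lookup (Poly_Mapping.single t c * p) u =
    (if t \<le> u then c * Poly_Mapping.lookup p (u - t) else 0)"
proof -
  have eq: "u = t + q \<longleftrightarrow> t \<le> u \<and> q = u - t" for q
    by (auto simp: fun_eq_iff le_fun_def)
  have "Poly_Mapping.lookup (Poly_Mapping.single t c * p) u =
      (\<Sum>l. (c when t = l) * (\<Sum>q. Poly_Mapping.lookup p q when u = l + q))"
    by (simp add: lookup_mult lookup_single)
  also have "\<dots> = c * (\<Sum>q. Poly_Mapping.lookup p q when u = t + q)"
    by (simp add: when_mult)
  also have "(\<Sum>q. Poly_Mapping.lookup p q when u = t + q) =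
      (if t \<le> u then Poly_Mapping.lookup p (u - t) else 0)"
    unfolding eq by (simp add: when_def)
  finally show ?thesis by simp
qed

text \<open>A homogeneous \<open>f\<close> is a scalar multiple of a single monomial, so
  multiplication by it rescales and shifts coefficients. If \<delta> is not nonnegative, then
  \<open>f\<close> is zero.\<close>

lemma coeff_at_homogeneous_mult:
  assumes "homogeneous \<delta> f"
  shows "coeff_at (f * p) \<gamma> = coeff_at f \<delta> * coeff_at p (\<gamma> - \<delta>)"
proof (cases "0 \<le> \<delta>")
  case True
  define t where "t = (\<lambda>v. nat (\<delta> v))"
  have \<delta>: "\<delta> = mdeg t" using True nonneg_mdeg t_def by metis
  have f: "f = Poly_Mapping.single t (coeff_at f \<delta>)"
    using homogeneous_eq_monom_at[OF assms] True by (simp add: monom_at_def t_def)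
  show ?thesis
  proof (cases "0 \<le> \<gamma>")
    case True
    then obtain u where \<gamma>: "\<gamma> = mdeg u" using nonneg_mdeg by metis
    have "0 \<le> mdeg u - mdeg t \<longleftrightarrow> t \<le> u" by (auto simp: le_fun_def mdeg_def)
    moreover have "mdeg u - mdeg t = mdeg (u - t)" if "t \<le> u"
      using that by (auto simp: le_fun_def mdeg_def fun_eq_iff)
    ultimately have "coeff_at p (\<gamma> - \<delta>) = (if t \<le> u then Poly_Mapping.lookup p (u - t) else 0)"
      unfolding \<gamma> \<delta> by (metis coeff_at_mdeg coeff_at_nonneg)
    then show ?thesis
      by (subst f) (simp add: \<gamma> coeff_at_mdeg lookup_single_mult)
  next
    case False
    then have "\<not> 0 \<le> \<gamma> - \<delta>" using \<open>0 \<le> \<delta>\<close> by (metis diff_ge_0_iff_ge order_trans)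
    then show ?thesis using False by (simp add: coeff_at_def)
  qed
next
  case False
  then have "coeff_at f \<delta> = 0" by (simp add: coeff_at_def)
  moreover from this have "f = 0" using homogeneous_eq_monom_at[OF assms] False
    by (simp add: monom_at_def)
  ultimately show ?thesis by simp
qed

section \<open>Monomial ideals as sets of degrees\<close>

definition degree_ideal :: "('n \<Rightarrow> int) set \<Rightarrow> ('n, 'k::field) mpoly set" where
  "degree_ideal P = {p. \<forall>\<gamma>. coeff_at p \<gamma> \<noteq> 0 \<longrightarrow> \<gamma> \<in> P}"

definition upset_gen :: "('n \<Rightarrow> nat) set \<Rightarrow> ('n \<Rightarrow> int) set" where
  "upset_gen S = {\<gamma>. \<exists>s\<in>S. mdeg s \<le> \<gamma>}"

interpretation mpoly_module: module "(*) :: ('n, 'k::field) mpoly \<Rightarrow> _ \<Rightarrow> _"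
  by unfold_locales (auto simp: algebra_simps)

text \<open>Membership in a monomial ideal is decided term by term; this reduces such ideals to sets
  of degrees.\<close>

lemma ideal_gen_monom:
  fixes S :: "('n \<Rightarrow> nat) set"
  shows "ideal_gen (monom ` S) = (degree_ideal (upset_gen S) :: ('n, 'k::field) mpoly set)"
proof
  have sub: "mpoly_module.subspace (degree_ideal (upset_gen S) :: ('n, 'k::field) mpoly set)"
    for S :: "('n \<Rightarrow> nat) set"
  proof (rule mpoly_module.subspaceI)
    fix x y :: "('n, 'k) mpoly" and c
    assume x: "x \<in> degree_ideal (upset_gen S)"
    show "c * x \<in> degree_ideal (upset_gen S)"
      unfolding degree_ideal_def
    proof (intro CollectI allI impI)
      fix \<gamma> assume "coeff_at (c * x) \<gamma> \<noteq> 0"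
      then obtain t where t: "t \<in> Poly_Mapping.keys (c * x)" "\<gamma> = mdeg t"
        unfolding coeff_at_nonzero by blast
      then obtain a b where ab: "t = a + b" "b \<in> Poly_Mapping.keys x"
        using keys_mult[of c x] by blast
      then have "mdeg b \<in> upset_gen S"
        using x unfolding degree_ideal_def coeff_at_nonzero by blast
      moreover have "mdeg b \<le> \<gamma>" using ab t by (simp add: mdeg_def le_fun_def)
      ultimately show "\<gamma> \<in> upset_gen S" by (auto simp: upset_gen_def intro: order_trans)
    qed
    assume "y \<in> degree_ideal (upset_gen S)"
    then show "x + y \<in> degree_ideal (upset_gen S)"
      using x unfolding degree_ideal_def mem_Collect_eq coeff_at_add by (metis add_0)
  qed (simp add: degree_ideal_def)
  have "monom s \<in> (degree_ideal (upset_gen S) :: ('n, 'k) mpoly set)" if "s \<in> S" for s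
    unfolding degree_ideal_def coeff_at_nonzero using that
    by (auto simp: monom_def upset_gen_def)
  then show "ideal_gen (monom ` S) \<subseteq> (degree_ideal (upset_gen S) :: ('n, 'k) mpoly set)"
    unfolding ideal_gen_def by (intro mpoly_module.span_minimal sub) blast
  show "(degree_ideal (upset_gen S) :: ('n, 'k) mpoly set) \<subseteq> ideal_gen (monom ` S)"
  proof
    fix p :: "('n, 'k) mpoly" assume p: "p \<in> degree_ideal (upset_gen S)"
    have "Poly_Mapping.single t c \<in> ideal_gen (monom ` S)" if t: "t \<in> Poly_Mapping.keys p" for t and c :: 'k
    proof -
      have "mdeg t \<in> upset_gen S"
        using p t unfolding degree_ideal_def coeff_at_nonzero by blast
      then obtain s where s: "s \<in> S" "s \<le> t" by (auto simp: upset_gen_def mdeg_def le_fun_def)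
      have "Poly_Mapping.single t c = Poly_Mapping.single (t - s) c * monom s"
        using s(2) by (auto simp: monom_def mult_single le_fun_def fun_eq_iff
            intro!: arg_cong2[where f = Poly_Mapping.single])
      then show ?thesis unfolding ideal_gen_def
        using s(1) by (simp add: mpoly_module.span_scale mpoly_module.span_base)
    qed
    then have "(\<Sum>t\<in>Poly_Mapping.keys p. Poly_Mapping.single t (Poly_Mapping.lookup p t)) \<in> ideal_gen (monom ` S)"
      unfolding ideal_gen_def by (intro mpoly_module.span_sum) blast
    moreover have "p = (\<Sum>t\<in>Poly_Mapping.keys p. Poly_Mapping.single t (Poly_Mapping.lookup p t))"
      by (rule poly_mapping_eqI) (simp add: lookup_sum lookup_single when_def in_keys_iff)
    ultimately show "p \<in> ideal_gen (monom ` S)" by simp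
  qed
qed

lemma ideal_gen_var: "ideal_gen (range var) = (degree_ideal {\<gamma>. 0 \<le> \<gamma> \<and> \<gamma> \<noteq> 0} :: ('n, 'k::field) mpoly set)"
proof -
  define x :: "'n \<Rightarrow> 'n \<Rightarrow> nat" where "x v = (\<lambda>w. if w = v then 1 else 0)" for v
  have "upset_gen (range x) = {\<gamma>. 0 \<le> \<gamma> \<and> \<gamma> \<noteq> 0}"
  proof (intro set_eqI iffI)
    fix \<gamma> assume "\<gamma> \<in> upset_gen (range x)"
    then obtain v where v: "mdeg (x v) \<le> \<gamma>" by (auto simp: upset_gen_def)
    then have "0 \<le> \<gamma>" using mdeg_nonneg order_trans by blast
    moreover have "1 \<le> \<gamma> v" using le_funD[OF v, of v] by (simp add: mdeg_def x_def)
    ultimately show "\<gamma> \<in> {\<gamma>. 0 \<le> \<gamma> \<and> \<gamma> \<noteq> 0}" by auto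
  next
    fix \<gamma> :: "'n \<Rightarrow> int" assume \<gamma>: "\<gamma> \<in> {\<gamma>. 0 \<le> \<gamma> \<and> \<gamma> \<noteq> 0}"
    then obtain v where v: "\<gamma> v \<noteq> 0" by (auto simp: fun_eq_iff)
    have nn: "0 \<le> \<gamma> w" for w using \<gamma> by (simp add: le_fun_def)
    then have "1 \<le> \<gamma> v" using v by (metis int_one_le_iff_zero_less order_le_less)
    then have "mdeg (x v) \<le> \<gamma>" using nn by (auto simp: mdeg_def x_def le_fun_def)
    then show "\<gamma> \<in> upset_gen (range x)" by (auto simp: upset_gen_def)
  qed
  moreover have "range var = (monom ` range x :: ('n, 'k) mpoly set)"
    by (simp add: var_def x_def image_image)
  ultimately show ?thesis by (simp add: ideal_gen_monom)
qed

lemma degree_ideal_empty: "degree_ideal {} = {0}"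
  by (auto simp: degree_ideal_def intro: mpoly_eqI)

lemma degree_ideal_nonneg: "degree_ideal {\<gamma>. 0 \<le> \<gamma>} = UNIV"
  by (auto simp: degree_ideal_def dest: coeff_at_nonneg)

section \<open>Homogeneous components of a free resolution\<close>

definition component :: "(nat \<Rightarrow> 'n \<Rightarrow> int) \<Rightarrow> ('n \<Rightarrow> int) \<Rightarrow> (nat \<Rightarrow> ('n, 'k::field) mpoly) \<Rightarrow> nat \<Rightarrow> 'k" where
  "component d \<gamma> v = (\<lambda>b. coeff_at (v b) (\<gamma> - d b))"

text \<open>A homogeneous entry \<open>M a b\<close> has at most one nonzero coefficient, the one at
  \<open>d' b - d a\<close>. The resulting scalar matrix describes the map on every graded component
  at once.\<close>

definition scalar_map ::
  "nat \<Rightarrow> nat \<Rightarrow> (nat \<Rightarrow> 'n \<Rightarrow> int) \<Rightarrow> (nat \<Rightarrow> 'n \<Rightarrow> int) \<Rightarrow> (nat \<Rightarrow> nat \<Rightarrow> ('n, 'k::field) mpoly) \<Rightarrow>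
    (nat \<Rightarrow> 'k) \<Rightarrow> (nat \<Rightarrow> 'k)" where
  "scalar_map p q d d' M w = (\<lambda>a. if a < p then \<Sum>b<q. coeff_at (M a b) (d' b - d a) * w b else 0)"

definition scalar_aug ::
  "nat \<Rightarrow> (nat \<Rightarrow> 'n \<Rightarrow> int) \<Rightarrow> (nat \<Rightarrow> ('n, 'k::field) mpoly) \<Rightarrow> (nat \<Rightarrow> 'k) \<Rightarrow> (unit \<Rightarrow> 'k)" where
  "scalar_aug r d \<epsilon> w = (\<lambda>_. \<Sum>b<r. coeff_at (\<epsilon> b) (d b) * w b)"

lemma component_deg_part: "v \<in> free_mod r \<Longrightarrow> component d \<gamma> v \<in> deg_part {..<r} d \<gamma>"
  unfolding deg_part_def component_def free_mod_def
  by (auto dest: coeff_at_nonneg) (metis coeff_at_zero not_le)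

lemma component_eqI:
  assumes "\<And>\<gamma>. component d \<gamma> v = component d \<gamma> w"
  shows "v = w"
proof
  fix b
  have "coeff_at (v b) \<gamma> = coeff_at (w b) \<gamma>" for \<gamma>
    using fun_cong[OF assms[of "\<gamma> + d b"], of b] by (simp add: component_def)
  then show "v b = w b" by (rule mpoly_eqI)
qed

lemma component_zero: "component d \<gamma> 0 = 0"
  by (simp add: component_def fun_eq_iff)

lemma finite_component:
  assumes "v \<in> free_mod r"
  shows "finite {\<gamma>. component d \<gamma> v \<noteq> 0}"
proof -
  have "{\<gamma>. component d \<gamma> v \<noteq> 0} \<subseteq> (\<Union>b<r. (\<lambda>\<gamma>. \<gamma> + d b) ` {\<gamma>. coeff_at (v b) \<gamma> \<noteq> 0})"
  proof
    fix \<gamma> assume "\<gamma> \<in> {\<gamma>. component d \<gamma> v \<noteq> 0}"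
    then obtain b where b: "coeff_at (v b) (\<gamma> - d b) \<noteq> 0"
      by (auto simp: component_def fun_eq_iff)
    then have "b < r" using assms by (metis (mono_tags) coeff_at_zero free_mod_def mem_Collect_eq not_le)
    moreover have "\<gamma> = (\<gamma> - d b) + d b" by simp
    ultimately show "\<gamma> \<in> (\<Union>b<r. (\<lambda>\<gamma>. \<gamma> + d b) ` {\<gamma>. coeff_at (v b) \<gamma> \<noteq> 0})"
      using b by blast
  qed
  then show ?thesis by (rule finite_subset) (simp add: finite_coeff_at)
qed

text \<open>Together with \<open>finite_component\<close> and \<open>component_eqI\<close> this
  identifies the free module with the direct sum of its graded components.\<close>

lemma assemble_components:
  fixes s :: "('n \<Rightarrow> int) \<Rightarrow> nat \<Rightarrow> 'k::field"
  assumes "finite {\<gamma>. s \<gamma> \<noteq> 0}" "\<And>\<gamma>. s \<gamma> \<in> deg_part {..<r} d \<gamma>"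
  obtains v where "v \<in> free_mod r" "\<And>\<gamma>. component d \<gamma> v = s \<gamma>"
proof
  define v where "v b = (\<Sum>\<gamma>\<in>{\<gamma>. s \<gamma> \<noteq> 0}. monom_at (\<gamma> - d b) (s \<gamma> b))" for b
  have s: "s \<gamma> b \<noteq> 0 \<Longrightarrow> b < r \<and> 0 \<le> \<gamma> - d b" for \<gamma> b
    using assms(2)[of \<gamma>] by (auto simp: deg_part_def)
  have "v b = 0" if "r \<le> b" for b
    unfolding v_def
  proof (rule sum.neutral, rule ballI)
    fix \<gamma>
    have "s \<gamma> b = 0" using s[of \<gamma> b] that by force
    then show "monom_at (\<gamma> - d b) (s \<gamma> b) = 0" by (simp add: monom_at_def)
  qed
  then show "v \<in> free_mod r" by (simp add: free_mod_def)
  show "component d \<gamma> v = s \<gamma>" for \<gamma>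
  proof
    fix b
    have "component d \<gamma> v b = (\<Sum>\<eta>\<in>{\<gamma>. s \<gamma> \<noteq> 0}. if \<gamma> = \<eta> then s \<gamma> b else 0)"
      unfolding component_def v_def coeff_at_sum
    proof (rule sum.cong)
      fix \<eta>
      show "coeff_at (monom_at (\<eta> - d b) (s \<eta> b)) (\<gamma> - d b) = (if \<gamma> = \<eta> then s \<gamma> b else 0)"
        using s[of \<gamma> b] by (auto simp: coeff_at_monom_at)
    qed simp
    also have "\<dots> = s \<gamma> b" using assms(1) by auto
    finally show "component d \<gamma> v b = s \<gamma> b" .
  qed
qed

lemma component_lin_map:
  assumes "\<And>a b. a < p \<Longrightarrow> b < q \<Longrightarrow> homogeneous (d' b - d a) (M a b)"
  shows "component d \<gamma> (lin_map p q M v) = scalar_map p q d d' M (component d' \<gamma> v)"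
proof
  fix a
  show "component d \<gamma> (lin_map p q M v) a = scalar_map p q d d' M (component d' \<gamma> v) a"
  proof (cases "a < p")
    case True
    have "coeff_at (M a b * v b) (\<gamma> - d a) = coeff_at (M a b) (d' b - d a) * coeff_at (v b) (\<gamma> - d' b)"
      if "b < q" for b
    proof -
      have "\<gamma> - d a - (d' b - d a) = \<gamma> - d' b" by simp
      then show ?thesis using coeff_at_homogeneous_mult[OF assms[OF True that]] by metis
    qed
    then show ?thesis using True
      by (simp add: component_def lin_map_def scalar_map_def coeff_at_sum)
  qed (simp add: component_def lin_map_def scalar_map_def)
qed

lemma coeff_at_aug:
  assumes "\<And>b. b < r \<Longrightarrow> homogeneous (d b) (\<epsilon> b)"
  shows "coeff_at (\<Sum>b<r. v b * \<epsilon> b) \<gamma> = scalar_aug r d \<epsilon> (component d \<gamma> v) ()"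
  unfolding scalar_aug_def component_def coeff_at_sum
proof (rule sum.cong)
  fix b assume "b \<in> {..<r}"
  then show "coeff_at (v b * \<epsilon> b) \<gamma> = coeff_at (\<epsilon> b) (d b) * coeff_at (v b) (\<gamma> - d b)"
    using coeff_at_homogeneous_mult[OF assms, of b "v b" \<gamma>] by (simp add: mult.commute)
qed simp

lemma lin_map_free_mod: "lin_map p q M v \<in> free_mod p"
  by (simp add: lin_map_def free_mod_def)

lemma lin_scalar_map: "lin (scalar_map p q d d' M)"
  by (rule linI) (auto simp: scalar_map_def fun_eq_iff algebra_simps sum.distrib sum_distrib_left)

lemma lin_scalar_aug: "lin (scalar_aug r d \<epsilon>)"
  by (rule linI) (auto simp: scalar_aug_def fun_eq_iff algebra_simps sum.distrib sum_distrib_left)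

lemma single_component:
  assumes "w \<in> deg_part {..<r} d \<gamma>"
  obtains v where "v \<in> free_mod r" "component d \<gamma> v = w" "\<And>\<eta>. \<eta> \<noteq> \<gamma> \<Longrightarrow> component d \<eta> v = 0"
proof -
  let ?s = "\<lambda>\<eta>. if \<eta> = \<gamma> then w else 0"
  have "finite {\<eta>. ?s \<eta> \<noteq> 0}" by (rule finite_subset[of _ "{\<gamma>}"]) auto
  moreover have "?s \<eta> \<in> deg_part {..<r} d \<eta>" for \<eta> using assms by simp
  ultimately obtain v where v: "v \<in> free_mod r" "\<And>\<eta>. component d \<eta> v = ?s \<eta>"
    using assemble_components[of ?s r d] by blast
  show thesis by (rule that[OF v(1)]) (simp_all add: v(2))
qed

text \<open>Exactness of a graded complex can be tested degree by degree. From the module to a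
  component one uses vectors concentrated in a single degree; in the other direction preimages of
  the components are assembled.\<close>

lemma lin_map_image_iff:
  fixes M :: "nat \<Rightarrow> nat \<Rightarrow> ('n, 'k::field) mpoly"
  assumes hom: "\<And>a b. a < p \<Longrightarrow> b < q \<Longrightarrow> homogeneous (d' b - d a) (M a b)"
    and Z: "\<And>\<gamma>. Z \<gamma> \<subseteq> deg_part {..<p} d \<gamma>" "\<And>\<gamma>. 0 \<in> Z \<gamma>"
  shows "{v \<in> free_mod p. \<forall>\<gamma>. component d \<gamma> v \<in> Z \<gamma>} = lin_map p q M ` free_mod q \<longleftrightarrow>
    (\<forall>\<gamma>. scalar_map p q d d' M ` deg_part {..<q} d' \<gamma> = Z \<gamma>)" (is "?L = ?R \<longleftrightarrow> ?S")
proof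
  note comp = component_lin_map[of p q d' d M, OF hom]
  assume eq: "?L = ?R"
  show ?S
  proof (intro allI set_eqI iffI)
    fix \<gamma> x assume "x \<in> scalar_map p q d d' M ` deg_part {..<q} d' \<gamma>"
    then obtain w where w: "w \<in> deg_part {..<q} d' \<gamma>" "x = scalar_map p q d d' M w" by blast
    obtain v where v: "v \<in> free_mod q" "component d' \<gamma> v = w" using single_component[OF w(1)] by metis
    then have "lin_map p q M v \<in> ?L" using eq by blast
    then have "component d \<gamma> (lin_map p q M v) \<in> Z \<gamma>" by blast
    then show "x \<in> Z \<gamma>" using comp v w by simp
  next
    fix \<gamma> x assume x: "x \<in> Z \<gamma>"
    then obtain v where v: "v \<in> free_mod p" "component d \<gamma> v = x"
        "\<And>\<eta>. \<eta> \<noteq> \<gamma> \<Longrightarrow> component d \<eta> v = 0"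
      using single_component[of x p d \<gamma>] Z(1) by blast
    have "component d \<eta> v \<in> Z \<eta>" for \<eta>
      using v(2,3) x Z(2) by (cases "\<eta> = \<gamma>") simp_all
    then have "v \<in> ?L" using v(1) by simp
    then obtain w where w: "w \<in> free_mod q" "v = lin_map p q M w" using eq by blast
    then have "x = scalar_map p q d d' M (component d' \<gamma> w)" using comp v(2) by simp
    then show "x \<in> scalar_map p q d d' M ` deg_part {..<q} d' \<gamma>" using component_deg_part[OF w(1)] by blast
  qed
next
  note comp = component_lin_map[of p q d' d M, OF hom]
  assume S: ?S
  show "?L = ?R"
  proof (intro set_eqI iffI)
    fix v assume v: "v \<in> ?L"
    \<comment> \<open>A zero component gets the preimage 0; without this normalisation the chosen
      family need not have finite support.\<close>
    have "\<exists>w. w \<in> deg_part {..<q} d' \<gamma> \<and> scalar_map p q d d' M w = component d \<gamma> v \<and>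
        (component d \<gamma> v = 0 \<longrightarrow> w = 0)" for \<gamma>
    proof (cases "component d \<gamma> v = 0")
      case True
      then show ?thesis using lin_zero[OF lin_scalar_map] deg_part_zero by metis
    next
      case False
      have "component d \<gamma> v \<in> Z \<gamma>" using v by blast
      then show ?thesis using S False by (metis (no_types, lifting) imageE)
    qed
    then obtain w where w: "\<And>\<gamma>. w \<gamma> \<in> deg_part {..<q} d' \<gamma>"
        "\<And>\<gamma>. scalar_map p q d d' M (w \<gamma>) = component d \<gamma> v"
        "\<And>\<gamma>. component d \<gamma> v = 0 \<Longrightarrow> w \<gamma> = 0" by metis
    have "finite {\<gamma>. w \<gamma> \<noteq> 0}"
      by (rule finite_subset[of _ "{\<gamma>. component d \<gamma> v \<noteq> 0}"])
        (use w(3) finite_component v in auto)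
    then obtain u where u: "u \<in> free_mod q" "\<And>\<gamma>. component d' \<gamma> u = w \<gamma>"
      using assemble_components[of w q d'] w(1) by blast
    have "component d \<gamma> (lin_map p q M u) = component d \<gamma> v" for \<gamma>
      using comp u(2) w(2) by simp
    then have "v = lin_map p q M u" using component_eqI by metis
    then show "v \<in> ?R" using u(1) by blast
  next
    fix v assume "v \<in> ?R"
    then obtain u where u: "u \<in> free_mod q" "v = lin_map p q M u" by blast
    have "component d \<gamma> v \<in> Z \<gamma>" for \<gamma>
      using S component_deg_part[OF u(1)] comp u(2) by blast
    then show "v \<in> ?L" using u(2) lin_map_free_mod by blast
  qed
qed

lemma scalar_map_basis:
  "a < p \<Longrightarrow> b < q \<Longrightarrow> scalar_map p q d d' M (basis b) a = coeff_at (M a b) (d' b - d a)"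
  by (simp add: scalar_map_def basis_def if_distrib cong: if_cong)

lemma scalar_aug_basis: "b < r \<Longrightarrow> scalar_aug r d \<epsilon> (basis b) = (\<lambda>_. coeff_at (\<epsilon> b) (d b))"
  by (simp add: scalar_aug_def basis_def if_distrib cong: if_cong)

section \<open>Polynomial resolutions and scalar resolutions\<close>

locale degree_sets =
  fixes P Q :: "('n \<Rightarrow> int) set"
  assumes P_nonneg: "\<gamma> \<in> P \<Longrightarrow> 0 \<le> \<gamma>"
    and P_up: "\<gamma> \<in> P \<Longrightarrow> \<gamma> \<le> \<delta> \<Longrightarrow> \<delta> \<in> P"
    and Q_up: "\<gamma> \<in> Q \<Longrightarrow> \<gamma> \<le> \<delta> \<Longrightarrow> \<delta> \<in> Q"
    and Q_P: "\<gamma> \<in> Q \<Longrightarrow> \<gamma> \<in> P"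
begin

text \<open>Once all maps are homogeneous, each remaining condition on the polynomial complex is
  equivalent to a condition on its graded components, and these conditions are the axioms of
  \<open>graded_resolution\<close>.\<close>

lemma minimal_free_resolution_iff:
  fixes \<epsilon> :: "nat \<Rightarrow> ('n, 'k::field) mpoly" and \<phi> :: "nat \<Rightarrow> nat \<Rightarrow> nat \<Rightarrow> ('n, 'k) mpoly"
  assumes hom_\<epsilon>: "\<And>b. b < r 0 \<Longrightarrow> homogeneous (d 0 b) (\<epsilon> b)"
    and hom_\<phi>: "\<And>i a b. a < r i \<Longrightarrow> b < r (Suc i) \<Longrightarrow> homogeneous (d (Suc i) b - d i a) (\<phi> i a b)"
  shows "minimal_free_resolution (degree_ideal P) (degree_ideal Q) r d \<epsilon> \<phi> \<longleftrightarrow>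
    graded_resolution (\<lambda>i. {..<r i}) d (scalar_aug (r 0) (d 0) \<epsilon>)
      (\<lambda>i. scalar_map (r i) (r (Suc i)) (d i) (d (Suc i)) (\<phi> i)) P Q"
    (is "?mfr \<longleftrightarrow> graded_resolution ?B d ?e ?D P Q")
proof -
  let ?Z = "cycles ?B d ?e ?D Q"
  note aug = coeff_at_aug[of "r 0" "d 0" \<epsilon>, OF hom_\<epsilon>]
  have degree: "(\<forall>b<r 0. \<epsilon> b \<in> degree_ideal P) \<longleftrightarrow>
      (\<forall>\<gamma>. \<forall>v\<in>deg_part {..<r 0} (d 0) \<gamma>. ?e v \<noteq> 0 \<longrightarrow> \<gamma> \<in> P)" (is "?l = ?r")
  proof
    assume l: ?l
    show ?r
    proof (intro allI ballI impI)
      fix \<gamma> and v :: "nat \<Rightarrow> 'k" assume v: "v \<in> deg_part {..<r 0} (d 0) \<gamma>" "?e v \<noteq> 0"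
      then obtain b where b: "b < r 0" "coeff_at (\<epsilon> b) (d 0 b) * v b \<noteq> 0"
        unfolding scalar_aug_def by (auto simp: fun_eq_iff elim: sum.not_neutral_contains_not_neutral)
      then have "d 0 b \<in> P" "d 0 b \<le> \<gamma>" using l v(1) by (auto simp: degree_ideal_def deg_part_def)
      then show "\<gamma> \<in> P" by (rule P_up)
    qed
  next
    assume r: ?r
    show ?l
      unfolding degree_ideal_def
    proof (intro allI impI CollectI)
      fix b \<gamma> assume b: "b < r 0" and nz: "coeff_at (\<epsilon> b) \<gamma> \<noteq> 0"
      then have \<gamma>: "\<gamma> = d 0 b" using hom_\<epsilon>[OF b] unfolding homogeneous_coeff_at by blast
      then have "?e (basis b) \<noteq> 0"
        using nz by (metis scalar_aug_basis[OF b] zero_fun_apply)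
      with \<gamma> show "\<gamma> \<in> P" using r basis_deg_part[of b "{..<r 0}" "d 0" "d 0 b"] b by auto
    qed
  qed
  \<comment> \<open>Surjectivity is tested on the monomials \<open>monom_at \<gamma> 1\<close>.
    Conversely, preimages of the finitely many terms of \<open>p\<close> outside \<open>Q\<close>
    are assembled, and the terms in \<open>Q\<close> are left to the summand from the smaller
    ideal.\<close>
  have onto: "degree_ideal P = {(\<Sum>b<r 0. v b * \<epsilon> b) + g | v g. v \<in> free_mod (r 0) \<and> g \<in> degree_ideal Q}
      \<longleftrightarrow> (\<forall>\<gamma>. \<gamma> \<in> P \<longrightarrow> \<gamma> \<notin> Q \<longrightarrow> (\<exists>v\<in>deg_part {..<r 0} (d 0) \<gamma>. ?e v = 1))"
    (is "_ = ?S \<longleftrightarrow> ?r") if deg: "\<forall>\<gamma>. \<forall>v\<in>deg_part {..<r 0} (d 0) \<gamma>. ?e v \<noteq> 0 \<longrightarrow> \<gamma> \<in> P"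
  proof
    assume eq: "degree_ideal P = ?S"
    show ?r
    proof (intro allI impI)
      fix \<gamma> assume \<gamma>: "\<gamma> \<in> P" "\<gamma> \<notin> Q"
      have "monom_at \<gamma> 1 \<in> degree_ideal P" using \<gamma>(1) by (auto simp: degree_ideal_def coeff_at_monom_at)
      then obtain v g where vg: "monom_at \<gamma> 1 = (\<Sum>b<r 0. v b * \<epsilon> b) + g" "v \<in> free_mod (r 0)"
          "g \<in> degree_ideal Q" using eq by blast
      have "coeff_at (monom_at \<gamma> (1::'k)) \<gamma> = 1" using P_nonneg[OF \<gamma>(1)] by (simp add: coeff_at_monom_at)
      moreover have "coeff_at g \<gamma> = 0" using vg(3) \<gamma>(2) by (auto simp: degree_ideal_def)
      ultimately have "?e (component (d 0) \<gamma> v) () = 1"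
        using vg(1) aug[of v \<gamma>] by (simp add: coeff_at_add)
      then have "?e (component (d 0) \<gamma> v) = 1" by (simp add: fun_eq_iff)
      then show "\<exists>v\<in>deg_part {..<r 0} (d 0) \<gamma>. ?e v = 1" using component_deg_part[OF vg(2)] by blast
    qed
  next
    assume r: ?r
    show "degree_ideal P = ?S"
    proof (intro set_eqI iffI)
      fix p :: "('n, 'k) mpoly" assume p: "p \<in> degree_ideal P"
      have "\<exists>s. s \<in> deg_part {..<r 0} (d 0) \<gamma> \<and> (\<gamma> \<notin> Q \<longrightarrow> ?e s = (\<lambda>_. coeff_at p \<gamma>)) \<and>
          (coeff_at p \<gamma> = 0 \<longrightarrow> s = 0)" for \<gamma>
      proof (cases "coeff_at p \<gamma> = 0 \<or> \<gamma> \<in> Q")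
        case True
        then show ?thesis by (intro exI[of _ 0]) (auto simp: scalar_aug_def)
      next
        case False
        then have "\<gamma> \<in> P" "\<gamma> \<notin> Q" using p by (auto simp: degree_ideal_def)
        then obtain v where "v \<in> deg_part {..<r 0} (d 0) \<gamma>" "?e v = 1" using r by blast
        then show ?thesis
          using False lin_scale[OF lin_scalar_aug, of "r 0" "d 0" \<epsilon> "coeff_at p \<gamma>" v]
          by (intro exI[of _ "\<lambda>b. coeff_at p \<gamma> * v b"]) (simp add: deg_part_scale)
      qed
      then obtain s where s: "\<And>\<gamma>. s \<gamma> \<in> deg_part {..<r 0} (d 0) \<gamma>"
          "\<And>\<gamma>. \<gamma> \<notin> Q \<Longrightarrow> ?e (s \<gamma>) = (\<lambda>_. coeff_at p \<gamma>)"
          "\<And>\<gamma>. coeff_at p \<gamma> = 0 \<Longrightarrow> s \<gamma> = 0" by metis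
      have "finite {\<gamma>. s \<gamma> \<noteq> 0}"
        by (rule finite_subset[OF _ finite_coeff_at[of p]]) (use s(3) in auto)
      then obtain v where v: "v \<in> free_mod (r 0)" "\<And>\<gamma>. component (d 0) \<gamma> v = s \<gamma>"
        using assemble_components[of s "r 0" "d 0"] s(1) by blast
      have "p - (\<Sum>b<r 0. v b * \<epsilon> b) \<in> degree_ideal Q"
        unfolding degree_ideal_def
      proof (intro CollectI allI impI, rule ccontr)
        fix \<gamma> assume "coeff_at (p - (\<Sum>b<r 0. v b * \<epsilon> b)) \<gamma> \<noteq> 0" "\<gamma> \<notin> Q"
        then show False using aug[of v \<gamma>] v(2) s(2) by (simp add: coeff_at_diff)
      qed
      moreover have "p = (\<Sum>b<r 0. v b * \<epsilon> b) + (p - (\<Sum>b<r 0. v b * \<epsilon> b))" by simp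
      ultimately show "p \<in> ?S" using v(1) by blast
    next
      fix p assume "p \<in> ?S"
      then obtain v g where vg: "p = (\<Sum>b<r 0. v b * \<epsilon> b) + g" "v \<in> free_mod (r 0)"
          "g \<in> degree_ideal Q" by blast
      show "p \<in> degree_ideal P"
        unfolding degree_ideal_def
      proof (intro CollectI allI impI)
        fix \<gamma> assume nz: "coeff_at p \<gamma> \<noteq> 0"
        show "\<gamma> \<in> P"
        proof (cases "coeff_at g \<gamma> = 0")
          case True
          then have "?e (component (d 0) \<gamma> v) \<noteq> 0"
            using nz vg(1) aug[of v \<gamma>] by (auto simp: coeff_at_add fun_eq_iff)
          then show ?thesis using deg component_deg_part[OF vg(2)] by blast
        next
          case False
          then show ?thesis using vg(3) Q_P by (auto simp: degree_ideal_def)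
        qed
      qed
    qed
  qed
  \<comment> \<open>A homogeneous entry lies outside the ideal of the variables only if it is a
    nonzero constant, which requires its degree \<open>d (Suc i) b - d i a\<close> to be
    zero.\<close>
  have min: "(\<forall>i. \<forall>a<r i. \<forall>b<r (Suc i). \<phi> i a b \<in> ideal_gen (range var)) \<longleftrightarrow>
      (\<forall>i. \<forall>a<r i. \<forall>b<r (Suc i). d i a = d (Suc i) b \<longrightarrow> ?D i (basis b) a = 0)"
  proof -
    have "\<phi> i a b \<in> ideal_gen (range var) \<longleftrightarrow> (d i a = d (Suc i) b \<longrightarrow> ?D i (basis b) a = 0)"
      if "a < r i" "b < r (Suc i)" for i a b
    proof -
      have "?D i (basis b) a = coeff_at (\<phi> i a b) (d (Suc i) b - d i a)"
        by (rule scalar_map_basis[OF that])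
      then show ?thesis using hom_\<phi>[OF that] unfolding ideal_gen_var degree_ideal_def
        by (auto simp: homogeneous_coeff_at dest: coeff_at_nonneg)
    qed
    then show ?thesis by blast
  qed
  have Z0: "{v \<in> free_mod (r 0). (\<Sum>b<r 0. v b * \<epsilon> b) \<in> degree_ideal Q} =
      {v \<in> free_mod (r 0). \<forall>\<gamma>. component (d 0) \<gamma> v \<in> ?Z 0 \<gamma>}"
  proof -
    have "(\<Sum>b<r 0. v b * \<epsilon> b) \<in> degree_ideal Q \<longleftrightarrow> (\<forall>\<gamma>. component (d 0) \<gamma> v \<in> ?Z 0 \<gamma>)"
      if "v \<in> free_mod (r 0)" for v
      using component_deg_part[OF that]
      by (auto simp: degree_ideal_def cycles_def aug fun_eq_iff)
    then show ?thesis by blast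
  qed
  have ZS: "{v \<in> free_mod (r (Suc i)). lin_map (r i) (r (Suc i)) (\<phi> i) v = 0} =
      {v \<in> free_mod (r (Suc i)). \<forall>\<gamma>. component (d (Suc i)) \<gamma> v \<in> ?Z (Suc i) \<gamma>}" for i
  proof -
    have "lin_map (r i) (r (Suc i)) (\<phi> i) v = 0 \<longleftrightarrow>
        (\<forall>\<gamma>. component (d (Suc i)) \<gamma> v \<in> ?Z (Suc i) \<gamma>)" if "v \<in> free_mod (r (Suc i))" for v
    proof -
      have "lin_map (r i) (r (Suc i)) (\<phi> i) v = 0 \<longleftrightarrow>
          (\<forall>\<gamma>. component (d i) \<gamma> (lin_map (r i) (r (Suc i)) (\<phi> i) v) = 0)"
        using component_eqI[of "d i" _ 0] component_zero by metis
      then show ?thesis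
        using component_deg_part[OF that]
        by (simp add: component_lin_map[of "r i" "r (Suc i)" "d (Suc i)" "d i" "\<phi> i", OF hom_\<phi>] cycles_def)
    qed
    then show ?thesis by blast
  qed
  have zero: "0 \<in> ?Z i \<gamma>" for i \<gamma>
    by (auto simp: cycles_def lin_zero[OF lin_scalar_aug] lin_zero[OF lin_scalar_map] split: nat.split)
  have sub: "?Z i \<gamma> \<subseteq> deg_part {..<r i} (d i) \<gamma>" for i \<gamma>
    by (auto simp: cycles_def)
  have image: "{v \<in> free_mod (r i). \<forall>\<gamma>. component (d i) \<gamma> v \<in> ?Z i \<gamma>} =
        lin_map (r i) (r (Suc i)) (\<phi> i) ` free_mod (r (Suc i)) \<longleftrightarrow>
      (\<forall>\<gamma>. ?D i ` deg_part {..<r (Suc i)} (d (Suc i)) \<gamma> = ?Z i \<gamma>)" for i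
    by (rule lin_map_image_iff[OF hom_\<phi> sub zero])
  have all_nat: "(\<forall>i. R i) \<longleftrightarrow> R 0 \<and> (\<forall>i. R (Suc i))" for R :: "nat \<Rightarrow> bool"
    by (metis not0_implies_Suc)
  have exact: "{v \<in> free_mod (r 0). (\<Sum>b<r 0. v b * \<epsilon> b) \<in> degree_ideal Q}
       = lin_map (r 0) (r 1) (\<phi> 0) ` free_mod (r 1) \<and>
     (\<forall>i. {v \<in> free_mod (r (Suc i)). lin_map (r i) (r (Suc i)) (\<phi> i) v = 0}
       = lin_map (r (Suc i)) (r (Suc (Suc i))) (\<phi> (Suc i)) ` free_mod (r (Suc (Suc i)))) \<longleftrightarrow>
     (\<forall>i \<gamma>. ?D i ` deg_part {..<r (Suc i)} (d (Suc i)) \<gamma> = ?Z i \<gamma>)"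
    unfolding Z0 ZS using image by (subst all_nat) (simp add: One_nat_def)
  have c1: "(\<forall>b<r 0. \<epsilon> b \<in> degree_ideal P \<and> homogeneous (d 0 b) (\<epsilon> b)) \<longleftrightarrow>
      (\<forall>b<r 0. \<epsilon> b \<in> degree_ideal P)"
    using hom_\<epsilon> by auto
  have c3: "(\<forall>i. \<forall>a<r i. \<forall>b<r (Suc i). homogeneous (d (Suc i) b - d i a) (\<phi> i a b)) \<longleftrightarrow> True"
    using hom_\<phi> by auto
  have "?mfr \<longleftrightarrow>
      (\<forall>\<gamma>. \<forall>v\<in>deg_part {..<r 0} (d 0) \<gamma>. ?e v \<noteq> 0 \<longrightarrow> \<gamma> \<in> P) \<and>
      (\<forall>\<gamma>. \<gamma> \<in> P \<longrightarrow> \<gamma> \<notin> Q \<longrightarrow> (\<exists>v\<in>deg_part {..<r 0} (d 0) \<gamma>. ?e v = 1)) \<and>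
      (\<forall>i. \<forall>a<r i. \<forall>b<r (Suc i). d i a = d (Suc i) b \<longrightarrow> ?D i (basis b) a = 0) \<and>
      (\<forall>i \<gamma>. ?D i ` deg_part {..<r (Suc i)} (d (Suc i)) \<gamma> = ?Z i \<gamma>)"
    unfolding minimal_free_resolution_def exact c1 c3 min degree simp_thms
    by (rule conj_cong[OF refl], rule conj_cong[OF onto refl])
  also have "\<dots> \<longleftrightarrow> graded_resolution ?B d ?e ?D P Q" (is "?c1 \<and> ?c2 \<and> ?c3 \<and> ?c4 \<longleftrightarrow> _")
  proof
    assume c: "?c1 \<and> ?c2 \<and> ?c3 \<and> ?c4"
    show "graded_resolution ?B d ?e ?D P Q"
    proof
      show "\<And>i. finite {..<r i}" "lin ?e" "\<And>i. lin (?D i)"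
        using lin_scalar_aug lin_scalar_map by auto
      show "\<And>v \<gamma>. v \<in> deg_part {..<r 0} (d 0) \<gamma> \<Longrightarrow> ?e v \<noteq> 0 \<Longrightarrow> \<gamma> \<in> P"
        using c by blast
      show "\<And>\<gamma>. \<gamma> \<in> P \<Longrightarrow> \<gamma> \<notin> Q \<Longrightarrow> \<exists>v\<in>deg_part {..<r 0} (d 0) \<gamma>. ?e v = 1"
        using c by blast
      show "\<And>b i a. b \<in> {..<r (Suc i)} \<Longrightarrow> a \<in> {..<r i} \<Longrightarrow> d i a = d (Suc i) b \<Longrightarrow>
          ?D i (basis b) a = 0"
        using c by blast
      show "\<And>i \<gamma>. ?D i ` deg_part {..<r (Suc i)} (d (Suc i)) \<gamma> = ?Z i \<gamma>"
        using c by blast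
    qed
  next
    assume "graded_resolution ?B d ?e ?D P Q"
    then interpret graded_resolution ?B d ?e ?D P Q .
    show "?c1 \<and> ?c2 \<and> ?c3 \<and> ?c4"
    proof (intro conjI)
      show ?c1 using e_degree by blast
      show ?c2 using e_onto by blast
      show ?c3 using minimal by blast
      show ?c4 using exact by blast
    qed
  qed
  finally show ?thesis .
qed

lemma graded_resolution_of_minimal:
  fixes \<epsilon> :: "nat \<Rightarrow> ('n, 'k::field) mpoly"
  assumes "minimal_free_resolution (degree_ideal P) (degree_ideal Q) r d \<epsilon> \<phi>"
  shows "graded_resolution (\<lambda>i. {..<r i}) d (scalar_aug (r 0) (d 0) \<epsilon>)
    (\<lambda>i. scalar_map (r i) (r (Suc i)) (d i) (d (Suc i)) (\<phi> i)) P Q"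
proof -
  have h0: "homogeneous (d 0 b) (\<epsilon> b)" if "b < r 0" for b
    using assms[unfolded minimal_free_resolution_def, THEN conjunct1] that by simp
  have h1: "homogeneous (d (Suc i) b - d i a) (\<phi> i a b)" if "a < r i" "b < r (Suc i)" for i a b
    using assms[unfolded minimal_free_resolution_def, THEN conjunct2, THEN conjunct2, THEN conjunct1] that
    by simp
  show ?thesis
    by (rule minimal_free_resolution_iff[THEN iffD1, OF _ _ assms]) (auto intro: h0 h1)
qed

text \<open>By \<open>rank_unique\<close> any minimal resolution may be used to evaluate the
  definite description.\<close>

lemma betti_eq:
  assumes "minimal_free_resolution (degree_ideal P) (degree_ideal Q) r d (\<epsilon> :: nat \<Rightarrow> ('n, 'k::field) mpoly) \<phi>"
  shows "betti (degree_ideal P :: ('n, 'k) mpoly set) (degree_ideal Q) i \<alpha> = card {b. b < r i \<and> d i b = \<alpha>}"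
  unfolding betti_def
proof (rule the_equality)
  fix n
  assume "\<exists>r d (\<epsilon> :: nat \<Rightarrow> ('n, 'k) mpoly) \<phi>.
    minimal_free_resolution (degree_ideal P) (degree_ideal Q) r d \<epsilon> \<phi> \<and> n = card {b. b < r i \<and> d i b = \<alpha>}"
  then obtain r' d' \<phi>' and \<epsilon>' :: "nat \<Rightarrow> ('n, 'k) mpoly" where
    r': "minimal_free_resolution (degree_ideal P) (degree_ideal Q) r' d' \<epsilon>' \<phi>'"
    and n: "n = card {b. b < r' i \<and> d' i b = \<alpha>}" by blast
  have "card {b \<in> {..<r' i}. d' i b = \<alpha>} = card {b \<in> {..<r i}. d i b = \<alpha>}"
    by (rule rank_unique[OF graded_resolution_of_minimal[OF r'] graded_resolution_of_minimal[OF assms]])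
      (rule Q_up)
  then show "n = card {b. b < r i \<and> d i b = \<alpha>}" using n by simp
qed (use assms in blast)

end

section \<open>Realisation of scalar resolutions by polynomial matrices\<close>

context degree_sets
begin

text \<open>The converse passage: generators are renumbered by initial segments of the naturals, and
  each scalar is multiplied by the monomial that makes the entry homogeneous. Arbitrary index types
  are allowed because the mapping cone is indexed by a sum type.\<close>

lemma minimal_free_resolution_exists:
  fixes e :: "('b \<Rightarrow> 'k::field) \<Rightarrow> (unit \<Rightarrow> 'k)"
  assumes "graded_resolution B d e D P Q"
  shows "\<exists>r d' (\<epsilon> :: nat \<Rightarrow> ('n, 'k) mpoly) \<phi>.
    minimal_free_resolution (degree_ideal P) (degree_ideal Q) r d' \<epsilon> \<phi> \<and>
    (\<forall>i \<alpha>. card {c. c < r i \<and> d' i c = \<alpha>} = card {b \<in> B i. d i b = \<alpha>})"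
proof -
  interpret R: graded_resolution B d e D P Q by fact
  define r where "r i = card (B i)" for i
  have "\<exists>\<pi>. bij_betw \<pi> {..<r i} (B i)" for i
    using ex_bij_betw_nat_finite[OF R.fin] by (simp add: r_def lessThan_atLeast0)
  then obtain \<pi> where \<pi>: "\<And>i. bij_betw (\<pi> i) {..<r i} (B i)" by metis
  define \<rho> where "\<rho> i = inv_into {..<r i} (\<pi> i)" for i
  have \<pi>_B: "\<pi> i c \<in> B i" if "c < r i" for i c
    using \<pi> that bij_betwE by blast
  have \<rho>_\<pi>: "\<rho> i (\<pi> i c) = c" if "c < r i" for i c
    using bij_betw_inv_into_left[OF \<pi>, of c i] that by (simp add: \<rho>_def)
  have \<rho>: "\<rho> i b < r i" "\<pi> i (\<rho> i b) = b" if "b \<in> B i" for i b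
    using bij_betwE[OF bij_betw_inv_into[OF \<pi>[of i]]] bij_betw_inv_into_right[OF \<pi>[of i] that] that
    by (auto simp: \<rho>_def)
  define d' where "d' i c = d i (\<pi> i c)" for i c
  define \<epsilon> :: "nat \<Rightarrow> ('n, 'k) mpoly" where "\<epsilon> c = monom_at (d' 0 c) (e (basis (\<pi> 0 c)) ())" for c
  define \<phi> :: "nat \<Rightarrow> nat \<Rightarrow> nat \<Rightarrow> ('n, 'k) mpoly" where
    "\<phi> i a c = monom_at (d' (Suc i) c - d' i a) (D i (basis (\<pi> (Suc i) c)) (\<pi> i a))" for i a c
  let ?e = "scalar_aug (r 0) (d' 0) \<epsilon>"
  let ?D = "\<lambda>i. scalar_map (r i) (r (Suc i)) (d' i) (d' (Suc i)) (\<phi> i)"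
  let ?F = "\<lambda>i \<gamma>. deg_part {..<r i} (d' i) \<gamma> :: (nat \<Rightarrow> 'k) set"
  \<comment> \<open>\<open>T\<close> transports coordinate vectors along the numbering
    \<open>\<pi>\<close>. It is injective only on vectors that vanish from \<open>r i\<close> on,
    hence the support conditions below.\<close>
  define T where "T i v = (\<lambda>b. if b \<in> B i then v (\<rho> i b) else 0)" for i and v :: "nat \<Rightarrow> 'k"
  have lin_T: "lin (T i)" for i
    by (rule linI) (auto simp: T_def fun_eq_iff)
  have T_\<pi>: "T i v (\<pi> i c) = v c" if "c < r i" for i c v
    using that by (simp add: T_def \<pi>_B \<rho>_\<pi>)
  have T_F: "T i v \<in> R.F i \<gamma> \<longleftrightarrow> v \<in> ?F i \<gamma>" if "\<And>c. r i \<le> c \<Longrightarrow> v c = 0" for i v \<gamma>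
  proof
    assume "T i v \<in> R.F i \<gamma>"
    then show "v \<in> ?F i \<gamma>"
      unfolding deg_part_def d'_def mem_Collect_eq using T_\<pi>[of _ i v] that by (metis lessThan_iff not_le)
  next
    assume "v \<in> ?F i \<gamma>"
    then show "T i v \<in> R.F i \<gamma>"
      unfolding deg_part_def d'_def by (auto simp: T_def \<rho>)
  qed
  have F_supp: "v c = 0" if "v \<in> ?F i \<gamma>" "r i \<le> c" for i v \<gamma> c
    using that by (force simp: deg_part_def)
  have T_onto: "\<exists>v\<in>?F i \<gamma>. T i v = w" if w: "w \<in> R.F i \<gamma>" for i w \<gamma>
  proof
    let ?v = "\<lambda>c. if c < r i then w (\<pi> i c) else 0"
    show "T i ?v = w"
      using w by (auto simp: T_def fun_eq_iff \<rho> deg_part_def)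
    then show "?v \<in> ?F i \<gamma>" using T_F[of i ?v \<gamma>] w by simp
  qed
  have T_inj: "v = 0" if "v \<in> ?F i \<gamma>" "T i v = 0" for i v \<gamma>
  proof
    fix c show "v c = 0 c"
      using that F_supp[OF that(1), of c] T_\<pi>[of c i v] by (cases "c < r i") auto
  qed
  have T_basis: "T i (basis c) = basis (\<pi> i c)" if "c < r i" for i c
    using that by (auto simp: T_def basis_def fun_eq_iff \<rho> \<rho>_\<pi> \<pi>_B)
  have T_sum: "(\<Sum>b\<in>B i. T i v b * x b) = (\<Sum>c<r i. v c * x (\<pi> i c))" for i v x
    unfolding sum.reindex_bij_betw[OF \<pi>, symmetric] by (simp add: T_\<pi>)
  have e: "?e v = e (T 0 v)" if v: "v \<in> ?F 0 \<gamma>" for v \<gamma>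
  proof -
    have T: "T 0 v \<in> R.F 0 \<gamma>" using T_F v F_supp[OF v] by blast
    \<comment> \<open>\<open>monom_at\<close> discards a scalar whose degree is not nonnegative.
      Nothing is lost: a nonzero augmentation puts the degree into \<open>P\<close>; for the
      differential below, a nonzero entry forces \<open>d' i a \<le> d' (Suc i) c\<close>.\<close>
    have "coeff_at (\<epsilon> c) (d' 0 c) = e (basis (\<pi> 0 c)) ()" if "c < r 0" for c
    proof (cases "e (basis (\<pi> 0 c)) = 0")
      case False
      then have "d' 0 c \<in> P" unfolding d'_def using R.e_degree[OF basis_deg_part[OF \<pi>_B[OF that] order_refl]] by blast
      then show ?thesis using P_nonneg by (simp add: \<epsilon>_def coeff_at_monom_at)
    qed (simp add: \<epsilon>_def coeff_at_monom_at)
    then show ?thesis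
      unfolding lin_expand[OF R.lin_e R.fin T] T_sum scalar_aug_def
      by (auto simp: fun_eq_iff mult.commute intro!: sum.cong)
  qed
  have D: "T i (?D i v) = D i (T (Suc i) v)" if v: "v \<in> ?F (Suc i) \<gamma>" for i v \<gamma>
  proof
    fix b
    have T: "T (Suc i) v \<in> R.F (Suc i) \<gamma>" using T_F v F_supp[OF v] by blast
    show "T i (?D i v) b = D i (T (Suc i) v) b"
    proof (cases "b \<in> B i")
      case True
      then obtain a where a: "a < r i" "b = \<pi> i a" using \<rho> by metis
      have "coeff_at (\<phi> i a c) (d' (Suc i) c - d' i a) = D i (basis (\<pi> (Suc i) c)) (\<pi> i a)"
        if "c < r (Suc i)" for c
      proof (cases "D i (basis (\<pi> (Suc i) c)) (\<pi> i a) = 0")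
        case False
        then have "d' i a \<le> d' (Suc i) c"
          using R.D_F[OF basis_deg_part[OF \<pi>_B[OF that] order_refl]] unfolding d'_def deg_part_def by blast
        then show ?thesis by (simp add: \<phi>_def coeff_at_monom_at)
      qed (simp add: \<phi>_def coeff_at_monom_at)
      then show ?thesis
        unfolding lin_expand[OF R.lin_D R.fin T] T_sum a(2) T_\<pi>[OF a(1)]
        using a(1) by (auto simp: scalar_map_def mult.commute intro!: sum.cong)
    next
      case False
      then show ?thesis using R.D_F[OF T] by (auto simp: T_def deg_part_def)
    qed
  qed
  have D_supp: "?D i v c = 0" if "r i \<le> c" for i v c
    using that by (simp add: scalar_map_def)
  have cycles: "v \<in> cycles (\<lambda>i. {..<r i}) d' ?e ?D Q i \<gamma> \<longleftrightarrow> v \<in> ?F i \<gamma> \<and> T i v \<in> R.Z i \<gamma>" for i v \<gamma>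
  proof (cases i)
    case 0
    then show ?thesis using e T_F F_supp by (auto simp: cycles_def)
  next
    case (Suc j)
    have "?D j v = 0 \<longleftrightarrow> D j (T (Suc j) v) = 0" if v: "v \<in> ?F (Suc j) \<gamma>"
    proof -
      have "T j (?D j v) \<in> R.F j \<gamma>"
        unfolding D[OF v] using R.D_F T_F v F_supp[OF v] by blast
      then have "?D j v \<in> ?F j \<gamma>" using T_F D_supp by blast
      then show ?thesis using T_inj D[OF v] lin_zero[OF lin_T] by metis
    qed
    then show ?thesis using Suc T_F F_supp by (auto simp: cycles_def)
  qed
  have "graded_resolution (\<lambda>i. {..<r i}) d' ?e ?D P Q"
  proof
    show "\<And>i. finite {..<r i}" "lin ?e" "\<And>i. lin (?D i)"
      using lin_scalar_aug lin_scalar_map by auto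
    show "\<gamma> \<in> P" if "v \<in> ?F 0 \<gamma>" "?e v \<noteq> 0" for v \<gamma>
    proof -
      have "T 0 v \<in> R.F 0 \<gamma>" using T_F that(1) F_supp[OF that(1)] by blast
      then show ?thesis using R.e_degree e[OF that(1)] that(2) by simp
    qed
    show "\<exists>v\<in>?F 0 \<gamma>. ?e v = 1" if "\<gamma> \<in> P" "\<gamma> \<notin> Q" for \<gamma>
      using R.e_onto[OF that] T_onto e by metis
    show "?D i (basis b) a = 0"
      if "b \<in> {..<r (Suc i)}" "a \<in> {..<r i}" "d' i a = d' (Suc i) b" for b i a
    proof -
      have b: "basis b \<in> ?F (Suc i) (d' (Suc i) b)" using basis_deg_part[OF that(1) order_refl] .
      have "?D i (basis b) a = D i (T (Suc i) (basis b)) (\<pi> i a)"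
        using T_\<pi>[of a i "?D i (basis b)"] that(2) unfolding D[OF b] by simp
      then show ?thesis
        using R.minimal[of "\<pi> (Suc i) b" i "\<pi> i a"] that \<pi>_B T_basis by (simp add: d'_def)
    qed
    show "?D i ` ?F (Suc i) \<gamma> = cycles (\<lambda>i. {..<r i}) d' ?e ?D Q i \<gamma>" for i \<gamma>
    proof (intro set_eqI iffI)
      fix x assume "x \<in> ?D i ` ?F (Suc i) \<gamma>"
      then obtain v where v: "v \<in> ?F (Suc i) \<gamma>" "x = ?D i v" by blast
      have "T (Suc i) v \<in> R.F (Suc i) \<gamma>" using T_F v(1) F_supp[OF v(1)] by blast
      then have Z: "T i x \<in> R.Z i \<gamma>" using R.D_cycle D[OF v(1)] v(2) by simp
      then have "x \<in> ?F i \<gamma>" using T_F[of i x \<gamma>] D_supp v(2) R.Z_F by blast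
      then show "x \<in> cycles (\<lambda>i. {..<r i}) d' ?e ?D Q i \<gamma>" using cycles Z by blast
    next
      fix x assume "x \<in> cycles (\<lambda>i. {..<r i}) d' ?e ?D Q i \<gamma>"
      then have x: "x \<in> ?F i \<gamma>" "T i x \<in> R.Z i \<gamma>" using cycles by blast+
      from x(2) obtain w where w: "w \<in> R.F (Suc i) \<gamma>" "D i w = T i x"
        unfolding R.exact[symmetric] by auto
      then obtain v where v: "v \<in> ?F (Suc i) \<gamma>" "T (Suc i) v = w" using T_onto by blast
      have eq: "T i (?D i v) = T i x" using D[OF v(1)] v(2) w(2) by simp
      then have "?D i v \<in> ?F i \<gamma>" using T_F[of i "?D i v" \<gamma>] D_supp x(2) R.Z_F by metis
      then have "?D i v - x \<in> ?F i \<gamma>" by (rule deg_part_diff[OF _ x(1)])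
      moreover have "T i (?D i v - x) = 0" using eq by (simp add: lin_diff[OF lin_T])
      ultimately have "?D i v - x = 0" by (rule T_inj)
      then show "x \<in> ?D i ` ?F (Suc i) \<gamma>" using v(1) by (metis eq_iff_diff_eq_0 imageI)
    qed
  qed
  moreover have "homogeneous (d' 0 b) (\<epsilon> b)" for b by (simp add: \<epsilon>_def homogeneous_monom_at)
  moreover have "homogeneous (d' (Suc i) b - d' i a) (\<phi> i a b)" for i a b
    by (simp add: \<phi>_def homogeneous_monom_at)
  ultimately have mfr: "minimal_free_resolution (degree_ideal P) (degree_ideal Q) r d' \<epsilon> \<phi>"
    using minimal_free_resolution_iff[of r d' \<epsilon> \<phi>] by simp
  have "card {c. c < r i \<and> d' i c = \<alpha>} = card {b \<in> B i. d i b = \<alpha>}" for i \<alpha>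
  proof -
    have "bij_betw (\<pi> i) {c. c < r i \<and> d' i c = \<alpha>} {b \<in> B i. d i b = \<alpha>}"
      by (rule bij_betw_byWitness[of _ "\<rho> i"]) (auto simp: \<rho> \<rho>_\<pi> \<pi>_B d'_def)
    then show ?thesis by (rule bij_betw_same_card)
  qed
  then show ?thesis using mfr by blast
qed

end

section \<open>The mapping cone\<close>

locale mapping_cone =
  R1: graded_resolution B1 d1 e1 D1 P1 "{}" + R2: graded_resolution B2 d2 e2 D2 P2 "{}" +
  R3: graded_resolution B3 d3 e3 D3 "P1 \<inter> P2" "{}"
  for B1 :: "nat \<Rightarrow> 'a set" and d1 :: "nat \<Rightarrow> 'a \<Rightarrow> 'p::order"
    and e1 :: "('a \<Rightarrow> 'k::field) \<Rightarrow> (unit \<Rightarrow> 'k)" and D1 P1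
    and B2 :: "nat \<Rightarrow> 'b set" and d2 :: "nat \<Rightarrow> 'b \<Rightarrow> 'p"
    and e2 :: "('b \<Rightarrow> 'k) \<Rightarrow> (unit \<Rightarrow> 'k)" and D2 P2
    and B3 :: "nat \<Rightarrow> 'c set" and d3 :: "nat \<Rightarrow> 'c \<Rightarrow> 'p"
    and e3 :: "('c \<Rightarrow> 'k) \<Rightarrow> (unit \<Rightarrow> 'k)" and D3 +
  fixes f :: "nat \<Rightarrow> ('c \<Rightarrow> 'k) \<Rightarrow> ('a \<Rightarrow> 'k)" and g :: "nat \<Rightarrow> ('c \<Rightarrow> 'k) \<Rightarrow> ('b \<Rightarrow> 'k)"
  assumes f: "comparison_map B3 d3 e3 D3 B1 d1 e1 D1 {} f"
    and g: "comparison_map B3 d3 e3 D3 B2 d2 e2 D2 {} g"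
    and disjoint1: "a \<in> B1 i \<Longrightarrow> c \<in> B3 i \<Longrightarrow> d1 i a \<noteq> d3 i c"
    and disjoint2: "b \<in> B2 i \<Longrightarrow> c \<in> B3 i \<Longrightarrow> d2 i b \<noteq> d3 i c"
begin

definition p1 :: "('a + 'b + 'c \<Rightarrow> 'k) \<Rightarrow> ('a \<Rightarrow> 'k)" where "p1 v = (\<lambda>x. v (Inl x))"
definition p2 :: "('a + 'b + 'c \<Rightarrow> 'k) \<Rightarrow> ('b \<Rightarrow> 'k)" where "p2 v = (\<lambda>x. v (Inr (Inl x)))"
definition p3 :: "('a + 'b + 'c \<Rightarrow> 'k) \<Rightarrow> ('c \<Rightarrow> 'k)" where "p3 v = (\<lambda>x. v (Inr (Inr x)))"

abbreviation join :: "('a \<Rightarrow> 'k) \<Rightarrow> ('b \<Rightarrow> 'k) \<Rightarrow> ('c \<Rightarrow> 'k) \<Rightarrow> ('a + 'b + 'c \<Rightarrow> 'k)" where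
  "join x y z \<equiv> case_sum x (case_sum y z)"

definition cB :: "nat \<Rightarrow> ('a + 'b + 'c) set" where
  "cB i = B1 i <+> (B2 i <+> (case i of 0 \<Rightarrow> {} | Suc j \<Rightarrow> B3 j))"

definition cd :: "nat \<Rightarrow> 'a + 'b + 'c \<Rightarrow> 'p" where
  "cd i = case_sum (d1 i) (case_sum (d2 i) (d3 (i - 1)))"

definition ce :: "('a + 'b + 'c \<Rightarrow> 'k) \<Rightarrow> (unit \<Rightarrow> 'k)" where
  "ce v = e1 (p1 v) + e2 (p2 v)"

text \<open>The sign makes the mixed terms cancel in the square of \<open>cD\<close>. At index 0 the
  cone has no third summand to map to.\<close>

definition D3' :: "nat \<Rightarrow> ('c \<Rightarrow> 'k) \<Rightarrow> ('c \<Rightarrow> 'k)" where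
  "D3' i v = (case i of 0 \<Rightarrow> 0 | Suc j \<Rightarrow> - D3 j v)"

text \<open>The cone over the sequence 0 -> J \<inter> K -> J \<oplus> K -> J + K -> 0, in which w
  is sent to (w, -w); hence the opposite signs of \<open>f\<close> and \<open>g\<close>.\<close>

definition cD :: "nat \<Rightarrow> ('a + 'b + 'c \<Rightarrow> 'k) \<Rightarrow> ('a + 'b + 'c \<Rightarrow> 'k)" where
  "cD i v = join (D1 i (p1 v) + f i (p3 v)) (D2 i (p2 v) - g i (p3 v)) (D3' i (p3 v))"

lemma p_join [simp]: "p1 (join x y z) = x" "p2 (join x y z) = y" "p3 (join x y z) = z"
  by (auto simp: p1_def p2_def p3_def)

lemma p_eqI: "p1 v = p1 w \<Longrightarrow> p2 v = p2 w \<Longrightarrow> p3 v = p3 w \<Longrightarrow> v = w"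
  unfolding p1_def p2_def p3_def fun_eq_iff by (metis sum.exhaust)

lemma p_zero [simp]: "p1 0 = 0" "p2 0 = 0" "p3 0 = 0"
  by (auto simp: p1_def p2_def p3_def)

lemma p_cD [simp]: "p1 (cD i v) = D1 i (p1 v) + f i (p3 v)"
  "p2 (cD i v) = D2 i (p2 v) - g i (p3 v)" "p3 (cD i v) = D3' i (p3 v)"
  by (simp_all add: cD_def)

lemma lin_p: "lin p1" "lin p2" "lin p3"
  by (auto intro!: linI simp: p1_def p2_def p3_def)

lemma lin_f: "lin (f i)" and lin_g: "lin (g i)"
  using comparison_mapD(1)[OF f] comparison_mapD(1)[OF g] by auto

lemma lin_D3': "lin (D3' i)"
proof (cases i)
  case 0
  then show ?thesis by (auto intro!: linI simp: D3'_def fun_eq_iff)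
next
  case (Suc j)
  then show ?thesis
    by (auto intro!: linI simp: D3'_def lin_add[OF R3.lin_D] lin_scale[OF R3.lin_D] fun_eq_iff)
qed

lemma cF_0: "v \<in> deg_part (cB 0) (cd 0) \<gamma> \<longleftrightarrow> p1 v \<in> R1.F 0 \<gamma> \<and> p2 v \<in> R2.F 0 \<gamma> \<and> p3 v = 0"
  unfolding deg_part_def cB_def cd_def p1_def p2_def p3_def
  by (auto simp: fun_eq_iff split_sum_all Plus_def)

lemma cF_Suc: "v \<in> deg_part (cB (Suc i)) (cd (Suc i)) \<gamma> \<longleftrightarrow>
    p1 v \<in> R1.F (Suc i) \<gamma> \<and> p2 v \<in> R2.F (Suc i) \<gamma> \<and> p3 v \<in> R3.F i \<gamma>"
  unfolding deg_part_def cB_def cd_def p1_def p2_def p3_def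
  by (auto simp: fun_eq_iff split_sum_all Plus_def)

lemma e_D1: "v \<in> R1.F (Suc 0) \<gamma> \<Longrightarrow> e1 (D1 0 v) = 0"
  using R1.D_cycle R1.Z_0 by blast

lemma e_D2: "v \<in> R2.F (Suc 0) \<gamma> \<Longrightarrow> e2 (D2 0 v) = 0"
  using R2.D_cycle R2.Z_0 by blast

lemma cD_F: 
  assumes v: "v \<in> deg_part (cB (Suc i)) (cd (Suc i)) \<gamma>"
  shows "cD i v \<in> deg_part (cB i) (cd i) \<gamma>"
proof -
  note v' = v[unfolded cF_Suc]
  have 1: "D1 i (p1 v) + f i (p3 v) \<in> R1.F i \<gamma>"
    using v' by (intro deg_part_add R1.D_F comparison_mapD(2)[OF f]) auto
  have 2: "D2 i (p2 v) - g i (p3 v) \<in> R2.F i \<gamma>"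
    using v' by (intro deg_part_diff R2.D_F comparison_mapD(2)[OF g]) auto
  show ?thesis
  proof (cases i)
    case 0
    then show ?thesis using 1 2 by (simp add: cF_0 D3'_def)
  next
    case (Suc j)
    then have "D3' i (p3 v) \<in> R3.F j \<gamma>"
      using v' R3.D_F[of "p3 v" j \<gamma>] by (simp add: D3'_def deg_part_uminus)
    then show ?thesis using 1 2 Suc by (simp add: cF_Suc)
  qed
qed

lemma ce_cD:
  assumes v: "v \<in> deg_part (cB (Suc 0)) (cd (Suc 0)) \<gamma>"
  shows "ce (cD 0 v) = 0"
proof -
  note v' = v[unfolded cF_Suc]
  have "e1 (f 0 (p3 v)) = e3 (p3 v)" "e2 (g 0 (p3 v)) = e3 (p3 v)"
    using comparison_mapD(3)[OF f, of "p3 v" \<gamma>] comparison_mapD(3)[OF g, of "p3 v" \<gamma>] v' by auto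
  moreover have "e1 (D1 0 (p1 v)) = 0" "e2 (D2 0 (p2 v)) = 0" using e_D1 e_D2 v' by blast+
  ultimately show ?thesis
    by (simp add: ce_def lin_add[OF R1.lin_e] lin_diff[OF R2.lin_e])
qed

lemma cD_cD:
  assumes v: "v \<in> deg_part (cB (Suc (Suc i))) (cd (Suc (Suc i))) \<gamma>"
  shows "cD i (cD (Suc i) v) = 0"
proof (rule p_eqI)
  note v' = v[unfolded cF_Suc]
  show "p1 (cD i (cD (Suc i) v)) = p1 0"
    using v' comparison_mapD(4)[OF f, of "p3 v" i \<gamma>] R1.D_D[of "p1 v" i \<gamma>]
    by (simp add: D3'_def lin_add[OF R1.lin_D] lin_uminus[OF lin_f])
  show "p2 (cD i (cD (Suc i) v)) = p2 0"
    using v' comparison_mapD(4)[OF g, of "p3 v" i \<gamma>] R2.D_D[of "p2 v" i \<gamma>]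
    by (simp add: D3'_def lin_diff[OF R2.lin_D] lin_uminus[OF lin_g])
  show "p3 (cD i (cD (Suc i) v)) = p3 0"
  proof (cases i)
    case (Suc j)
    then show ?thesis using v' R3.D_D[of "p3 v" j \<gamma>] by (simp add: D3'_def lin_uminus[OF R3.lin_D])
  qed (simp add: D3'_def)
qed

text \<open>Once the third coordinate \<open>w\<close> of a preimage is known, exactness of the two
  given resolutions supplies the other coordinates. Both exactness proofs thus reduce to finding
  \<open>w\<close>.\<close>

lemma cone_preimage:
  assumes "p1 x - f i w \<in> R1.Z i \<gamma>" "p2 x + g i w \<in> R2.Z i \<gamma>" "p3 x = D3' i w" "w \<in> R3.F i \<gamma>"
  shows "x \<in> cD i ` deg_part (cB (Suc i)) (cd (Suc i)) \<gamma>"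
proof -
  obtain w1 where w1: "w1 \<in> R1.F (Suc i) \<gamma>" "D1 i w1 = p1 x - f i w"
    using assms(1) unfolding R1.exact[symmetric] by auto
  obtain w2 where w2: "w2 \<in> R2.F (Suc i) \<gamma>" "D2 i w2 = p2 x + g i w"
    using assms(2) unfolding R2.exact[symmetric] by auto
  have "cD i (join w1 w2 w) = x"
    by (rule p_eqI) (simp_all add: w1 w2 assms(3))
  moreover have "join w1 w2 w \<in> deg_part (cB (Suc i)) (cd (Suc i)) \<gamma>"
    unfolding cF_Suc using w1 w2 assms(4) by simp
  ultimately show ?thesis by (metis imageI)
qed

text \<open>The two augmentations of \<open>x\<close> cancel. If they are nonzero, the degree lies
  in both \<open>P1\<close> and \<open>P2\<close>, so their common value is attained by the
  resolution of the intersection.\<close>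

lemma cone_exact_0:
  assumes x: "x \<in> deg_part (cB 0) (cd 0) \<gamma>" "ce x = 0"
  shows "x \<in> cD 0 ` deg_part (cB (Suc 0)) (cd (Suc 0)) \<gamma>"
proof -
  note x' = x(1)[unfolded cF_0]
  have sum: "e1 (p1 x) + e2 (p2 x) = 0" using x(2) by (simp add: ce_def)
  have "\<exists>w\<in>R3.F 0 \<gamma>. e3 w = e1 (p1 x)"
  proof (cases "e1 (p1 x) = 0")
    case True
    then show ?thesis using lin_zero[OF R3.lin_e] deg_part_zero by metis
  next
    case False
    moreover from this have "e2 (p2 x) \<noteq> 0" using sum by auto
    ultimately have "\<gamma> \<in> P1 \<inter> P2" using R1.e_degree R2.e_degree x' by blast
    then obtain w where w: "w \<in> R3.F 0 \<gamma>" "e3 w = 1" using R3.e_onto by blast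
    have "e3 (\<lambda>a. e1 (p1 x) () * w a) = e1 (p1 x)"
      using lin_scale[OF R3.lin_e, of _ w] w(2) by (simp add: fun_eq_iff)
    then show ?thesis using deg_part_scale[OF w(1)] by blast
  qed
  then obtain w where w: "w \<in> R3.F 0 \<gamma>" "e3 w = e1 (p1 x)" by blast
  show ?thesis
  proof (rule cone_preimage[OF _ _ _ w(1)])
    show "p1 x - f 0 w \<in> R1.Z 0 \<gamma>"
      using x' w comparison_mapD(2,3)[OF f w(1)]
      by (simp add: R1.Z_0 deg_part_diff lin_diff[OF R1.lin_e])
    show "p2 x + g 0 w \<in> R2.Z 0 \<gamma>"
      using x' w comparison_mapD(2,3)[OF g w(1)] sum
      by (simp add: R2.Z_0 deg_part_add lin_add[OF R2.lin_e] add.commute)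
    show "p3 x = D3' 0 w" using x' by (simp add: D3'_def)
  qed
qed

text \<open>The third coordinate of a cycle is itself a cycle, hence a boundary
  \<open>D3 j u\<close>; the sign in \<open>D3'\<close> makes \<open>- u\<close> the coordinate to
  lift.\<close>

lemma cone_exact_Suc:
  assumes x: "x \<in> deg_part (cB (Suc j)) (cd (Suc j)) \<gamma>" "cD j x = 0"
  shows "x \<in> cD (Suc j) ` deg_part (cB (Suc (Suc j))) (cd (Suc (Suc j))) \<gamma>"
proof -
  note x' = x(1)[unfolded cF_Suc]
  have 1: "D1 j (p1 x) = - f j (p3 x)"
    using p_cD(1)[of j x] x(2) by (simp add: eq_neg_iff_add_eq_0)
  have 2: "D2 j (p2 x) = g j (p3 x)"
    using p_cD(2)[of j x] x(2) by simp
  have 3: "D3' j (p3 x) = 0"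
    using p_cD(3)[of j x] x(2) by simp
  \<comment> \<open>For \<open>j = 0\<close> the third row of the cone gives no information. The
    augmentation of \<open>p3 x\<close> equals that of \<open>f 0 (p3 x)\<close>, which is a
    boundary up to sign and so has augmentation zero.\<close>
  have "p3 x \<in> R3.Z j \<gamma>"
  proof (cases j)
    case 0
    have "e3 (p3 x) = e1 (f 0 (p3 x))" using comparison_mapD(3)[OF f, of "p3 x" \<gamma>] x' 0 by simp
    also have "\<dots> = - e1 (D1 0 (p1 x))" using 1 0 by (simp add: lin_uminus[OF R1.lin_e])
    also have "\<dots> = 0" using e_D1[of "p1 x" \<gamma>] x' 0 by simp
    finally show ?thesis using x' 0 by (simp add: R3.Z_0)
  next
    case (Suc k)
    then show ?thesis using 3 x' by (simp add: D3'_def R3.Z_Suc)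
  qed
  then obtain u where u: "u \<in> R3.F (Suc j) \<gamma>" "D3 j u = p3 x"
    unfolding R3.exact[symmetric] by auto
  show ?thesis
  proof (rule cone_preimage[OF _ _ _ deg_part_uminus[OF u(1)]])
    have fu: "f (Suc j) u \<in> R1.F (Suc j) \<gamma>" and gu: "g (Suc j) u \<in> R2.F (Suc j) \<gamma>"
      using comparison_mapD(2)[OF f u(1)] comparison_mapD(2)[OF g u(1)] .
    show "p1 x - f (Suc j) (- u) \<in> R1.Z (Suc j) \<gamma>"
      using x' fu 1 comparison_mapD(4)[OF f u(1)] u(2)
      by (simp add: R1.Z_Suc deg_part_add lin_add[OF R1.lin_D] lin_uminus[OF lin_f])
    show "p2 x + g (Suc j) (- u) \<in> R2.Z (Suc j) \<gamma>"
      using x' gu 2 comparison_mapD(4)[OF g u(1)] u(2)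
      by (simp add: R2.Z_Suc deg_part_diff lin_diff[OF R2.lin_D] lin_uminus[OF lin_g])
    show "p3 x = D3' (Suc j) (- u)"
      using u(2) by (simp add: D3'_def lin_uminus[OF R3.lin_D])
  qed
qed

text \<open>Only the blocks \<open>f\<close> and \<open>g\<close> need more than the given
  minimality. They join generators of the same index \<open>i\<close>, and there equal degrees are
  excluded by \<open>disjoint1\<close> and \<open>disjoint2\<close>.\<close>

lemma cone_minimal:
  assumes b: "b \<in> cB (Suc i)" and a: "a \<in> cB i" and eq: "cd i a = cd (Suc i) b"
  shows "cD i (basis b) a = 0"
proof -
  let ?v = "basis b :: 'a + 'b + 'c \<Rightarrow> 'k" and ?\<delta> = "cd (Suc i) b"
  have "?v \<in> deg_part (cB (Suc i)) (cd (Suc i)) ?\<delta>" by (rule basis_deg_part[OF b order_refl])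
  then have v: "p1 ?v \<in> R1.F (Suc i) ?\<delta>" "p2 ?v \<in> R2.F (Suc i) ?\<delta>" "p3 ?v \<in> R3.F i ?\<delta>"
    unfolding cF_Suc by blast+
  have p3: "p3 ?v = 0 \<or> (\<exists>c\<in>B3 i. d3 i c = ?\<delta>)"
    using b by (auto simp: cB_def cd_def p3_def basis_def fun_eq_iff)
  consider (1) x where "a = Inl x" "x \<in> B1 i" | (2) y where "a = Inr (Inl y)" "y \<in> B2 i"
    | (3) z j where "a = Inr (Inr z)" "i = Suc j" "z \<in> B3 j"
    using a by (auto simp: cB_def split: nat.splits)
  then show ?thesis
  proof cases
    case 1
    then have "D1 i (p1 ?v) x = 0" using R1.minimal_vector[OF v(1)] eq by (simp add: cd_def)
    moreover have "d1 i x = ?\<delta>" unfolding eq[symmetric] 1(1) by (simp add: cd_def)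
    then have "p3 ?v = 0" using p3 disjoint1[OF 1(2)] by metis
    then have "f i (p3 ?v) = 0" by (simp add: lin_zero[OF lin_f])
    ultimately show ?thesis using 1 by (simp add: cD_def)
  next
    case 2
    then have "D2 i (p2 ?v) y = 0" using R2.minimal_vector[OF v(2)] eq by (simp add: cd_def)
    moreover have "d2 i y = ?\<delta>" unfolding eq[symmetric] 2(1) by (simp add: cd_def)
    then have "p3 ?v = 0" using p3 disjoint2[OF 2(2)] by metis
    then have "g i (p3 ?v) = 0" by (simp add: lin_zero[OF lin_g])
    ultimately show ?thesis using 2 by (simp add: cD_def)
  next
    case 3
    then have "D3 j (p3 ?v) z = 0" using R3.minimal_vector[of "p3 ?v" j ?\<delta> z] v(3) eq by (simp add: cd_def)
    then show ?thesis using 3 by (simp add: cD_def D3'_def)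
  qed
qed

lemma graded_resolution_cone: "graded_resolution cB cd ce cD (P1 \<union> P2) {}"
proof
  show "finite (cB i)" for i
    by (auto simp: cB_def R1.fin R2.fin R3.fin split: nat.split)
  show "lin ce"
    by (rule linI) (auto simp: ce_def lin_add[OF lin_p(1)] lin_add[OF lin_p(2)] lin_scale[OF lin_p(1)]
        lin_scale[OF lin_p(2)] lin_add[OF R1.lin_e] lin_add[OF R2.lin_e] lin_scale[OF R1.lin_e]
        lin_scale[OF R2.lin_e] fun_eq_iff algebra_simps)
  show "lin (cD i)" for i
  proof (rule linI)
    show "cD i (v + w) = cD i v + cD i w" for v w
      by (rule p_eqI) (simp_all add: lin_add[OF lin_p(1)] lin_add[OF lin_p(2)] lin_add[OF lin_p(3)]
          lin_add[OF R1.lin_D] lin_add[OF R2.lin_D] lin_add[OF lin_D3'] lin_add[OF lin_f] lin_add[OF lin_g])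
    show "cD i (\<lambda>a. c * v a) = (\<lambda>b. c * cD i v b)" for c v
      by (rule p_eqI) (simp_all add: lin_scale[OF lin_p(1)] lin_scale[OF lin_p(2)] lin_scale[OF lin_p(3)]
          lin_scale[OF R1.lin_D] lin_scale[OF R2.lin_D] lin_scale[OF lin_D3'] lin_scale[OF lin_f]
          lin_scale[OF lin_g] fun_eq_iff algebra_simps)
  qed
  show "\<gamma> \<in> P1 \<union> P2" if "v \<in> deg_part (cB 0) (cd 0) \<gamma>" "ce v \<noteq> 0" for v \<gamma>
  proof -
    have "e1 (p1 v) \<noteq> 0 \<or> e2 (p2 v) \<noteq> 0" using that(2) by (auto simp: ce_def)
    then show ?thesis using that(1) R1.e_degree R2.e_degree unfolding cF_0 by blast
  qed
  show "\<exists>v\<in>deg_part (cB 0) (cd 0) \<gamma>. ce v = 1" if "\<gamma> \<in> P1 \<union> P2" "\<gamma> \<notin> {}" for \<gamma>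
  proof (cases "\<gamma> \<in> P1")
    case True
    then obtain v where "v \<in> R1.F 0 \<gamma>" "e1 v = 1" using R1.e_onto by blast
    then show ?thesis
      by (intro bexI[of _ "join v 0 0"]) (simp_all add: cF_0 ce_def lin_zero[OF R2.lin_e])
  next
    case False
    then have "\<gamma> \<in> P2" using that by blast
    then obtain v where "v \<in> R2.F 0 \<gamma>" "e2 v = 1" using R2.e_onto by blast
    then show ?thesis
      by (intro bexI[of _ "join 0 v 0"]) (simp_all add: cF_0 ce_def lin_zero[OF R1.lin_e])
  qed
  show "cD i (basis b) a = 0" if "b \<in> cB (Suc i)" "a \<in> cB i" "cd i a = cd (Suc i) b" for b i a
    using cone_minimal[OF that] .
  show "cD i ` deg_part (cB (Suc i)) (cd (Suc i)) \<gamma> = cycles cB cd ce cD {} i \<gamma>" for i \<gamma>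
  proof (cases i)
    case 0
    then show ?thesis using cD_F ce_cD cone_exact_0 by (auto simp: cycles_def)
  next
    case (Suc j)
    then show ?thesis using cD_F cD_cD cone_exact_Suc by (auto simp: cycles_def)
  qed
qed

lemma card_cone:
  "card {b \<in> cB i. cd i b = \<alpha>} = card {b \<in> B1 i. d1 i b = \<alpha>} + card {b \<in> B2 i. d2 i b = \<alpha>} +
     (if i = 0 then 0 else card {b \<in> B3 (i - 1). d3 (i - 1) b = \<alpha>})"
proof -
  let ?C = "if i = 0 then {} else {b \<in> B3 (i - 1). d3 (i - 1) b = \<alpha>}"
  have "{b \<in> cB i. cd i b = \<alpha>} = {b \<in> B1 i. d1 i b = \<alpha>} <+> ({b \<in> B2 i. d2 i b = \<alpha>} <+> ?C)"
    by (auto simp: cB_def cd_def split: nat.splits)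
  moreover have "finite ?C" using R3.fin by simp
  ultimately show ?thesis using R1.fin R2.fin by (simp add: card_Plus)
qed

end

section \<open>Betti numbers\<close>

text \<open>\<open>betti\<close> carries information only where a minimal resolution exists, so
  existence is propagated through the splittings together with the Betti numbers.\<close>

definition has_resolution :: "('n, 'k::field) mpoly set \<Rightarrow> ('n, 'k) mpoly set \<Rightarrow> bool" where
  "has_resolution A B \<longleftrightarrow> (\<exists>r d \<epsilon> \<phi>. minimal_free_resolution A B r d \<epsilon> \<phi>)"

context degree_sets
begin

lemma betti_of_graded_resolution:
  fixes e :: "('b \<Rightarrow> 'k::field) \<Rightarrow> (unit \<Rightarrow> 'k)"
  assumes "graded_resolution B d e D P Q"
  shows "has_resolution (degree_ideal P :: ('n, 'k) mpoly set) (degree_ideal Q)"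
    and "betti (degree_ideal P :: ('n, 'k) mpoly set) (degree_ideal Q) i \<alpha> = card {b \<in> B i. d i b = \<alpha>}"
proof -
  obtain r d' \<phi> and \<epsilon> :: "nat \<Rightarrow> ('n, 'k) mpoly" where
    m: "minimal_free_resolution (degree_ideal P) (degree_ideal Q) r d' \<epsilon> \<phi>" and
    c: "\<And>i \<alpha>. card {c. c < r i \<and> d' i c = \<alpha>} = card {b \<in> B i. d i b = \<alpha>}"
    using minimal_free_resolution_exists[OF assms] by blast
  show "has_resolution (degree_ideal P :: ('n, 'k) mpoly set) (degree_ideal Q)"
    using m unfolding has_resolution_def by blast
  show "betti (degree_ideal P :: ('n, 'k) mpoly set) (degree_ideal Q) i \<alpha> = card {b \<in> B i. d i b = \<alpha>}"
    using betti_eq[OF m] c by simp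
qed

lemma graded_resolution_of_has_resolution:
  assumes "has_resolution (degree_ideal P :: ('n, 'k::field) mpoly set) (degree_ideal Q)"
  shows "\<exists>(B :: nat \<Rightarrow> nat set) d (e :: (nat \<Rightarrow> 'k) \<Rightarrow> (unit \<Rightarrow> 'k)) D. graded_resolution B d e D P Q \<and>
    (\<forall>i \<alpha>. betti (degree_ideal P :: ('n, 'k) mpoly set) (degree_ideal Q) i \<alpha> =
      card {b \<in> B i. d i b = \<alpha>})"
proof -
  obtain r d \<phi> and \<epsilon> :: "nat \<Rightarrow> ('n, 'k) mpoly" where
    m: "minimal_free_resolution (degree_ideal P) (degree_ideal Q) r d \<epsilon> \<phi>"
    using assms unfolding has_resolution_def by blast
  show ?thesis
    by (rule exI, rule exI, rule exI, rule exI, rule conjI[OF graded_resolution_of_minimal[OF m]])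
      (simp add: betti_eq[OF m])
qed

end

section \<open>Betti numbers of sums and of quotient rings\<close>

lemma degree_sets_Int:
  assumes "degree_sets P1 {}" "degree_sets P2 {}"
  shows "degree_sets (P1 \<inter> P2) {}"
proof
  show "0 \<le> \<gamma>" if "\<gamma> \<in> P1 \<inter> P2" for \<gamma>
    using degree_sets.P_nonneg[OF assms(1)] that by blast
  show "\<delta> \<in> P1 \<inter> P2" if "\<gamma> \<in> P1 \<inter> P2" "\<gamma> \<le> \<delta>" for \<gamma> \<delta>
    using degree_sets.P_up[OF assms(1) _ that(2)] degree_sets.P_up[OF assms(2) _ that(2)] that(1) by blast
qed simp_all

lemma degree_sets_Un:
  assumes "degree_sets P1 {}" "degree_sets P2 {}"
  shows "degree_sets (P1 \<union> P2) {}"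
proof
  show "0 \<le> \<gamma>" if "\<gamma> \<in> P1 \<union> P2" for \<gamma>
    using degree_sets.P_nonneg[OF assms(1)] degree_sets.P_nonneg[OF assms(2)] that by blast
  show "\<delta> \<in> P1 \<union> P2" if "\<gamma> \<in> P1 \<union> P2" "\<gamma> \<le> \<delta>" for \<gamma> \<delta>
    using degree_sets.P_up[OF assms(1) _ that(2)] degree_sets.P_up[OF assms(2) _ that(2)] that(1) by blast
qed simp_all

theorem betti_union:
  fixes P1 P2 :: "('n \<Rightarrow> int) set"
  defines "J \<equiv> degree_ideal P1 :: ('n, 'k::field) mpoly set" 
    and "K \<equiv> degree_ideal P2 :: ('n, 'k) mpoly set"
    and "L \<equiv> degree_ideal (P1 \<inter> P2) :: ('n, 'k) mpoly set"
    and "I \<equiv> degree_ideal (P1 \<union> P2) :: ('n, 'k) mpoly set"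
  assumes P: "degree_sets P1 {}" "degree_sets P2 {}"
    and res: "has_resolution J {0}" "has_resolution K {0}" "has_resolution L {0}"
    and disj: "\<And>i \<alpha>. betti_ideal L i \<alpha> \<noteq> 0 \<Longrightarrow> betti_ideal J i \<alpha> = 0 \<and> betti_ideal K i \<alpha> = 0"
  shows "has_resolution I {0}"
    and "betti_ideal I i \<alpha> = betti_ideal J i \<alpha> + betti_ideal K i \<alpha> +
      (if i = 0 then 0 else betti_ideal L (i - 1) \<alpha>)"
proof -
  interpret A1: degree_sets P1 "{}" by fact
  interpret A2: degree_sets P2 "{}" by fact
  interpret A3: degree_sets "P1 \<inter> P2" "{}"
    by (rule degree_sets_Int[OF P])
  interpret A4: degree_sets "P1 \<union> P2" "{}"
    by (rule degree_sets_Un[OF P])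
  note defs = J_def K_def L_def I_def degree_ideal_empty[symmetric]
  obtain B1 :: "nat \<Rightarrow> nat set" and d1 and e1 :: "(nat \<Rightarrow> 'k) \<Rightarrow> (unit \<Rightarrow> 'k)" and D1 where
    R1: "graded_resolution B1 d1 e1 D1 P1 {}"
    and b1: "\<And>i \<alpha>. betti_ideal J i \<alpha> = card {b \<in> B1 i. d1 i b = \<alpha>}"
    using A1.graded_resolution_of_has_resolution[OF res(1)[unfolded defs]] unfolding defs by blast
  obtain B2 :: "nat \<Rightarrow> nat set" and d2 and e2 :: "(nat \<Rightarrow> 'k) \<Rightarrow> (unit \<Rightarrow> 'k)" and D2 where
    R2: "graded_resolution B2 d2 e2 D2 P2 {}"
    and b2: "\<And>i \<alpha>. betti_ideal K i \<alpha> = card {b \<in> B2 i. d2 i b = \<alpha>}"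
    using A2.graded_resolution_of_has_resolution[OF res(2)[unfolded defs]] unfolding defs by blast
  obtain B3 :: "nat \<Rightarrow> nat set" and d3 and e3 :: "(nat \<Rightarrow> 'k) \<Rightarrow> (unit \<Rightarrow> 'k)" and D3 where
    R3: "graded_resolution B3 d3 e3 D3 (P1 \<inter> P2) {}"
    and b3: "\<And>i \<alpha>. betti_ideal L i \<alpha> = card {b \<in> B3 i. d3 i b = \<alpha>}"
    using A3.graded_resolution_of_has_resolution[OF res(3)[unfolded defs]] unfolding defs by blast
  interpret R1: graded_resolution B1 d1 e1 D1 P1 "{}" by fact
  interpret R2: graded_resolution B2 d2 e2 D2 P2 "{}" by fact
  interpret R3: graded_resolution B3 d3 e3 D3 "P1 \<inter> P2" "{}" by fact
  obtain f where f: "comparison_map B3 d3 e3 D3 B1 d1 e1 D1 {} f"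
    using comparison_map_exists[OF R3 R1] by blast
  obtain g where g: "comparison_map B3 d3 e3 D3 B2 d2 e2 D2 {} g"
    using comparison_map_exists[OF R3 R2] by blast
  have ne: "betti_ideal L i (d3 i c) \<noteq> 0" if "c \<in> B3 i" for i c
    using that R3.fin[of i] by (auto simp: b3 card_eq_0_iff)
  interpret mapping_cone B1 d1 e1 D1 P1 B2 d2 e2 D2 P2 B3 d3 e3 D3 f g
  proof
    show "d1 i a \<noteq> d3 i c" if "a \<in> B1 i" "c \<in> B3 i" for i a c
      using disj[OF ne[OF that(2)]] that R1.fin[of i] by (auto simp: b1)
    show "d2 i a \<noteq> d3 i c" if "a \<in> B2 i" "c \<in> B3 i" for i a c
      using disj[OF ne[OF that(2)]] that R2.fin[of i] by (auto simp: b2)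
  qed (rule f g)+
  note cone = A4.betti_of_graded_resolution[OF graded_resolution_cone]
  show "has_resolution I {0}" using cone(1) unfolding defs .
  have "betti_ideal I i \<alpha> = card {b \<in> cB i. cd i b = \<alpha>}" using cone(2) unfolding defs .
  then show "betti_ideal I i \<alpha> = betti_ideal J i \<alpha> + betti_ideal K i \<alpha> +
      (if i = 0 then 0 else betti_ideal L (i - 1) \<alpha>)"
    unfolding card_cone b1 b2 b3 .
qed

text \<open>Putting R in front of a minimal resolution of I gives one of R/I; it stays minimal
  because a proper ideal has no generator of degree 0. The pruning condition speaks of R/I and Betti
  splittings of I, and this links the two.\<close>

lemma betti_quotient_eq:
  fixes P :: "('n \<Rightarrow> int) set"
  defines "I \<equiv> degree_ideal P :: ('n, 'k::field) mpoly set"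
  assumes "degree_sets P {}" and res: "has_resolution I {0}" and proper: "0 \<notin> P"
  shows "betti_quotient I i \<alpha> = (if i = 0 then if \<alpha> = 0 then 1 else 0 else betti_ideal I (i - 1) \<alpha>)"
proof -
  interpret A: degree_sets P "{}" by fact
  interpret A': degree_sets "{\<gamma>. 0 \<le> \<gamma>}" P
  proof
    show "\<delta> \<in> {\<gamma>. 0 \<le> \<gamma>}" if "\<gamma> \<in> {\<gamma>. 0 \<le> \<gamma>}" "\<gamma> \<le> \<delta>" for \<gamma> \<delta> :: "'n \<Rightarrow> int"
      using that order_trans[of 0 \<gamma> \<delta>] by simp
    show "\<delta> \<in> P" if "\<gamma> \<in> P" "\<gamma> \<le> \<delta>" for \<gamma> \<delta> by (rule A.P_up[OF that])
  qed (simp_all add: A.P_nonneg)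
  note defs = I_def degree_ideal_empty[symmetric] degree_ideal_nonneg[symmetric]
  obtain B :: "nat \<Rightarrow> nat set" and d and e :: "(nat \<Rightarrow> 'k) \<Rightarrow> (unit \<Rightarrow> 'k)" and D where
    R: "graded_resolution B d e D P {}"
    and b: "\<And>i \<alpha>. betti_ideal I i \<alpha> = card {b \<in> B i. d i b = \<alpha>}"
    using A.graded_resolution_of_has_resolution[OF res[unfolded defs]] unfolding defs by blast
  interpret R: graded_resolution B d e D P "{}" by fact
  define B' :: "nat \<Rightarrow> nat set" where "B' i = (case i of 0 \<Rightarrow> {0} | Suc j \<Rightarrow> B j)" for i
  define d' where "d' i = (case i of 0 \<Rightarrow> (\<lambda>_. 0) | Suc j \<Rightarrow> d j)" for i
  define e' where "e' v = (\<lambda>_::unit. v 0)" for v :: "nat \<Rightarrow> 'k"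
  define D' where "D' i = (case i of 0 \<Rightarrow> (\<lambda>v a. if a = 0 then e v () else 0) | Suc j \<Rightarrow> D j)" for i
  have F0: "v \<in> deg_part (B' 0) (d' 0) \<gamma> \<longleftrightarrow> (\<forall>a. a \<noteq> 0 \<longrightarrow> v a = 0) \<and> (v 0 \<noteq> 0 \<longrightarrow> 0 \<le> \<gamma>)"
    for v :: "nat \<Rightarrow> 'k" and \<gamma>
    by (auto simp: deg_part_def B'_def d'_def) (metis neq0_conv)
  have FS: "deg_part (B' (Suc i)) (d' (Suc i)) \<gamma> = R.F i \<gamma>" for i \<gamma>
    by (simp add: B'_def d'_def)
  have D'0: "D' 0 v = 0 \<longleftrightarrow> e v = 0" for v
    by (auto simp: D'_def fun_eq_iff)
  have "graded_resolution B' d' e' D' {\<gamma>. 0 \<le> \<gamma>} P"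
  proof
    show "finite (B' i)" for i by (auto simp: B'_def R.fin split: nat.split)
    show "lin e'" by (rule linI) (auto simp: e'_def)
    show "lin (D' i)" for i
      by (cases i) (auto intro!: linI simp: D'_def R.lin_D lin_add[OF R.lin_e] lin_scale[OF R.lin_e])
    show "\<gamma> \<in> {\<gamma>. 0 \<le> \<gamma>}" if "v \<in> deg_part (B' 0) (d' 0) \<gamma>" "e' v \<noteq> 0" for v \<gamma>
      using that by (auto simp: F0 e'_def)
    show "\<exists>v\<in>deg_part (B' 0) (d' 0) \<gamma>. e' v = 1" if "\<gamma> \<in> {\<gamma>. 0 \<le> \<gamma>}" for \<gamma>
      using that by (intro bexI[of _ "basis 0"]) (auto simp: F0 e'_def basis_def)
    show "D' i (basis b) a = 0"
      if "b \<in> B' (Suc i)" "a \<in> B' i" "d' i a = d' (Suc i) b" for b i a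
    proof (cases i)
      case 0
      then have bb: "b \<in> B 0" "d 0 b = 0" using that by (auto simp: B'_def d'_def)
      have "e (basis b) = 0"
        using R.e_degree[OF basis_deg_part[OF bb(1) order_refl]] bb(2) proper by auto
      then have "D' 0 (basis b) = 0" unfolding D'0 .
      then show ?thesis using 0 by simp
    next
      case (Suc j)
      then show ?thesis using that R.minimal by (simp add: B'_def d'_def D'_def)
    qed
    show "D' i ` deg_part (B' (Suc i)) (d' (Suc i)) \<gamma> = cycles B' d' e' D' P i \<gamma>" for i \<gamma>
    proof (cases i)
      case 0
      have "x \<in> D' 0 ` R.F 0 \<gamma> \<longleftrightarrow> x \<in> deg_part (B' 0) (d' 0) \<gamma> \<and> (\<gamma> \<in> P \<or> e' x = 0)" for x
      proof
        assume "x \<in> D' 0 ` R.F 0 \<gamma>"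
        then obtain v where v: "v \<in> R.F 0 \<gamma>" "x = D' 0 v" by blast
        have "e v () \<noteq> 0 \<Longrightarrow> \<gamma> \<in> P" using R.e_degree[OF v(1)] by (metis zero_fun_apply)
        then show "x \<in> deg_part (B' 0) (d' 0) \<gamma> \<and> (\<gamma> \<in> P \<or> e' x = 0)"
          using v(2) A.P_nonneg by (auto simp: F0 D'_def e'_def fun_eq_iff)
      next
        assume x: "x \<in> deg_part (B' 0) (d' 0) \<gamma> \<and> (\<gamma> \<in> P \<or> e' x = 0)"
        show "x \<in> D' 0 ` R.F 0 \<gamma>"
        proof (cases "x 0 = 0")
          case True
          then have "x = D' 0 0"
            using x by (auto simp: F0 D'_def fun_eq_iff lin_zero[OF R.lin_e])
          then show ?thesis using deg_part_zero by blast
        next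
          case False
          then have "\<gamma> \<in> P" using x by (auto simp: e'_def fun_eq_iff)
          then obtain v where v: "v \<in> R.F 0 \<gamma>" "e v = 1" using R.e_onto by blast
          have "x = D' 0 (\<lambda>a. x 0 * v a)"
            using x v(2) by (auto simp: F0 D'_def fun_eq_iff lin_scale[OF R.lin_e])
          then show ?thesis using deg_part_scale[OF v(1)] by blast
        qed
      qed
      then show ?thesis using 0 FS by (auto simp: cycles_def)
    next
      case (Suc j)
      have "cycles B' d' e' D' P (Suc j) \<gamma> = R.Z j \<gamma>"
      proof (cases j)
        case 0
        then show ?thesis using FS D'0 by (auto simp: cycles_def)
      next
        case (Suc k)
        then show ?thesis using FS by (auto simp: cycles_def D'_def)
      qed
      then show ?thesis using Suc FS R.exact by (simp add: D'_def)
    qed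
  qed
  then have "betti_quotient I i \<alpha> = card {b \<in> B' i. d' i b = \<alpha>}"
    using A'.betti_of_graded_resolution(2) unfolding defs by blast
  also have "\<dots> = (if i = 0 then if \<alpha> = 0 then 1 else 0 else betti_ideal I (i - 1) \<alpha>)"
    unfolding b by (cases i) (auto simp: B'_def d'_def)
  finally show ?thesis .
qed

text \<open>The cases of the zero ideal (\<open>\<not> c\<close>) and of a principal monomial ideal.\<close>

lemma principal_resolution:
  fixes c :: bool and \<mu> :: "'n \<Rightarrow> int"
  defines "I \<equiv> degree_ideal {\<gamma>. c \<and> \<mu> \<le> \<gamma>} :: ('n, 'k::field) mpoly set"
  assumes \<mu>: "0 \<le> \<mu>"
  shows "has_resolution I {0}" and "betti_ideal I i \<alpha> = (if c \<and> i = 0 \<and> \<alpha> = \<mu> then 1 else 0)"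
proof -
  let ?P = "{\<gamma>. c \<and> \<mu> \<le> \<gamma>}"
  interpret A: degree_sets ?P "{}"
  proof
    show "0 \<le> \<gamma>" if "\<gamma> \<in> ?P" for \<gamma> using that order_trans[OF \<mu>, of \<gamma>] by simp
    show "\<delta> \<in> ?P" if "\<gamma> \<in> ?P" "\<gamma> \<le> \<delta>" for \<gamma> \<delta> using that order_trans[of \<mu> \<gamma> \<delta>] by simp
  qed simp_all
  define B where "B i = (if c \<and> i = 0 then {()} else {})" for i :: nat
  let ?d = "\<lambda>(i::nat) (x::unit). \<mu>" and ?e = "\<lambda>v :: unit \<Rightarrow> 'k. v"
  let ?D = "\<lambda>(i::nat) (v :: unit \<Rightarrow> 'k). (0 :: unit \<Rightarrow> 'k)"
  have F: "v \<in> deg_part (B i) (?d i) \<gamma> \<longleftrightarrow> v = 0 \<or> c \<and> i = 0 \<and> \<mu> \<le> \<gamma>" for v :: "unit \<Rightarrow> 'k" and i \<gamma>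
    by (auto simp: deg_part_def B_def fun_eq_iff)
  have "graded_resolution B ?d ?e ?D ?P {}"
  proof
    show "finite (B i)" for i by (simp add: B_def)
    show "lin ?e" "lin (?D i)" for i by (auto intro!: linI simp: fun_eq_iff)
    show "\<gamma> \<in> ?P" if "v \<in> deg_part (B 0) (?d 0) \<gamma>" "?e v \<noteq> 0" for v \<gamma>
      using that by (simp add: F)
    show "\<exists>v\<in>deg_part (B 0) (?d 0) \<gamma>. ?e v = 1" if "\<gamma> \<in> ?P" for \<gamma>
      using that by (simp add: F)
    show "?D i ` deg_part (B (Suc i)) (?d (Suc i)) \<gamma> = cycles B ?d ?e ?D {} i \<gamma>" for i \<gamma>
      by (cases i) (auto simp: cycles_def F image_iff)
  qed simp
  note r = A.betti_of_graded_resolution[OF this]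
  show "has_resolution I {0}" using r(1) unfolding I_def degree_ideal_empty .
  show "betti_ideal I i \<alpha> = (if c \<and> i = 0 \<and> \<alpha> = \<mu> then 1 else 0)"
    using r(2)[of i \<alpha>] unfolding I_def degree_ideal_empty by (auto simp: B_def)
qed

section \<open>Squarefree monomial ideals\<close>

text \<open>
  A squarefree monomial ideal is given by the upward closed family \<open>P\<close> of the supports of its
  monomials; sums and intersections of ideals are unions and intersections of families.
\<close>

definition up_closed :: "'n set set \<Rightarrow> bool" where
  "up_closed P \<longleftrightarrow> (\<forall>U\<in>P. \<forall>W. U \<subseteq> W \<longrightarrow> W \<in> P)"

definition degrees :: "'n set set \<Rightarrow> ('n \<Rightarrow> int) set" where
  "degrees P = {\<gamma>. 0 \<le> \<gamma> \<and> {v. \<gamma> v \<noteq> 0} \<in> P}"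

definition ideal_of :: "'n set set \<Rightarrow> ('n, 'k::field) mpoly set" where
  "ideal_of P = degree_ideal (degrees P)"

definition indicat :: "'n set \<Rightarrow> 'n \<Rightarrow> nat" where
  "indicat U = (\<lambda>v. if v \<in> U then 1 else 0)"

definition minimal_sets :: "'n set set \<Rightarrow> 'n set set" where
  "minimal_sets P = {U \<in> P. \<forall>W\<in>P. W \<subseteq> U \<longrightarrow> W = U}"

lemma indicat_inj: "indicat U = indicat W \<Longrightarrow> U = W"
  by (auto simp: indicat_def fun_eq_iff split: if_splits)

lemma mdeg_indicat_le: "mdeg (indicat U) \<le> \<gamma> \<longleftrightarrow> 0 \<le> \<gamma> \<and> U \<subseteq> {v. \<gamma> v \<noteq> 0}"
proof
  assume le: "mdeg (indicat U) \<le> \<gamma>"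
  have "0 \<le> \<gamma>" by (rule order_trans[OF mdeg_nonneg le])
  moreover have "\<gamma> v \<noteq> 0" if "v \<in> U" for v
    using le_funD[OF le, of v] that by (simp add: mdeg_def indicat_def)
  ultimately show "0 \<le> \<gamma> \<and> U \<subseteq> {v. \<gamma> v \<noteq> 0}" by blast
next
  assume r: "0 \<le> \<gamma> \<and> U \<subseteq> {v. \<gamma> v \<noteq> 0}"
  then have nn: "0 \<le> \<gamma> v" for v by (simp add: le_fun_def)
  have "1 \<le> \<gamma> v" if "v \<in> U" for v
  proof -
    have "\<gamma> v \<noteq> 0" using r that by blast
    then show ?thesis using nn[of v] by linarith
  qed
  then show "mdeg (indicat U) \<le> \<gamma>" using nn by (simp add: le_fun_def mdeg_def indicat_def)
qed

lemma degrees_Un: "degrees (P \<union> Q) = degrees P \<union> degrees Q"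
  by (auto simp: degrees_def)

lemma degrees_Int: "degrees (P \<inter> Q) = degrees P \<inter> degrees Q"
  by (auto simp: degrees_def)

lemma degrees_principal: "degrees {W. c \<and> U \<subseteq> W} = {\<gamma>. c \<and> mdeg (indicat U) \<le> \<gamma>}"
  by (auto simp: degrees_def mdeg_indicat_le)

lemma degree_sets_degrees:
  assumes "up_closed P"
  shows "degree_sets (degrees P) {}"
proof
  show "0 \<le> \<gamma>" if "\<gamma> \<in> degrees P" for \<gamma> using that by (simp add: degrees_def)
  show "\<delta> \<in> degrees P" if "\<gamma> \<in> degrees P" and le: "\<gamma> \<le> \<delta>" for \<gamma> \<delta>
  proof -
    have "0 \<le> \<gamma>" and supp: "{v. \<gamma> v \<noteq> 0} \<in> P" using that(1) by (simp_all add: degrees_def)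
    have "{v. \<gamma> v \<noteq> 0} \<subseteq> {v. \<delta> v \<noteq> 0}"
    proof
      fix v assume "v \<in> {v. \<gamma> v \<noteq> 0}"
      then show "v \<in> {v. \<delta> v \<noteq> 0}"
        using le_funD[OF \<open>0 \<le> \<gamma>\<close>, of v] le_funD[OF le, of v] by simp
    qed
    then have "{v. \<delta> v \<noteq> 0} \<in> P" using assms supp unfolding up_closed_def by blast
    then show ?thesis using order_trans[OF \<open>0 \<le> \<gamma>\<close> le] by (simp add: degrees_def)
  qed
qed simp_all

lemma degree_ideal_sum:
  "{f + g |f g. f \<in> degree_ideal P \<and> g \<in> degree_ideal Q} = (degree_ideal (P \<union> Q) :: ('n, 'k::field) mpoly set)"
proof (intro set_eqI iffI)
  fix p :: "('n, 'k) mpoly"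
  assume "p \<in> {f + g |f g. f \<in> degree_ideal P \<and> g \<in> degree_ideal Q}"
  then obtain f g where fg: "p = f + g" "f \<in> degree_ideal P" "g \<in> degree_ideal Q" by blast
  show "p \<in> degree_ideal (P \<union> Q)"
    unfolding degree_ideal_def
  proof (intro CollectI allI impI)
    fix \<gamma> assume "coeff_at p \<gamma> \<noteq> 0"
    then have "coeff_at f \<gamma> \<noteq> 0 \<or> coeff_at g \<gamma> \<noteq> 0" by (auto simp: fg(1) coeff_at_add)
    then show "\<gamma> \<in> P \<union> Q" using fg(2,3) by (auto simp: degree_ideal_def)
  qed
next
  fix p :: "('n, 'k) mpoly" assume p: "p \<in> degree_ideal (P \<union> Q)"
  define f where "f = (\<Sum>\<gamma>\<in>{\<gamma>. coeff_at p \<gamma> \<noteq> 0} \<inter> P. monom_at \<gamma> (coeff_at p \<gamma>))"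
  have f: "coeff_at f \<gamma> = (if \<gamma> \<in> P then coeff_at p \<gamma> else 0)" for \<gamma>
  proof -
    have "coeff_at f \<gamma> = (\<Sum>\<eta>\<in>{\<gamma>. coeff_at p \<gamma> \<noteq> 0} \<inter> P. if \<gamma> = \<eta> then coeff_at p \<gamma> else 0)"
      unfolding f_def coeff_at_sum
      by (rule sum.cong) (auto simp: coeff_at_monom_at dest: coeff_at_nonneg)
    then show ?thesis using finite_coeff_at[of p] by auto
  qed
  then have "f \<in> degree_ideal P" by (auto simp: degree_ideal_def)
  moreover have "p - f \<in> degree_ideal Q"
    using p by (auto simp: degree_ideal_def coeff_at_diff f)
  moreover have "p = f + (p - f)" by simp
  ultimately show "p \<in> {f + g |f g. f \<in> degree_ideal P \<and> g \<in> degree_ideal Q}" by blast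
qed

lemma ideal_of_Un: "ideal_of (P \<union> Q) = {f + g |f g. f \<in> ideal_of P \<and> g \<in> ideal_of Q}"
  by (simp add: ideal_of_def degrees_Un degree_ideal_sum)

lemma ideal_of_Int: "ideal_of (P \<inter> Q) = ideal_of P \<inter> ideal_of Q"
  by (auto simp: ideal_of_def degrees_Int degree_ideal_def)

lemma upset_gen_indicat: "up_closed P \<Longrightarrow> upset_gen (indicat ` P) = degrees P"
  by (auto simp: upset_gen_def degrees_def mdeg_indicat_le up_closed_def)

lemma ideal_of_eq_ideal_gen: "up_closed P \<Longrightarrow> ideal_of P = ideal_gen (monom ` indicat ` P)"
  by (simp add: ideal_of_def ideal_gen_monom upset_gen_indicat)

lemma monom_in_ideal_of: "monom m \<in> ideal_of P \<longleftrightarrow> {v. m v \<noteq> 0} \<in> P"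
proof -
  have "monom m \<in> ideal_of P \<longleftrightarrow> mdeg m \<in> degrees P"
    by (auto simp: ideal_of_def degree_ideal_def coeff_at_nonzero monom_def)
  then show ?thesis by (simp add: degrees_def mdeg_nonneg) (simp add: mdeg_def)
qed

text \<open>Minimal generators are squarefree: the indicator of the support of a monomial of the
  ideal also lies in the ideal and divides that monomial.\<close>

lemma min_gens_ideal_of: "min_gens (ideal_of P :: ('n, 'k::field) mpoly set) = indicat ` minimal_sets P"
proof (intro set_eqI iffI)
  have supp: "{v. indicat W v \<noteq> 0} = W" for W :: "'n set" by (auto simp: indicat_def)
  fix m
  assume "m \<in> min_gens (ideal_of P :: ('n, 'k) mpoly set)"
  then have m: "{v. m v \<noteq> 0} \<in> P" "\<And>m'. {v. m' v \<noteq> 0} \<in> P \<Longrightarrow> m' \<le> m \<Longrightarrow> m' = m"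
    by (auto simp: min_gens_def monom_in_ideal_of)
  have le: "indicat W \<le> m" if "W \<subseteq> {v. m v \<noteq> 0}" for W
    using that by (auto simp: indicat_def le_fun_def)
  have eq: "indicat W = m" if "W \<in> P" "W \<subseteq> {v. m v \<noteq> 0}" for W
    by (rule m(2)) (simp_all only: supp that le)
  have "indicat {v. m v \<noteq> 0} = m" using eq m(1) by blast
  moreover have "{v. m v \<noteq> 0} \<in> minimal_sets P"
    unfolding minimal_sets_def using m(1) eq supp by blast
  ultimately show "m \<in> indicat ` minimal_sets P" by (metis imageI)
next
  have supp: "{v. indicat W v \<noteq> 0} = W" for W :: "'n set" by (auto simp: indicat_def)
  fix m assume "m \<in> indicat ` minimal_sets P"
  then obtain U where U: "m = indicat U" "U \<in> P" "\<And>W. W \<in> P \<Longrightarrow> W \<subseteq> U \<Longrightarrow> W = U"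
    by (auto simp: minimal_sets_def)
  have "m' = m" if m': "{v. m' v \<noteq> 0} \<in> P" "m' \<le> m" for m'
  proof
    fix v
    have "{v. m' v \<noteq> 0} \<subseteq> U"
    proof
      fix w assume "w \<in> {v. m' v \<noteq> 0}"
      then show "w \<in> U" using le_funD[OF m'(2), of w] by (auto simp: U(1) indicat_def split: if_splits)
    qed
    then have "{v. m' v \<noteq> 0} = U" using U(3) m'(1) by blast
    then show "m' v = m v" using le_funD[OF m'(2), of v] by (auto simp: U(1) indicat_def)
  qed
  then show "m \<in> min_gens (ideal_of P :: ('n, 'k) mpoly set)"
    using U(1,2) supp by (auto simp: min_gens_def monom_in_ideal_of)
qed

lemma minimal_sets_principal: "minimal_sets {W. U \<subseteq> W} = {U}"
  unfolding minimal_sets_def by blast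

lemma minimal_set_below:
  fixes P :: "'n::finite set set"
  assumes "U \<in> P"
  obtains W where "W \<in> minimal_sets P" "W \<subseteq> U"
  using finite_has_minimal2[OF finite[of P] assms] unfolding minimal_sets_def by blast

section \<open>Iterated splittings with disjoint degrees\<close>

text \<open>
  Here \<open>A\<close> contains the pairs of a homological degree and a multidegree (as a vertex set) at which
  the ideal of the family may have a non-zero Betti number. The last premise of \<open>split\<close> forces the
  lifts in the mapping cone to be minimal.
\<close>

inductive splits :: "'n set set \<Rightarrow> (nat \<times> 'n set) set \<Rightarrow> bool" where
  zero: "splits {} {}"
| principal: "U \<noteq> {} \<Longrightarrow> splits {W. U \<subseteq> W} {(0, U)}"
| split: "splits P A \<Longrightarrow> splits Q B \<Longrightarrow> splits (P \<inter> Q) C \<Longrightarrow> C \<inter> (A \<union> B) = {} \<Longrightarrow>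
    splits (P \<union> Q) (A \<union> B \<union> (\<lambda>(i, U). (Suc i, U)) ` C)"

lemma up_closed_Un: "up_closed P \<Longrightarrow> up_closed Q \<Longrightarrow> up_closed (P \<union> Q)"
  unfolding up_closed_def by (meson UnE UnI1 UnI2)

lemma up_closed_principal: "up_closed {W. U \<subseteq> W}"
  unfolding up_closed_def by (simp add: subset_trans)

lemma splits_up_closed: "splits P A \<Longrightarrow> up_closed P"
proof (induction rule: splits.induct)
  case zero
  show ?case by (simp add: up_closed_def)
qed (simp_all add: up_closed_Un up_closed_principal)

lemma splits_proper: "splits P A \<Longrightarrow> {} \<notin> P"
  by (induction rule: splits.induct) auto

text \<open>Labels of an intersection therefore lie in both families; disjointness of labels is
  later deduced from this.\<close>

lemma splits_label: "splits P A \<Longrightarrow> (i, U) \<in> A \<Longrightarrow> U \<in> P"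
  by (induction arbitrary: i rule: splits.induct) auto

text \<open>A minimal set of \<open>P\<close> lying in \<open>Q\<close> would be minimal in
  \<open>P \<inter> Q\<close>, against the hypothesis. So no generator of one ideal becomes
  redundant in the sum.\<close>

lemma minimal_sets_Un:
  fixes P Q :: "'n::finite set set"
  assumes up: "up_closed P" "up_closed Q"
    and disj: "minimal_sets (P \<inter> Q) \<inter> (minimal_sets P \<union> minimal_sets Q) = {}"
  shows "minimal_sets (P \<union> Q) = minimal_sets P \<union> minimal_sets Q"
    and "minimal_sets P \<inter> minimal_sets Q = {}"
proof -
  have P: "U \<notin> Q" if U: "U \<in> minimal_sets P" for U
  proof
    assume "U \<in> Q"
    then have "U \<in> P \<inter> Q" using U by (auto simp: minimal_sets_def)
    then obtain W where W: "W \<in> minimal_sets (P \<inter> Q)" "W \<subseteq> U" by (rule minimal_set_below)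
    then have "W = U" using U by (auto simp: minimal_sets_def)
    then show False using W U disj by blast
  qed
  have Q: "U \<notin> P" if U: "U \<in> minimal_sets Q" for U
  proof
    assume "U \<in> P"
    then have "U \<in> P \<inter> Q" using U by (auto simp: minimal_sets_def)
    then obtain W where W: "W \<in> minimal_sets (P \<inter> Q)" "W \<subseteq> U" by (rule minimal_set_below)
    then have "W = U" using U by (auto simp: minimal_sets_def)
    then show False using W U disj by blast
  qed
  show "minimal_sets P \<inter> minimal_sets Q = {}" using P by (auto simp: minimal_sets_def)
  have "U \<in> minimal_sets (P \<union> Q)" if U: "U \<in> minimal_sets P" for U
    using U P[OF U] up(2) unfolding minimal_sets_def up_closed_def by blast
  moreover have "U \<in> minimal_sets (P \<union> Q)" if U: "U \<in> minimal_sets Q" for U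
    using U Q[OF U] up(1) unfolding minimal_sets_def up_closed_def by blast
  moreover have "minimal_sets (P \<union> Q) \<subseteq> minimal_sets P \<union> minimal_sets Q"
    by (auto simp: minimal_sets_def)
  ultimately show "minimal_sets (P \<union> Q) = minimal_sets P \<union> minimal_sets Q" by blast
qed

text \<open>Exactness of the labels at index 0 turns the disjointness premise of
  \<open>split\<close> into the disjointness of generators that \<open>minimal_sets_Un\<close>
  requires.\<close>

lemma splits_minimal_sets:
  fixes P :: "'n::finite set set"
  assumes "splits P A"
  shows "(0, U) \<in> A \<longleftrightarrow> U \<in> minimal_sets P"
  using assms
proof (induction arbitrary: U rule: splits.induct)
  case (split P A Q B C)
  have "minimal_sets (P \<inter> Q) \<inter> (minimal_sets P \<union> minimal_sets Q) = {}"
  proof (rule equals0I)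
    fix U assume "U \<in> minimal_sets (P \<inter> Q) \<inter> (minimal_sets P \<union> minimal_sets Q)"
    then have "(0, U) \<in> C \<inter> (A \<union> B)" using split.IH by simp
    then show False using split.hyps by simp
  qed
  note m = minimal_sets_Un(1)[OF splits_up_closed[OF split.hyps(1)] splits_up_closed[OF split.hyps(2)] this]
  show ?case unfolding m using split.IH(1)[of U] split.IH(2)[of U] by auto
qed (auto simp: minimal_sets_principal, simp add: minimal_sets_def)

text \<open>Multiplication by a new variable \<open>x\<close>: every ideal of the iterated splitting
  is multiplied by it. Inserting \<open>x\<close> is injective on labels that avoid
  \<open>x\<close>, so disjointness survives.\<close>

lemma splits_mult:
  assumes "splits P A" "\<And>i U. (i, U) \<in> A \<Longrightarrow> x \<notin> U"
  shows "splits {W \<in> P. x \<in> W} ((\<lambda>(i, U). (i, insert x U)) ` A)"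
  using assms
proof (induction rule: splits.induct)
  case zero
  then show ?case using splits.zero by simp
next
  case (principal U)
  have "{W \<in> {W. U \<subseteq> W}. x \<in> W} = {W. insert x U \<subseteq> W}" by auto
  then show ?case using splits.principal[of "insert x U"] by simp
next
  case (split P A Q B C)
  let ?h = "\<lambda>(i::nat, U). (i, insert x U)"
  \<comment> \<open>The labels in \<open>C\<close> avoid \<open>x\<close> as well, because they
    reappear, shifted by one, among the labels of the union.\<close>
  have x: "x \<notin> U" if "(i, U) \<in> A \<union> B \<union> C" for i U
  proof -
    have "(Suc i, U) \<in> (\<lambda>(i, U). (Suc i, U)) ` C" if "(i, U) \<in> C" using that by force
    then show ?thesis using that split.prems[of i U] split.prems[of "Suc i" U] by blast
  qed
  have 3: "splits ({W \<in> P. x \<in> W} \<inter> {W \<in> Q. x \<in> W}) (?h ` C)"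
  proof -
    have "{W \<in> P \<inter> Q. x \<in> W} = {W \<in> P. x \<in> W} \<inter> {W \<in> Q. x \<in> W}" by auto
    then show ?thesis using split.IH(3) x by force
  qed
  have 12: "splits {W \<in> P. x \<in> W} (?h ` A)" "splits {W \<in> Q. x \<in> W} (?h ` B)"
    using split.IH(1,2) x by force+
  have "?h ` C \<inter> (?h ` A \<union> ?h ` B) = {}"
  proof (rule equals0I)
    fix y assume "y \<in> ?h ` C \<inter> (?h ` A \<union> ?h ` B)"
    then obtain i U j W where "(i, U) \<in> C" "(j, W) \<in> A \<union> B" "i = j" "insert x U = insert x W"
      by auto
    moreover from this have "U = W" using x[of i U] x[of j W] by auto
    ultimately show False using split.hyps(4) by blast
  qed
  then have "splits ({W \<in> P. x \<in> W} \<union> {W \<in> Q. x \<in> W})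
      (?h ` A \<union> ?h ` B \<union> (\<lambda>(i, U). (Suc i, U)) ` ?h ` C)"
    by (rule splits.split[OF 12 3])
  moreover have "{W \<in> P \<union> Q. x \<in> W} = {W \<in> P. x \<in> W} \<union> {W \<in> Q. x \<in> W}" by auto
  moreover have "?h ` (A \<union> B \<union> (\<lambda>(i, U). (Suc i, U)) ` C) =
      ?h ` A \<union> ?h ` B \<union> (\<lambda>(i, U). (Suc i, U)) ` ?h ` C"
    by (simp add: image_Un image_image case_prod_unfold)
  ultimately show ?case by simp
qed

section \<open>Pruned resolutions of the zero ideal and of principal ideals\<close>

lemma critical_faces_Nil: "critical_faces [] = {{}}"
  by (simp add: critical_faces_def pruned_edges_def)

lemma face_lcm_empty: "face_lcm ms {} = 0"
  by (simp add: face_lcm_def fun_eq_iff)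

lemma face_lcm_single: "face_lcm [m] {0} = m"
  by (simp add: face_lcm_def fun_eq_iff)

text \<open>A generator other than 1 changes the lcm of the empty face, so no edge is
  selected.\<close>

lemma critical_faces_single:
  assumes "m \<noteq> 0"
  shows "critical_faces [m] = {{}, {0}}"
proof -
  have "face_lcm [m] \<sigma> \<noteq> face_lcm [m] (insert 0 \<sigma>)" if "\<sigma> \<subseteq> {..<length [m]}" "0 \<notin> \<sigma>" for \<sigma>
  proof -
    have "\<sigma> = {}" using that by auto
    then show ?thesis using assms by (simp add: face_lcm_empty face_lcm_single)
  qed
  then have "pruned_edges [m] = {}" unfolding pruned_edges_def prune_step_def by auto
  moreover have "{\<sigma>. \<sigma> \<subseteq> {0::nat}} = {{}, {0}}" by auto
  ultimately show ?thesis by (simp add: critical_faces_def lessThan_Suc)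
qed

lemma mdeg_zero: "mdeg 0 = 0"
  by (simp add: mdeg_def fun_eq_iff)

lemma admits_zero: "admits_minimal_pruned_resolution (ideal_of {} :: ('n, 'k::field) mpoly set)"
proof (rule admits_minimal_pruned_resolution.pruned)
  let ?I = "ideal_of {} :: ('n, 'k) mpoly set"
  have up: "up_closed {}" by (simp add: up_closed_def)
  show "monomial_ideal ?I" unfolding monomial_ideal_def using ideal_of_eq_ideal_gen[OF up] by blast
  have eq: "?I = degree_ideal {\<gamma>. False \<and> 0 \<le> \<gamma>}" by (simp add: ideal_of_def degrees_def)
  have res: "has_resolution ?I {0}" "betti_ideal ?I i \<alpha> = 0" for i \<alpha>
    using principal_resolution(1)[of 0 False, where 'k = 'k]
      principal_resolution(2)[of 0 False i \<alpha>, where 'k = 'k] unfolding eq by auto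
  have "betti_quotient ?I i \<alpha> = (if i = 0 \<and> \<alpha> = 0 then 1 else 0)" for i \<alpha>
    using betti_quotient_eq[OF degree_sets_degrees[OF up], folded ideal_of_def, OF res(1), of i \<alpha>]
    by (simp add: res(2) degrees_def)
  moreover have "{\<sigma> \<in> {{}}. card \<sigma> = i \<and> mdeg (face_lcm ([] :: ('n \<Rightarrow> nat) list) \<sigma>) = \<alpha>} =
      (if i = 0 \<and> \<alpha> = 0 then {{}} else {})" for i \<alpha>
    by (auto simp: face_lcm_empty mdeg_zero)
  ultimately show "minimal_pruned_order ?I []"
    by (simp add: minimal_pruned_order_def critical_faces_Nil min_gens_ideal_of minimal_sets_def)
qed

lemma admits_principal:
  assumes "U \<noteq> {}"
  shows "admits_minimal_pruned_resolution (ideal_of {W. U \<subseteq> W} :: ('n, 'k::field) mpoly set)"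
proof (rule admits_minimal_pruned_resolution.pruned)
  let ?I = "ideal_of {W. U \<subseteq> W} :: ('n, 'k) mpoly set" and ?m = "indicat U"
  note up = up_closed_principal[of U]
  show "monomial_ideal ?I" unfolding monomial_ideal_def using ideal_of_eq_ideal_gen[OF up] by blast
  have eq: "?I = degree_ideal {\<gamma>. True \<and> mdeg ?m \<le> \<gamma>}"
    using degrees_principal[of True U] by (simp add: ideal_of_def)
  have res: "has_resolution ?I {0}" "betti_ideal ?I i \<alpha> = (if i = 0 \<and> \<alpha> = mdeg ?m then 1 else 0)" for i \<alpha>
    using principal_resolution(1)[of "mdeg ?m" True, OF mdeg_nonneg, where 'k = 'k]
      principal_resolution(2)[of "mdeg ?m" True i \<alpha>, OF mdeg_nonneg, where 'k = 'k] unfolding eq by auto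
  have quot: "betti_quotient ?I i \<alpha> = (if i = 0 then if \<alpha> = 0 then 1 else 0
      else if i = 1 \<and> \<alpha> = mdeg ?m then 1 else 0)" for i \<alpha>
    using betti_quotient_eq[OF degree_sets_degrees[OF up], folded ideal_of_def, OF res(1), of i \<alpha>] assms
    by (auto simp: res(2) degrees_def)
  have m: "?m \<noteq> 0" using assms by (auto simp: indicat_def fun_eq_iff)
  have "{\<sigma> \<in> {{}, {0}}. card \<sigma> = i \<and> mdeg (face_lcm [?m] \<sigma>) = \<alpha>} =
      (if i = 0 then if \<alpha> = 0 then {{}} else {} else if i = 1 \<and> \<alpha> = mdeg ?m then {{0}} else {})" for i \<alpha>
    by (auto simp: face_lcm_empty face_lcm_single mdeg_zero)
  then have "card {\<sigma> \<in> {{}, {0}}. card \<sigma> = i \<and> mdeg (face_lcm [?m] \<sigma>) = \<alpha>} = betti_quotient ?I i \<alpha>" for i \<alpha>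
    by (simp add: quot)
  then show "minimal_pruned_order ?I [?m]"
    by (simp add: minimal_pruned_order_def critical_faces_single[OF m] min_gens_ideal_of
        minimal_sets_principal)
qed

text \<open>The last conjunct bounds the nonzero Betti numbers by the labels. It converts disjoint
  labels into the hypothesis of \<open>betti_union\<close>; an inclusion is enough for that.\<close>

theorem splits_admits:
  fixes P :: "'n::finite set set"
  defines "ideal \<equiv> (ideal_of :: 'n set set \<Rightarrow> ('n, 'k::field) mpoly set)"
  assumes "splits P A"
  shows "has_resolution (ideal P) {0} \<and> admits_minimal_pruned_resolution (ideal P) \<and>
    (\<forall>i \<alpha>. betti_ideal (ideal P) i \<alpha> \<noteq> 0 \<longrightarrow> (\<exists>U. (i, U) \<in> A \<and> \<alpha> = mdeg (indicat U)))"
  using assms(2)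
proof (induction rule: splits.induct)
  case zero
  have eq: "ideal {} = degree_ideal {\<gamma>. False \<and> 0 \<le> \<gamma>}" by (simp add: ideal_def ideal_of_def degrees_def)
  note r = principal_resolution[of "0 :: 'n \<Rightarrow> int" False, OF order_refl, where 'k = 'k, folded eq]
  have "admits_minimal_pruned_resolution (ideal {})" unfolding ideal_def by (rule admits_zero)
  then show ?case using r by simp
next
  case (principal U)
  have eq: "ideal {W. U \<subseteq> W} = degree_ideal {\<gamma>. True \<and> mdeg (indicat U) \<le> \<gamma>}"
    using degrees_principal[of True U] by (simp add: ideal_def ideal_of_def)
  note r = principal_resolution[of "mdeg (indicat U)" True, OF mdeg_nonneg, where 'k = 'k, folded eq]
  have "admits_minimal_pruned_resolution (ideal {W. U \<subseteq> W})"
    unfolding ideal_def by (rule admits_principal[OF principal])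
  then show ?case using r by simp
next
  case (split P A Q B C)
  let ?J = "ideal P" and ?K = "ideal Q" and ?L = "ideal (P \<inter> Q)" and ?I = "ideal (P \<union> Q)"
  note up = splits_up_closed[OF split.hyps(1)] splits_up_closed[OF split.hyps(2)]
  have up': "up_closed (P \<union> Q)" by (rule up_closed_Un[OF up])
  have L: "?L = ?J \<inter> ?K" by (simp add: ideal_def ideal_of_Int)
  have disj: "betti_ideal ?J i \<alpha> = 0 \<and> betti_ideal ?K i \<alpha> = 0" if nz: "betti_ideal ?L i \<alpha> \<noteq> 0" for i \<alpha>
  proof -
    obtain U where U: "(i, U) \<in> C" "\<alpha> = mdeg (indicat U)" using split.IH(3) nz by blast
    have inj: "W = U" if "\<alpha> = mdeg (indicat W)" for W :: "'n set"
      using that U(2) by (intro indicat_inj) (auto simp: mdeg_def fun_eq_iff)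
    have "betti_ideal ?J i \<alpha> \<noteq> 0 \<Longrightarrow> (i, U) \<in> A" using split.IH(1) inj by blast
    moreover have "betti_ideal ?K i \<alpha> \<noteq> 0 \<Longrightarrow> (i, U) \<in> B" using split.IH(2) inj by blast
    ultimately show ?thesis using U(1) split.hyps(4) by blast
  qed
  have un: "has_resolution ?I {0}" "betti_ideal ?I i \<alpha> = betti_ideal ?J i \<alpha> + betti_ideal ?K i \<alpha> +
      (if i = 0 then 0 else betti_ideal ?L (i - 1) \<alpha>)" for i \<alpha>
    by (rule betti_union[OF degree_sets_degrees[OF up(1)] degree_sets_degrees[OF up(2)],
        where 'k = 'k, folded degrees_Un degrees_Int, folded ideal_of_def, folded ideal_def];
      use split.IH disj in blast)+
  have mono: "monomial_ideal (ideal R)" if "up_closed R" for R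
    unfolding monomial_ideal_def ideal_def using ideal_of_eq_ideal_gen[OF that] by blast
  have "minimal_sets (P \<inter> Q) \<inter> (minimal_sets P \<union> minimal_sets Q) = {}"
    using split.hyps(4) splits_minimal_sets[OF split.hyps(1)] splits_minimal_sets[OF split.hyps(2)]
      splits_minimal_sets[OF split.hyps(3)] by blast
  note min = minimal_sets_Un[OF up this]
  have "min_gens ?I = min_gens ?J \<union> min_gens ?K" "min_gens ?J \<inter> min_gens ?K = {}"
    unfolding ideal_def min_gens_ideal_of min(1) using min(2) indicat_inj by (auto simp: image_Un)
  moreover have "?I = {f + g |f g. f \<in> ?J \<and> g \<in> ?K}"
    unfolding ideal_def by (rule ideal_of_Un)
  moreover have "\<forall>i \<alpha>. betti_ideal ?I i \<alpha> = betti_ideal ?J i \<alpha> + betti_ideal ?K i \<alpha> +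
      (if i = 0 then 0 else betti_ideal (?J \<inter> ?K) (i - 1) \<alpha>)"
    unfolding L[symmetric] using un(2) by blast
  ultimately have betti: "betti_splitting ?I ?J ?K"
    unfolding betti_splitting_def
    by (intro conjI mono[OF up(1)] mono[OF up(2)] mono[OF up'])
  have "admits_minimal_pruned_resolution ?I"
    by (rule admits_minimal_pruned_resolution.splitting[OF betti])
      (simp_all add: split.IH L[symmetric])
  moreover have "\<exists>U. (i, U) \<in> A \<union> B \<union> (\<lambda>(i, U). (Suc i, U)) ` C \<and> \<alpha> = mdeg (indicat U)"
    if nz: "betti_ideal ?I i \<alpha> \<noteq> 0" for i \<alpha>
  proof -
    consider "betti_ideal ?J i \<alpha> \<noteq> 0" | "betti_ideal ?K i \<alpha> \<noteq> 0"
      | j where "i = Suc j" "betti_ideal ?L j \<alpha> \<noteq> 0"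
      using nz un(2)[of i \<alpha>] by (cases i) force+
    then show ?thesis
    proof cases
      case 1
      then show ?thesis using split.IH(1) by blast
    next
      case 2
      then show ?thesis using split.IH(2) by blast
    next
      case 3
      then obtain U where "(j, U) \<in> C" "\<alpha> = mdeg (indicat U)" using split.IH(3) by blast
      then show ?thesis using 3(1) by (intro exI[of _ U]) force
    qed
  qed
  ultimately show ?case using un(1) by blast
qed

section \<open>Paths and cycles\<close>

text \<open>Homological degrees are forgotten and only a vertex set containing all labels is kept.
  Every splitting below except those for the triangle can be verified from this bound.\<close>

definition split_on :: "'n set set \<Rightarrow> 'n set \<Rightarrow> bool" where
  "split_on P X \<longleftrightarrow> (\<exists>A. splits P A \<and> (\<forall>i U. (i, U) \<in> A \<longrightarrow> U \<subseteq> X))"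

lemma split_on_mono: "split_on P X \<Longrightarrow> X \<subseteq> Y \<Longrightarrow> split_on P Y"
  unfolding split_on_def by blast

lemma split_on_empty: "split_on {} X"
  unfolding split_on_def using splits.zero by blast

lemma split_on_principal: "U \<noteq> {} \<Longrightarrow> split_on {W. U \<subseteq> W} U"
  unfolding split_on_def by (rule exI, rule conjI, erule splits.principal) simp

lemma split_on_mult:
  assumes "split_on P X" "x \<notin> X"
  shows "split_on {W \<in> P. x \<in> W} (insert x X)"
proof -
  obtain A where A: "splits P A" "\<And>i U. (i, U) \<in> A \<Longrightarrow> U \<subseteq> X"
    using assms(1) unfolding split_on_def by blast
  have "splits {W \<in> P. x \<in> W} ((\<lambda>(i, U). (i, insert x U)) ` A)"
    by (rule splits_mult[OF A(1)]) (use A(2) assms(2) in blast)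
  moreover have "\<forall>i U. (i, U) \<in> (\<lambda>(i, U). (i, insert x U)) ` A \<longrightarrow> U \<subseteq> insert x X"
    by (auto dest!: A(2))
  ultimately show ?thesis unfolding split_on_def by blast
qed

text \<open>Labels of the intersection belong to \<open>P\<close> and to \<open>Q\<close>, so by
  \<open>deg\<close> they fit neither into \<open>X\<close> nor into \<open>Y\<close> and differ
  from all labels of the two summands.\<close>

lemma split_on_Un:
  assumes "split_on P X" "split_on Q Y" "split_on (P \<inter> Q) Z"
    and deg: "\<And>W. W \<in> P \<Longrightarrow> W \<in> Q \<Longrightarrow> \<not> W \<subseteq> X \<and> \<not> W \<subseteq> Y"
  shows "split_on (P \<union> Q) (X \<union> Y \<union> Z)"
proof -
  obtain A where A: "splits P A" "\<And>i U. (i, U) \<in> A \<Longrightarrow> U \<subseteq> X"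
    using assms(1) unfolding split_on_def by blast
  obtain B where B: "splits Q B" "\<And>i U. (i, U) \<in> B \<Longrightarrow> U \<subseteq> Y"
    using assms(2) unfolding split_on_def by blast
  obtain C where C: "splits (P \<inter> Q) C" "\<And>i U. (i, U) \<in> C \<Longrightarrow> U \<subseteq> Z"
    using assms(3) unfolding split_on_def by blast
  have "y \<notin> A \<union> B" if "y \<in> C" for y
  proof -
    obtain i U where y: "y = (i, U)" by (cases y)
    then have "U \<in> P" "U \<in> Q" using splits_label[OF C(1)] that by blast+
    then show ?thesis using deg A(2) B(2) y by blast
  qed
  then have "splits (P \<union> Q) (A \<union> B \<union> (\<lambda>(i, U). (Suc i, U)) ` C)"
    by (intro splits.split[OF A(1) B(1) C(1)]) blast
  moreover have "\<forall>i U. (i, U) \<in> A \<union> B \<union> (\<lambda>(i, U). (Suc i, U)) ` C \<longrightarrow> U \<subseteq> X \<union> Y \<union> Z"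
    by (auto dest!: A(2) B(2) C(2))
  ultimately show ?thesis unfolding split_on_def by blast
qed

lemma split_on_meets:
  fixes P :: "'n::finite set set"
  assumes "split_on P X" "W \<in> P"
  shows "W \<inter> X \<noteq> {}"
proof -
  obtain A where A: "splits P A" "\<And>i U. (i, U) \<in> A \<Longrightarrow> U \<subseteq> X"
    using assms(1) unfolding split_on_def by blast
  obtain U where U: "U \<in> minimal_sets P" "U \<subseteq> W" using minimal_set_below[OF assms(2)] .
  then have "(0, U) \<in> A" using splits_minimal_sets[OF A(1)] by simp
  then have "U \<subseteq> X" by (rule A(2))
  moreover have "U \<noteq> {}" using U(1) splits_proper[OF A(1)] by (auto simp: minimal_sets_def)
  ultimately show ?thesis using U(2) by blast
qed

text \<open>The ideals (x) and I meet in xI. A set in both families contains \<open>x\<close>, hence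
  is not inside \<open>X\<close>, and meets \<open>X\<close> by \<open>split_on_meets\<close>, hence
  is not inside \<open>{x}\<close>.\<close>

lemma split_on_add_var:
  fixes P :: "'n::finite set set"
  assumes P: "split_on P X" "x \<notin> X"
  shows "split_on ({W. x \<in> W} \<union> P) (insert x X)"
proof -
  have x: "split_on {W. x \<in> W} {x}" using split_on_principal[of "{x}"] by simp
  have "{W. x \<in> W} \<inter> P = {W \<in> P. x \<in> W}" by blast
  then have L: "split_on ({W. x \<in> W} \<inter> P) (insert x X)"
    using split_on_mult[OF P] by simp
  have "split_on ({W. x \<in> W} \<union> P) ({x} \<union> X \<union> insert x X)"
  proof (rule split_on_Un[OF x P(1) L])
    fix W assume "W \<in> {W. x \<in> W}" "W \<in> P"
    then show "\<not> W \<subseteq> {x} \<and> \<not> W \<subseteq> X"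
      using split_on_meets[OF P(1), of W] P(2) by blast
  qed
  then show ?thesis by (rule split_on_mono) blast
qed

section \<open>Families of paths and closed paths\<close>

locale vertex_sequence =
  fixes p :: "nat \<Rightarrow> 'n::finite" and N :: nat
  assumes inj: "inj_on p {..<N}"
begin

definition path :: "nat \<Rightarrow> nat \<Rightarrow> 'n set set" where
  "path a b = {W. \<exists>i. a \<le> i \<and> i < b \<and> p i \<in> W \<and> p (Suc i) \<in> W}"

definition closed_path :: "nat \<Rightarrow> nat \<Rightarrow> 'n set set" where
  "closed_path a b = path a b \<union> {W. p a \<in> W \<and> p b \<in> W}"

lemma p_eq: "i < N \<Longrightarrow> j < N \<Longrightarrow> p i = p j \<longleftrightarrow> i = j"
  using inj_on_eq_iff[OF inj, of i j] by simp

lemma p_segment: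
  assumes "i < N" "b < N"
  shows "p i \<in> p ` {a..b} \<longleftrightarrow> a \<le> i \<and> i \<le> b"
proof -
  have "{a..b} \<subseteq> {..<N}" using assms(2) by auto
  then show ?thesis using inj_on_image_mem_iff[OF inj, of i "{a..b}"] assms(1) by simp
qed

lemma pathE:
  assumes "W \<in> path a b"
  obtains i where "a \<le> i" "i < b" "p i \<in> W" "p (Suc i) \<in> W"
  using assms unfolding path_def by blast

lemma pathI: "a \<le> i \<Longrightarrow> i < b \<Longrightarrow> p i \<in> W \<Longrightarrow> p (Suc i) \<in> W \<Longrightarrow> W \<in> path a b"
  unfolding path_def by blast

lemma path_mono:
  assumes "a' \<le> a" "b \<le> b'"
  shows "path a b \<subseteq> path a' b'"
proof
  fix W assume "W \<in> path a b"
  then obtain i where "a \<le> i" "i < b" "p i \<in> W" "p (Suc i) \<in> W" by (rule pathE)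
  then show "W \<in> path a' b'" using assms by (intro pathI[of a' i b']) simp_all
qed

lemma path_empty: "b \<le> a \<Longrightarrow> path a b = {}"
  unfolding path_def by auto

lemma path_edge: "path a (Suc a) = {W. {p a, p (Suc a)} \<subseteq> W}"
proof (intro set_eqI iffI)
  fix W assume "W \<in> path a (Suc a)"
  then obtain i where i: "a \<le> i" "i < Suc a" "p i \<in> W" "p (Suc i) \<in> W" by (rule pathE)
  have "i = a" using i(1,2) by simp
  then show "W \<in> {W. {p a, p (Suc a)} \<subseteq> W}" using i(3,4) by simp
next
  fix W assume "W \<in> {W. {p a, p (Suc a)} \<subseteq> W}"
  then show "W \<in> path a (Suc a)" by (intro pathI[of a a]) simp_all
qed

text \<open>The first edge is split off. A set in both summands contains \<open>p a\<close>, which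
  the remaining path avoids, and also a vertex of that path beyond the first edge.\<close>

lemma split_on_path:
  assumes "b < N"
  shows "split_on (path a b) (p ` {a..b})"
proof (induction "b - a" arbitrary: a rule: less_induct)
  case less
  show ?case
  proof (cases "b \<le> Suc a")
    case True
    show ?thesis
    proof (cases "b = Suc a")
      case True
      then have eq: "path a b = {W. {p a, p (Suc a)} \<subseteq> W}" using path_edge by simp
      show ?thesis unfolding eq by (rule split_on_mono[OF split_on_principal]) (use True in auto)
    next
      case False
      then have "path a b = {}" using \<open>b \<le> Suc a\<close> by (intro path_empty) simp
      then show ?thesis by (simp add: split_on_empty)
    qed
  next
    case False
    then have ab: "Suc (Suc a) \<le> b" by simp
    let ?J = "{W. {p a, p (Suc a)} \<subseteq> W}" and ?K = "path (Suc a) b"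
    \<comment> \<open>The intersection is \<open>?M\<close> multiplied by the first two variables:
      the edge following the split-off one contributes just the variable
      \<open>p (Suc (Suc a))\<close>, which absorbs the edge after it.\<close>
    let ?M = "{W. p (Suc (Suc a)) \<in> W} \<union> path (Suc (Suc (Suc a))) b"
    have J: "split_on ?J {p a, p (Suc a)}" by (rule split_on_principal) simp
    have K: "split_on ?K (p ` {Suc a..b})" using less ab by simp
    have "split_on (path (Suc (Suc (Suc a))) b) (p ` {Suc (Suc (Suc a))..b})" using less ab by simp
    then have "split_on ?M (insert (p (Suc (Suc a))) (p ` {Suc (Suc (Suc a))..b}))"
      by (rule split_on_add_var) (use assms ab in \<open>simp add: p_segment\<close>)
    then have M: "split_on ?M (p ` {Suc (Suc a)..b})"
      by (rule split_on_mono) (use ab in auto)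
    have "split_on {W \<in> ?M. p (Suc a) \<in> W} (insert (p (Suc a)) (p ` {Suc (Suc a)..b}))"
      by (rule split_on_mult[OF M]) (use assms ab in \<open>simp add: p_segment\<close>)
    then have "split_on {W \<in> ?M. p (Suc a) \<in> W} (p ` {Suc a..b})"
      by (rule split_on_mono) (use ab in auto)
    then have L: "split_on {W \<in> {W \<in> ?M. p (Suc a) \<in> W}. p a \<in> W} (insert (p a) (p ` {Suc a..b}))"
      by (rule split_on_mult) (use assms ab in \<open>simp add: p_segment\<close>)
    have eqL: "?J \<inter> ?K = {W \<in> {W \<in> ?M. p (Suc a) \<in> W}. p a \<in> W}"
    proof (intro set_eqI iffI)
      fix W assume W: "W \<in> ?J \<inter> ?K"
      then have "W \<in> ?K" by blast
      then obtain i where i: "Suc a \<le> i" "i < b" "p i \<in> W" "p (Suc i) \<in> W" by (rule pathE)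
      then consider "i = Suc a" | "i = Suc (Suc a)" | "Suc (Suc (Suc a)) \<le> i" by linarith
      then have "W \<in> ?M" using i pathI[of "Suc (Suc (Suc a))" i b W] by cases simp_all
      then show "W \<in> {W \<in> {W \<in> ?M. p (Suc a) \<in> W}. p a \<in> W}" using W by simp
    next
      fix W assume W: "W \<in> {W \<in> {W \<in> ?M. p (Suc a) \<in> W}. p a \<in> W}"
      then have "W \<in> ?K"
        using ab pathI[of "Suc a" "Suc a" b W] path_mono[of "Suc a" "Suc (Suc (Suc a))" b b] by auto
      then show "W \<in> ?J \<inter> ?K" using W by simp
    qed
    have "split_on (?J \<union> ?K) ({p a, p (Suc a)} \<union> p ` {Suc a..b} \<union> insert (p a) (p ` {Suc a..b}))"
    proof (rule split_on_Un[OF J K])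
      show "split_on (?J \<inter> ?K) (insert (p a) (p ` {Suc a..b}))" unfolding eqL by (rule L)
      fix W assume WJ: "W \<in> ?J" and WK: "W \<in> ?K"
      have "p a \<notin> p ` {Suc a..b}" using assms ab by (simp add: p_segment)
      then have "\<not> W \<subseteq> p ` {Suc a..b}" using WJ by blast
      moreover obtain i where i: "Suc a \<le> i" "i < b" "p (Suc i) \<in> W" using WK by (rule pathE)
      then have "p (Suc i) \<notin> {p a, p (Suc a)}" using p_eq[of "Suc i"] assms by auto
      ultimately show "\<not> W \<subseteq> {p a, p (Suc a)} \<and> \<not> W \<subseteq> p ` {Suc a..b}" using i(3) by blast
    qed
    moreover have eq: "path a b = ?J \<union> ?K"
    proof (intro set_eqI iffI)
      fix W assume "W \<in> path a b"
      then obtain i where i: "a \<le> i" "i < b" "p i \<in> W" "p (Suc i) \<in> W" by (rule pathE)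
      then show "W \<in> ?J \<union> ?K" using pathI[of "Suc a" i b W] by (cases "i = a") simp_all
    next
      fix W assume "W \<in> ?J \<union> ?K"
      then show "W \<in> path a b" using ab pathI[of a a b W] path_mono[of a "Suc a" b b] by auto
    qed
    ultimately have "split_on (path a b) ({p a, p (Suc a)} \<union> p ` {Suc a..b} \<union> insert (p a) (p ` {Suc a..b}))"
      by (simp only: eq)
    then show ?thesis by (rule split_on_mono) (use ab in auto)
  qed
qed

text \<open>The set \<open>{x, y, z}\<close> labels \<open>J\<close> at index 1 and the intersection
  at index 0. Bounds on vertex sets cannot separate these, so the labels are computed explicitly
  with their homological degrees.\<close>

lemma split_on_triangle:
  assumes "Suc (Suc a) < N"
  shows "split_on (closed_path a (Suc (Suc a))) (p ` {a..Suc (Suc a)})"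
proof -
  define x y z where "x = p a" and "y = p (Suc a)" and "z = p (Suc (Suc a))"
  have ne: "x \<noteq> y" "x \<noteq> z" "y \<noteq> z" using assms by (simp_all add: x_def y_def z_def p_eq)
  have "splits {W. {y} \<subseteq> W} {(0, {y})}" "splits {W. {z} \<subseteq> W} {(0, {z})}"
    by (rule splits.principal; simp)+
  moreover have "{W. {y} \<subseteq> W} \<inter> {W. {z} \<subseteq> W} = {W. {y, z} \<subseteq> W}" by auto
  then have "splits ({W. {y} \<subseteq> W} \<inter> {W. {z} \<subseteq> W}) {(0, {y, z})}"
    using splits.principal[of "{y, z}"] by (simp del: insert_subset)
  moreover have "{(0, {y, z})} \<inter> ({(0, {y})} \<union> {(0::nat, {z})}) = {}" using ne by auto
  ultimately have "splits ({W. {y} \<subseteq> W} \<union> {W. {z} \<subseteq> W})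
      ({(0, {y})} \<union> {(0, {z})} \<union> (\<lambda>(i, U). (Suc i, U)) ` {(0, {y, z})})"
    by (rule splits.split)
  then have "splits {W \<in> {W. {y} \<subseteq> W} \<union> {W. {z} \<subseteq> W}. x \<in> W}
      ((\<lambda>(i, U). (i, insert x U)) ` ({(0, {y})} \<union> {(0, {z})} \<union> (\<lambda>(i, U). (Suc i, U)) ` {(0, {y, z})}))"
    by (rule splits_mult) (use ne in auto)
  moreover have "{W \<in> {W. {y} \<subseteq> W} \<union> {W. {z} \<subseteq> W}. x \<in> W} = {W. x \<in> W \<and> (y \<in> W \<or> z \<in> W)}" by auto
  ultimately have J: "splits {W. x \<in> W \<and> (y \<in> W \<or> z \<in> W)} {(0, {x, y}), (0, {x, z}), (1, {x, y, z})}"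
    by (simp add: insert_commute)
  have K: "splits {W. {y, z} \<subseteq> W} {(0, {y, z})}" by (rule splits.principal) simp
  have "{W. x \<in> W \<and> (y \<in> W \<or> z \<in> W)} \<inter> {W. {y, z} \<subseteq> W} = {W. {x, y, z} \<subseteq> W}" by auto
  then have L: "splits ({W. x \<in> W \<and> (y \<in> W \<or> z \<in> W)} \<inter> {W. {y, z} \<subseteq> W}) {(0, {x, y, z})}"
    using splits.principal[of "{x, y, z}"] by (simp del: insert_subset)
  have "z \<notin> {x, y}" "y \<notin> {x, z}" "x \<notin> {y, z}" using ne by auto
  then have "{x, y, z} \<noteq> {x, y}" "{x, y, z} \<noteq> {x, z}" "{x, y, z} \<noteq> {y, z}"
    by (metis insertCI)+
  then have "{(0, {x, y, z})} \<inter> ({(0, {x, y}), (0, {x, z}), (1, {x, y, z})} \<union> {(0::nat, {y, z})}) = {}"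
    by simp
  note s = splits.split[OF J K L this]
  have "path a (Suc (Suc a)) = path a (Suc a) \<union> path (Suc a) (Suc (Suc a))"
  proof (intro set_eqI iffI)
    fix W assume "W \<in> path a (Suc (Suc a))"
    then obtain i where i: "a \<le> i" "i < Suc (Suc a)" "p i \<in> W" "p (Suc i) \<in> W" by (rule pathE)
    have "i = a \<or> i = Suc a" using i(1,2) by auto
    then show "W \<in> path a (Suc a) \<union> path (Suc a) (Suc (Suc a))"
      using i(3,4) unfolding path_edge by auto
  next
    fix W assume "W \<in> path a (Suc a) \<union> path (Suc a) (Suc (Suc a))"
    then show "W \<in> path a (Suc (Suc a))"
      using path_mono[of a a "Suc a" "Suc (Suc a)"] path_mono[of a "Suc a" "Suc (Suc a)" "Suc (Suc a)"]
      by auto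
  qed
  then have eq: "closed_path a (Suc (Suc a)) = {W. x \<in> W \<and> (y \<in> W \<or> z \<in> W)} \<union> {W. {y, z} \<subseteq> W}"
    unfolding closed_path_def path_edge by (auto simp: x_def y_def z_def)
  have "{a..Suc (Suc a)} = {a, Suc a, Suc (Suc a)}" by auto
  then have X: "p ` {a..Suc (Suc a)} = {x, y, z}" by (simp add: x_def y_def z_def)
  show ?thesis
    unfolding split_on_def eq X by (rule exI, rule conjI[OF s]) auto
qed

text \<open>
  The induction passes from cycles of length \<open>m \<ge> 4\<close> to cycles of length \<open>m - 3\<close>, where
  cycles of length 1 and 2 have to be read as a single vertex and a single edge.
\<close>

lemma split_on_closed_path:
  assumes "a \<le> b" "b < N"
  shows "split_on (closed_path a b) (p ` {a..b})"
  using assms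
proof (induction "b - a" arbitrary: a b rule: less_induct)
  case less
  \<comment> \<open>In the last case there are at least four vertices. Deleting \<open>p a\<close>,
    \<open>p (Suc a)\<close> and \<open>p b\<close> leaves the segment from
    \<open>Suc (Suc a)\<close> to \<open>Suc e\<close>, which is nonempty by
    \<open>Suc a \<le> e\<close>.\<close>
  consider "b = a" | "b = Suc a" | "b = Suc (Suc a)" | e where "b = Suc (Suc e)" "Suc a \<le> e"
  proof -
    have "b = Suc (Suc (b - 2))" "Suc a \<le> b - 2" if "b \<noteq> a" "b \<noteq> Suc a" "b \<noteq> Suc (Suc a)"
      using that less.prems by auto
    then show ?thesis using that by metis
  qed
  then show ?case
  proof cases
    case 1
    then have "closed_path a b = {W. {p a} \<subseteq> W}" by (simp add: closed_path_def path_empty)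
    then show ?thesis using 1 split_on_principal[of "{p a}"] by simp
  next
    case 2
    then have eq: "closed_path a b = {W. {p a, p b} \<subseteq> W}"
      by (simp add: closed_path_def path_edge)
    show ?thesis unfolding eq by (rule split_on_mono[OF split_on_principal]) (use 2 in auto)
  next
    case 3
    then show ?thesis using split_on_triangle less.prems by simp
  next
    case (4 e)
    have N: "Suc (Suc e) < N" using less.prems 4 by simp
    note ae = \<open>Suc a \<le> e\<close>
    \<comment> \<open>Here \<open>p a\<close> is the distinguished vertex, with neighbours
      \<open>p (Suc a)\<close> and \<open>p b\<close>.\<close>
    let ?J = "{W. p a \<in> W \<and> (p (Suc a) \<in> W \<or> p b \<in> W)}" and ?K = "path (Suc a) b"
    \<comment> \<open>\<open>?M1\<close> and \<open>?M2\<close> are the two parts of the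
      intersection after division by \<open>p a\<close>. The edge from \<open>p (Suc e)\<close> to
      \<open>p b\<close> is left out of \<open>?M1\<close>, since its product with
      \<open>p (Suc a)\<close> already lies in \<open>?M2\<close>; symmetrically for the first edge.
      This keeps \<open>p b\<close> out of the labels of \<open>?M1\<close> and
      \<open>p (Suc a)\<close> out of those of \<open>?M2\<close>, as the support test
      requires.\<close>
    let ?M1 = "{W \<in> {W. p (Suc (Suc a)) \<in> W} \<union> path (Suc (Suc (Suc a))) (Suc e). p (Suc a) \<in> W}"
    let ?M2 = "{W \<in> {W. p (Suc e) \<in> W} \<union> path (Suc (Suc a)) e. p b \<in> W}"
    let ?C = "closed_path (Suc (Suc a)) (Suc e)"
    have M1: "split_on ?M1 (p ` {Suc a..Suc e})"
    proof -
      have "split_on (path (Suc (Suc (Suc a))) (Suc e)) (p ` {Suc (Suc (Suc a))..Suc e})"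
        using split_on_path N by simp
      then have "split_on ({W. p (Suc (Suc a)) \<in> W} \<union> path (Suc (Suc (Suc a))) (Suc e))
          (insert (p (Suc (Suc a))) (p ` {Suc (Suc (Suc a))..Suc e}))"
        by (rule split_on_add_var) (use N ae in \<open>simp add: p_segment\<close>)
      then have "split_on ?M1 (insert (p (Suc a)) (insert (p (Suc (Suc a))) (p ` {Suc (Suc (Suc a))..Suc e})))"
        by (rule split_on_mult) (use N ae in \<open>simp add: p_segment p_eq\<close>)
      then show ?thesis by (rule split_on_mono) (use ae in auto)
    qed
    have M2: "split_on ?M2 (p ` {Suc (Suc a)..b})"
    proof -
      have "split_on (path (Suc (Suc a)) e) (p ` {Suc (Suc a)..e})"
        using split_on_path N by simp
      then have "split_on ({W. p (Suc e) \<in> W} \<union> path (Suc (Suc a)) e)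
          (insert (p (Suc e)) (p ` {Suc (Suc a)..e}))"
        by (rule split_on_add_var) (use N ae in \<open>simp add: p_segment\<close>)
      then have "split_on ?M2 (insert (p b) (insert (p (Suc e)) (p ` {Suc (Suc a)..e})))"
        by (rule split_on_mult) (use N ae 4 in \<open>simp add: p_segment p_eq\<close>)
      then show ?thesis by (rule split_on_mono) (use ae 4 in auto)
    qed
    have M12: "split_on (?M1 \<inter> ?M2) (p ` {Suc a..b})"
    proof -
      have "split_on ?C (p ` {Suc (Suc a)..Suc e})"
        by (rule less.hyps) (use ae N 4 in auto)
      then have "split_on {W \<in> ?C. p b \<in> W} (insert (p b) (p ` {Suc (Suc a)..Suc e}))"
        by (rule split_on_mult) (use N 4 in \<open>simp add: p_segment\<close>)
      then have "split_on {W \<in> {W \<in> ?C. p b \<in> W}. p (Suc a) \<in> W}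
          (insert (p (Suc a)) (insert (p b) (p ` {Suc (Suc a)..Suc e})))"
        by (rule split_on_mult) (use N ae 4 in \<open>simp add: p_segment p_eq\<close>)
      moreover have "?M1 \<inter> ?M2 = {W \<in> {W \<in> ?C. p b \<in> W}. p (Suc a) \<in> W}"
      proof -
        \<comment> \<open>Every edge of the remaining segment lies in both factors, and the two end
          variables multiply to the edge that closes the cycle.\<close>
        have "(p (Suc (Suc a)) \<in> W \<or> W \<in> path (Suc (Suc (Suc a))) (Suc e)) \<and>
            (p (Suc e) \<in> W \<or> W \<in> path (Suc (Suc a)) e) \<longleftrightarrow> W \<in> ?C" (is "?l \<longleftrightarrow> _") for W
        proof
          assume ?l
          moreover have "path (Suc (Suc (Suc a))) (Suc e) \<subseteq> path (Suc (Suc a)) (Suc e)"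
            "path (Suc (Suc a)) e \<subseteq> path (Suc (Suc a)) (Suc e)"
            by (rule path_mono; simp)+
          ultimately show "W \<in> ?C" unfolding closed_path_def by blast
        next
          assume "W \<in> ?C"
          then consider i where "Suc (Suc a) \<le> i" "i < Suc e" "p i \<in> W" "p (Suc i) \<in> W"
            | "p (Suc (Suc a)) \<in> W" "p (Suc e) \<in> W"
            unfolding closed_path_def path_def by blast
          then show ?l
          proof cases
            case 1
            have "p (Suc (Suc a)) \<in> W \<or> W \<in> path (Suc (Suc (Suc a))) (Suc e)"
              using 1 pathI[of "Suc (Suc (Suc a))" i "Suc e" W] by (cases "i = Suc (Suc a)") simp_all
            moreover have "p (Suc e) \<in> W \<or> W \<in> path (Suc (Suc a)) e"
              using 1 pathI[of "Suc (Suc a)" i e W] by (cases "i = e") simp_all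
            ultimately show ?thesis by blast
          qed blast
        qed
        then show ?thesis by blast
      qed
      ultimately have "split_on (?M1 \<inter> ?M2) (insert (p (Suc a)) (insert (p b) (p ` {Suc (Suc a)..Suc e})))"
        by (simp only:)
      then show ?thesis by (rule split_on_mono) (use 4 ae in auto)
    qed
    have M: "split_on (?M1 \<union> ?M2) (p ` {Suc a..b})"
    proof -
      have "split_on (?M1 \<union> ?M2) (p ` {Suc a..Suc e} \<union> p ` {Suc (Suc a)..b} \<union> p ` {Suc a..b})"
      proof (rule split_on_Un[OF M1 M2 M12])
        fix W assume W: "W \<in> ?M1" "W \<in> ?M2"
        have "p b \<notin> p ` {Suc a..Suc e}" "p (Suc a) \<notin> p ` {Suc (Suc a)..b}"
          using N ae 4 by (simp_all add: p_segment)
        then show "\<not> W \<subseteq> p ` {Suc a..Suc e} \<and> \<not> W \<subseteq> p ` {Suc (Suc a)..b}" using W by blast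
      qed
      then show ?thesis by (rule split_on_mono) (use 4 ae in auto)
    qed
    have eqL: "?J \<inter> ?K = {W \<in> ?M1 \<union> ?M2. p a \<in> W}"
    proof (intro set_eqI iffI)
      fix W assume W: "W \<in> ?J \<inter> ?K"
      then have "W \<in> ?K" by blast
      then obtain i where i: "Suc a \<le> i" "i < b" "p i \<in> W" "p (Suc i) \<in> W" by (rule pathE)
      \<comment> \<open>The first edge of the path always leads to \<open>?M1\<close> and the last
        one to \<open>?M2\<close>. For an edge in between, the neighbour of \<open>p a\<close>
        contained in \<open>W\<close> decides.\<close>
      have "W \<in> ?M1" if "p (Suc a) \<in> W" "i < Suc e"
      proof -
        consider "i = Suc a" | "i = Suc (Suc a)" | "Suc (Suc (Suc a)) \<le> i" using i(1) by linarith
        then show ?thesis using i that pathI[of "Suc (Suc (Suc a))" i "Suc e" W] by cases simp_all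
      qed
      moreover have "W \<in> ?M2" if "i = Suc e" using i that 4 by simp
      moreover have "W \<in> ?M2" if "p b \<in> W" "i \<noteq> Suc a"
      proof -
        consider "i = Suc e" | "i = e" | "i < e" using i(2) 4 by linarith
        then show ?thesis using i that pathI[of "Suc (Suc a)" i e W] by cases simp_all
      qed
      moreover have "W \<in> ?M1" if "i = Suc a" using i that by simp
      moreover have "i < Suc e \<or> i = Suc e" using i(2) 4 by linarith
      ultimately show "W \<in> {W \<in> ?M1 \<union> ?M2. p a \<in> W}" using W by blast
    next
      fix W assume W: "W \<in> {W \<in> ?M1 \<union> ?M2. p a \<in> W}"
      have "path (Suc (Suc (Suc a))) (Suc e) \<subseteq> ?K" "path (Suc (Suc a)) e \<subseteq> ?K"
        by (rule path_mono; use 4 in simp)+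
      moreover have "W \<in> ?K" if "p (Suc a) \<in> W" "p (Suc (Suc a)) \<in> W"
        using that 4 ae by (intro pathI[of _ "Suc a"]) auto
      moreover have "W \<in> ?K" if "p (Suc e) \<in> W" "p b \<in> W"
        using that 4 ae by (intro pathI[of _ "Suc e"]) auto
      ultimately show "W \<in> ?J \<inter> ?K" using W by blast
    qed
    have J: "split_on ?J {p a, p (Suc a), p b}"
    proof -
      have "split_on {W. p b \<in> W} {p b}" using split_on_principal[of "{p b}"] by simp
      then have "split_on ({W. p (Suc a) \<in> W} \<union> {W. p b \<in> W}) {p (Suc a), p b}"
        by (rule split_on_add_var) (use N ae 4 in \<open>simp add: p_eq\<close>)
      then have "split_on {W \<in> {W. p (Suc a) \<in> W} \<union> {W. p b \<in> W}. p a \<in> W} {p a, p (Suc a), p b}"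
        by (rule split_on_mult) (use N ae 4 in \<open>simp add: p_eq\<close>)
      moreover have "{W \<in> {W. p (Suc a) \<in> W} \<union> {W. p b \<in> W}. p a \<in> W} = ?J" by blast
      ultimately show ?thesis by simp
    qed
    have K: "split_on ?K (p ` {Suc a..b})" using split_on_path N 4 by simp
    have pa: "p a \<notin> p ` {Suc a..b}" using N ae 4 by (simp add: p_segment)
    have "split_on (?J \<union> ?K) ({p a, p (Suc a), p b} \<union> p ` {Suc a..b} \<union> insert (p a) (p ` {Suc a..b}))"
    proof (rule split_on_Un[OF J K])
      show "split_on (?J \<inter> ?K) (insert (p a) (p ` {Suc a..b}))"
        unfolding eqL by (rule split_on_mult[OF M pa])
      fix W assume WJ: "W \<in> ?J" and WK: "W \<in> ?K"
      obtain i where i: "Suc a \<le> i" "i < b" "p i \<in> W" "p (Suc i) \<in> W" using WK by (rule pathE)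
      \<comment> \<open>Some end of the edge is an inner vertex of the path: \<open>i\<close> itself
        unless \<open>i = Suc a\<close>, and then its successor, which is not \<open>b\<close>
        because the cycle has at least four vertices.\<close>
      define j where "j = (if i = Suc a then Suc (Suc a) else i)"
      have "p j \<in> W" "j \<noteq> a" "j \<noteq> Suc a" "j \<noteq> b" "j < N"
        using i ae 4 N by (auto simp: j_def)
      then have "p j \<notin> {p a, p (Suc a), p b}" using N ae 4 by (simp add: p_eq)
      then show "\<not> W \<subseteq> {p a, p (Suc a), p b} \<and> \<not> W \<subseteq> p ` {Suc a..b}"
        using \<open>p j \<in> W\<close> WJ pa by blast
    qed
    moreover have eq: "closed_path a b = ?J \<union> ?K"
    proof (intro set_eqI iffI)
      fix W assume "W \<in> closed_path a b"
      then consider i where "a \<le> i" "i < b" "p i \<in> W" "p (Suc i) \<in> W" | "p a \<in> W" "p b \<in> W"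
        unfolding closed_path_def path_def by blast
      then show "W \<in> ?J \<union> ?K"
      proof cases
        case 1
        then show ?thesis using pathI[of "Suc a" i b W] by (cases "i = a") simp_all
      qed blast
    next
      fix W assume "W \<in> ?J \<union> ?K"
      moreover have "?K \<subseteq> path a b" by (rule path_mono) simp_all
      moreover have "W \<in> path a b" if "p a \<in> W" "p (Suc a) \<in> W"
        using that 4 ae by (intro pathI[of _ a]) auto
      ultimately show "W \<in> closed_path a b" unfolding closed_path_def by blast
    qed
    ultimately have "split_on (closed_path a b)
        ({p a, p (Suc a), p b} \<union> p ` {Suc a..b} \<union> insert (p a) (p ` {Suc a..b}))"
      by (simp only: eq)
    then show ?thesis by (rule split_on_mono) (use 4 ae in auto)
  qed
qed

end

section \<open>The edge ideal of a cycle\<close>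

lemma edge_ideal_eq:
  assumes "simple_graph E"
  shows "edge_ideal E = (ideal_of {W. \<exists>U\<in>E. U \<subseteq> W} :: ('n, 'k::field) mpoly set)"
proof -
  have prod: "var u * var v = (monom (indicat {u, v}) :: ('n, 'k) mpoly)" if "u \<noteq> v" for u v :: 'n
    using that by (auto simp: var_def monom_def mult_single indicat_def fun_eq_iff
        intro!: arg_cong2[where f = Poly_Mapping.single])
  have "{var u * var v | u v. u \<noteq> v \<and> {u, v} \<in> E} = (monom ` indicat ` E :: ('n, 'k) mpoly set)"
  proof (intro set_eqI iffI)
    fix f :: "('n, 'k) mpoly" assume "f \<in> {var u * var v | u v. u \<noteq> v \<and> {u, v} \<in> E}"
    then show "f \<in> monom ` indicat ` E" using prod by auto
  next
    fix f :: "('n, 'k) mpoly" assume "f \<in> monom ` indicat ` E"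
    then obtain U where U: "U \<in> E" "f = monom (indicat U)" by blast
    then obtain u v where "U = {u, v}" "u \<noteq> v"
      using assms unfolding simple_graph_def by (metis card_2_iff)
    then have "f = var u * var v \<and> u \<noteq> v \<and> {u, v} \<in> E" using U prod by simp
    then show "f \<in> {var u * var v | u v. u \<noteq> v \<and> {u, v} \<in> E}" by blast
  qed
  moreover have "upset_gen (indicat ` E) = degrees {W. \<exists>U\<in>E. U \<subseteq> W}"
    by (auto simp: upset_gen_def degrees_def mdeg_indicat_le)
  ultimately show ?thesis by (simp add: edge_ideal_def ideal_of_def ideal_gen_monom)
qed

theorem corollary6p21:
  fixes E :: "'n::finite set set"
  assumes "cycle_graph E"
  shows "admits_minimal_pruned_resolution (edge_ideal E :: ('n, 'k::field) mpoly set)"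
proof -
  let ?N = "CARD('n)"
  have N: "?N \<ge> 3" and simple: "simple_graph E" using assms by (auto simp: cycle_graph_def)
  obtain p where p: "bij_betw p {..<?N} (UNIV :: 'n set)"
    and E: "E = {{p i, p (Suc i mod ?N)} | i. i < ?N}"
    using assms unfolding cycle_graph_def by blast
  interpret vertex_sequence p ?N
    by unfold_locales (use p in \<open>simp add: bij_betw_def\<close>)
  \<comment> \<open>Only the index \<open>?N - 1\<close> wraps around modulo \<open>?N\<close>; it
    gives the joining edge of \<open>closed_path\<close>, and all other indices give edges of the
    path.\<close>
  have eq: "{W. \<exists>U\<in>E. U \<subseteq> W} = closed_path 0 (?N - 1)"
  proof (intro set_eqI iffI)
    fix W assume "W \<in> {W. \<exists>U\<in>E. U \<subseteq> W}"
    then obtain i where i: "i < ?N" "p i \<in> W" "p (Suc i mod ?N) \<in> W" unfolding E by blast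
    show "W \<in> closed_path 0 (?N - 1)"
    proof (cases "Suc i = ?N")
      case True
      then have "i = ?N - 1" by simp
      then show ?thesis using i True by (simp add: closed_path_def)
    next
      case False
      then have "i < ?N - 1" "Suc i mod ?N = Suc i" using i(1) by auto
      then show ?thesis using i pathI[of 0 i "?N - 1" W] by (simp add: closed_path_def)
    qed
  next
    fix W assume "W \<in> closed_path 0 (?N - 1)"
    then consider i where "i < ?N - 1" "p i \<in> W" "p (Suc i) \<in> W" | "p 0 \<in> W" "p (?N - 1) \<in> W"
      unfolding closed_path_def path_def by blast
    then show "W \<in> {W. \<exists>U\<in>E. U \<subseteq> W}"
    proof cases
      case 1
      then have "{p i, p (Suc i mod ?N)} \<in> E" "{p i, p (Suc i mod ?N)} \<subseteq> W" unfolding E by auto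
      then show ?thesis by blast
    next
      case 2
      have "Suc (?N - 1) mod ?N = 0" "?N - 1 < ?N" using N by auto
      moreover from this(2) have "{p (?N - 1), p (Suc (?N - 1) mod ?N)} \<in> E" unfolding E by blast
      ultimately have "{p (?N - 1), p 0} \<in> E" by (simp only:)
      moreover have "{p (?N - 1), p 0} \<subseteq> W" using 2 by simp
      ultimately show ?thesis by (intro CollectI bexI)
    qed
  qed
  have "split_on (closed_path 0 (?N - 1)) (p ` {0..?N - 1})"
    by (rule split_on_closed_path) (use N in auto)
  then obtain A where A: "splits (closed_path 0 (?N - 1)) A" unfolding split_on_def by blast
  show ?thesis
    unfolding edge_ideal_eq[OF simple] eq by (rule splits_admits[OF A, THEN conjunct2, THEN conjunct1])
qed

end
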